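(* Let $\lambda$ be a nonzero real number. Let $Q\in C^2([0,\infty))$ be complex-valued with $Q(0)=0$, and let $q$ be the unique global classical solution, $q\in C^1([0,\infty);L^2(0,\infty))\cap C^0([0,\infty);H^2(0,\infty))$, of $$\mathrm{i}q_t+q_{xx}-2\lambda|q|^2q=0\quad (x>0,\ t>0),\qquad q(x,0)=0\ (x\ge 0),\qquad q(0,t)=Q(t)\ (t\ge 0).$$ If $\lambda<0$, assume in addition that $\|q(0,\cdot)\|_{L^2(0,t)}^2\le c_2$ uniformly in $t\ge 0$, for some sufficiently small $c_2>0$. Suppose that, as $t\to\infty$, $q(0,t)=\mathcal{O}(t^{-\alpha})$ and $q_t(0,t)=\mathcal{O}(t^{-\beta})$ with $\alpha,\beta>1/2$. Then: (1) $\displaystyle\int_0^\infty|q_x(0,t)|^2\,dt<\infty$. (2) There exists $c>0$ independent of $t$ such that $\|q(\cdot,t)\|\le c$ and $\|q_x(\cdot,t)\|\le c$ for all $t\ge 0$. (3) There exists $c>0$ independent of $t$ such that for all $t\ge 0$ and all $x$, $|q(x,t)|\le c\,\|q(\cdot,t)\|^{1/2}\|q_x(\cdot,t)\|^{1/2}\le c$; consequently, for any $x$, $\lim_{t\to\infty}|q(x,t)|\le c$ if this limit exists.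
   Context: $\|\cdot\|$ denotes the $L^2(0,\infty)$ norm in the space variable $x$; $\|\cdot\|_{L^2(0,t)}$ denotes the $L^2$ norm in the time variable over $(0,t)$. The constant $c$ may differ from one occurrence to the next. Existence and uniqueness of the global classical solution $q$ is known (Carroll–Bu). "Sufficiently small" means that there is a threshold (depending only on $\lambda$) below which $c_2$ is to be taken. *)

theory Defs
  imports "HOL-Analysis.Analysis" "HOL-Library.Landau_Symbols"
begin

definition L2_on :: "real set \<Rightarrow> (real \<Rightarrow> complex) \<Rightarrow> bool" where
  "L2_on S f \<longleftrightarrow> set_borel_measurable lborel S f \<and>
     set_integrable lborel S (\<lambda>x. (cmod (f x))\<^sup>2)"

(* Only meaningful together with L2_on: for a non-integrable square the
   Bochner integral, and hence L2_norm, is 0 by convention. *)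
definition L2_norm :: "real set \<Rightarrow> (real \<Rightarrow> complex) \<Rightarrow> real" where
  "L2_norm S f = sqrt (LINT x:S|lborel. (cmod (f x))\<^sup>2)"

abbreviation half_line :: "real set" where
  "half_line \<equiv> {0<..}"

(* phi is in C^1_c(0,\<infinity>), with derivative phi'. *)
definition test_function :: "(real \<Rightarrow> real) \<Rightarrow> (real \<Rightarrow> real) \<Rightarrow> bool" where
  "test_function phi phi' \<longleftrightarrow>
     (\<forall>x. (phi has_real_derivative phi' x) (at x)) \<and> continuous_on UNIV phi' \<and>
     (\<exists>a b. 0 < a \<and> (\<forall>x. x \<notin> {a..b} \<longrightarrow> phi x = 0))"

(* Test functions in C^1_c, as in Brezis, "Functional Analysis, Sobolev Spaces
   and PDE", Section 8.2; real test functions suffice for complex f by linearity. *)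
definition weak_derivative :: "(real \<Rightarrow> complex) \<Rightarrow> (real \<Rightarrow> complex) \<Rightarrow> bool" where
  "weak_derivative f g \<longleftrightarrow>
     (\<forall>phi phi'. test_function phi phi' \<longrightarrow>
        (LINT x:half_line|lborel. phi' x *\<^sub>R f x) = - (LINT x:half_line|lborel. phi x *\<^sub>R g x))"

(* In the curves below, u t is the element of the function space at time t. *)
definition C0_L2 :: "(real \<Rightarrow> real \<Rightarrow> complex) \<Rightarrow> bool" where
  "C0_L2 u \<longleftrightarrow> (\<forall>t\<ge>0. L2_on half_line (u t) \<and>
     ((\<lambda>s. L2_norm half_line (\<lambda>x. u s x - u t x)) \<longlongrightarrow> 0) (at t within {0..}))"

(* u is in C^1([0,\<infinity>); L^2(0,\<infinity>)), with L^2-derivative ut. *)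
definition C1_L2 :: "(real \<Rightarrow> real \<Rightarrow> complex) \<Rightarrow> (real \<Rightarrow> real \<Rightarrow> complex) \<Rightarrow> bool" where
  "C1_L2 u ut \<longleftrightarrow> C0_L2 u \<and> C0_L2 ut \<and>
     (\<forall>t\<ge>0. ((\<lambda>s. L2_norm half_line (\<lambda>x. (u s x - u t x) /\<^sub>R (s - t) - ut t x)) \<longlongrightarrow> 0)
        (at t within {0..}))"

(* u is in C^0([0,\<infinity>); H^2(0,\<infinity>)), with weak derivatives ux, uxx: continuity in
   the H^2 norm (|f|^2 + |f'|^2 + |f''|^2)^(1/2) is continuity of the three L^2 parts. *)
definition C0_H2 ::
  "(real \<Rightarrow> real \<Rightarrow> complex) \<Rightarrow> (real \<Rightarrow> real \<Rightarrow> complex) \<Rightarrow> (real \<Rightarrow> real \<Rightarrow> complex) \<Rightarrow> bool" where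
  "C0_H2 u ux uxx \<longleftrightarrow> C0_L2 u \<and> C0_L2 ux \<and> C0_L2 uxx \<and>
     (\<forall>t\<ge>0. weak_derivative (u t) (ux t) \<and> weak_derivative (ux t) (uxx t))"

definition C2_half_line :: "(real \<Rightarrow> complex) \<Rightarrow> bool" where
  "C2_half_line Q \<longleftrightarrow> (\<exists>Q' Q''.
     (\<forall>t\<ge>0. (Q has_vector_derivative Q' t) (at t within {0..}) \<and>
            (Q' has_vector_derivative Q'' t) (at t within {0..})) \<and>
     continuous_on {0..} Q'')"

(* q x t is the value at position x and time t; only x \<ge> 0, t \<ge> 0 matter.
   The first clause picks the continuous representative of the H^2 function
   q(., t), which is C^1 on [0,\<infinity>); this gives q(0,t) and q_x(0,t) a meaning.
   The equation is an identity in L^2(0,\<infinity>) at each time. *)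
definition nls_solution :: "real \<Rightarrow> (real \<Rightarrow> complex) \<Rightarrow> (real \<Rightarrow> real \<Rightarrow> complex) \<Rightarrow> bool" where
  "nls_solution lam Q q \<longleftrightarrow>
     (\<forall>t\<ge>0. continuous_on {0..} (\<lambda>x. q x t)) \<and>
     (\<exists>qt qx qxx.
        C1_L2 (\<lambda>t x. q x t) qt \<and> C0_H2 (\<lambda>t x. q x t) qx qxx \<and>
        (\<forall>t>0. AE x in lborel. x > 0 \<longrightarrow>
           \<i> * qt t x + qxx t x - 2 * of_real lam * of_real ((cmod (q x t))\<^sup>2) * q x t = 0)) \<and>
     (\<forall>x\<ge>0. q x 0 = 0) \<and>
     (\<forall>t\<ge>0. q 0 t = Q t)"

definition dx :: "(real \<Rightarrow> real \<Rightarrow> complex) \<Rightarrow> real \<Rightarrow> real \<Rightarrow> complex" where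
  "dx q x t = vector_derivative (\<lambda>y. q y t) (at x within {0..})"

definition dt :: "(real \<Rightarrow> real \<Rightarrow> complex) \<Rightarrow> real \<Rightarrow> real \<Rightarrow> complex" where
  "dt q x t = vector_derivative (\<lambda>s. q x s) (at t within {0..})"

end

theory Submission
  imports Defs
begin

text \<open>
  Let \<open>n = \<parallel>q\<parallel>\<close>, \<open>d = \<parallel>q\<^sub>x\<parallel>\<close> at time \<open>T\<close>, and let \<open>P\<close>, \<open>A\<close>, \<open>B\<close> be the norms of \<open>q\<^sub>x(0,\<cdot>)\<close>, \<open>q(0,\<cdot>)\<close>,
  \<open>q\<^sub>t(0,\<cdot>)\<close> in \<open>L\<^sup>2(0,T)\<close>; the decay assumptions bound \<open>A\<close> and \<open>B\<close> uniformly in \<open>T\<close>. The balance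
  laws of mass, energy and momentum give \<open>n\<^sup>2 \<le> 2PA\<close>, \<open>d\<^sup>2 + \<lambda>\<parallel>q\<parallel>\<^sub>4\<^sup>4 \<le> 2PB\<close> and \<open>P\<^sup>2 \<le> nd + K\<close> with
  a constant \<open>K\<close>. For \<open>\<lambda> > 0\<close> the product \<open>nd\<close> is at most linear in \<open>P\<close>; for \<open>\<lambda> < 0\<close> one uses
  \<open>\<parallel>q\<parallel>\<^sub>4\<^sup>4 \<le> 2n\<^sup>3d\<close> and absorbs a term \<open>8\<bar>\<lambda>\<bar>A\<^sup>2P\<^sup>2\<close> by smallness of \<open>A\<close>. So \<open>P\<close>, and with it \<open>n\<close> and \<open>d\<close>, stays bounded.

  Since \<open>q\<^sub>x\<close> is not differentiable in time with values in \<open>L\<^sup>2\<close>, each balance law is derived from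
  difference quotients: after an integration by parts in \<open>x\<close>, every increment is a pairing of
  \<open>q(s) - q(t)\<close> with an \<open>L\<^sup>2\<close>-continuous curve plus a boundary term.
\<close>

subsection \<open>Square-integrable functions\<close>

text \<open>The unknown flux \<open>q_x(0,t)\<close> stands on the right-hand side of the mass and
  energy laws, so neither gives a bound by itself. The momentum law closes the circle: tested with
  the conjugate of \<open>q_x\<close>, both spatial terms of the equation have real parts that are
  total derivatives. This leaves \<open>-|q_x(0,t)|^2\<close>, with the same sign for either sign of
  \<open>lam\<close>, while the momentum is at most \<open>n d\<close>. The other boundary terms are
  data and make up \<open>K = |lam| M^2 A^2 + A B\<close>, with \<open>M\<close> a bound of
  \<open>|Q|\<close>.

  For \<open>lam < 0\<close> the energy law becomes \<open>d^2 <= 2 P B + 2 |lam| n^3 d\<close>,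
  hence \<open>d <= sqrt (2 P B) + 2 |lam| n^3\<close>, and \<open>n d\<close> acquires the term
  \<open>2 |lam| n^4 <= 8 |lam| A^2 P^2\<close>. This is at most half of \<open>P^2\<close> once
  \<open>A^2 <= 1 / (16 |lam|)\<close>, the threshold for \<open>c2\<close>.

  The hypotheses speak of weak derivatives and almost-everywhere identities, the conclusion of point
  values of derivatives. The bridge is the absolutely continuous representative of an H^1 function
  on the half-line.\<close>

definition sq_integrable :: "'a measure \<Rightarrow> ('a \<Rightarrow> complex) \<Rightarrow> bool" where
  "sq_integrable M f \<longleftrightarrow> f \<in> borel_measurable M \<and> integrable M (\<lambda>x. (cmod (f x))\<^sup>2)"

text \<open>The measure is a parameter because the same calculus is used in space, on the half-line,
  and in time, on bounded intervals.\<close>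

definition l2norm :: "'a measure \<Rightarrow> ('a \<Rightarrow> complex) \<Rightarrow> real" where
  "l2norm M f = sqrt (\<integral>x. (cmod (f x))\<^sup>2 \<partial>M)"

lemma l2norm_nonneg [simp]: "0 \<le> l2norm M f"
  by (simp add: l2norm_def)

lemma l2norm_zero [simp]: "l2norm M (\<lambda>x. 0) = 0"
  by (simp add: l2norm_def)

lemma l2norm_power2: "(l2norm M f)\<^sup>2 = (\<integral>x. (cmod (f x))\<^sup>2 \<partial>M)"
  by (simp add: l2norm_def)

lemma sq_integrable_add:
  assumes "sq_integrable M f" "sq_integrable M g"
  shows "sq_integrable M (\<lambda>x. f x + g x)"
  unfolding sq_integrable_def
proof
  have [measurable]: "f \<in> borel_measurable M" "g \<in> borel_measurable M"
    using assms by (auto simp: sq_integrable_def)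
  show "(\<lambda>x. f x + g x) \<in> borel_measurable M" by simp
  have "integrable M (\<lambda>x. 2 * (cmod (f x))\<^sup>2 + 2 * (cmod (g x))\<^sup>2)"
    using assms by (auto simp: sq_integrable_def)
  moreover have "(cmod (f x + g x))\<^sup>2 \<le> 2 * (cmod (f x))\<^sup>2 + 2 * (cmod (g x))\<^sup>2" for x
  proof -
    have "(cmod (f x + g x))\<^sup>2 \<le> (cmod (f x) + cmod (g x))\<^sup>2"
      by (simp add: norm_triangle_ineq power_mono)
    also have "\<dots> \<le> 2 * (cmod (f x))\<^sup>2 + 2 * (cmod (g x))\<^sup>2"
      using sum_squares_bound[of "cmod (f x)" "cmod (g x)"] by (simp add: power2_sum)
    finally show ?thesis .
  qed
  ultimately show "integrable M (\<lambda>x. (cmod (f x + g x))\<^sup>2)"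
    by (rule_tac Bochner_Integration.integrable_bound[where f="\<lambda>x. 2 * (cmod (f x))\<^sup>2 + 2 * (cmod (g x))\<^sup>2"])
      (auto intro!: AE_I2 order_trans[OF _ abs_ge_self])
qed

lemma sq_integrable_bounded_mult:
  assumes "sq_integrable M f" "b \<in> borel_measurable M" "\<And>x. x \<in> space M \<Longrightarrow> cmod (b x) \<le> K"
  shows "sq_integrable M (\<lambda>x. b x * f x)"
  unfolding sq_integrable_def
proof
  have [measurable]: "f \<in> borel_measurable M" "b \<in> borel_measurable M"
    using assms by (auto simp: sq_integrable_def)
  show "(\<lambda>x. b x * f x) \<in> borel_measurable M" by simp
  have i: "integrable M (\<lambda>x. K\<^sup>2 * (cmod (f x))\<^sup>2)"
    using assms by (auto simp: sq_integrable_def)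
  show "integrable M (\<lambda>x. (cmod (b x * f x))\<^sup>2)"
    by (rule Bochner_Integration.integrable_bound[OF i])
      (use assms in \<open>auto simp: norm_mult power_mult_distrib intro!: mult_right_mono power_mono\<close>)
qed

lemma sq_integrable_cmult:
  assumes "sq_integrable M f"
  shows "sq_integrable M (\<lambda>x. c * f x)"
  by (rule sq_integrable_bounded_mult[OF assms, of _ "cmod c"]) auto

lemma sq_integrable_scaleR:
  assumes "sq_integrable M f"
  shows "sq_integrable M (\<lambda>x. c *\<^sub>R f x)"
  using sq_integrable_cmult[OF assms, of "of_real c"] by (simp add: scaleR_conv_of_real)

lemma sq_integrable_uminus:
  assumes "sq_integrable M f"
  shows "sq_integrable M (\<lambda>x. - f x)"
  using sq_integrable_cmult[OF assms, of "-1"] by simp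

lemma sq_integrable_diff:
  assumes "sq_integrable M f" "sq_integrable M g"
  shows "sq_integrable M (\<lambda>x. f x - g x)"
  using sq_integrable_add[OF assms(1) sq_integrable_uminus[OF assms(2)]] by simp

lemma sq_integrable_cnj:
  assumes "sq_integrable M f"
  shows "sq_integrable M (\<lambda>x. cnj (f x))"
  using assms by (auto simp: sq_integrable_def intro!: borel_measurable_continuous_on[of cnj] continuous_intros)

lemma sq_integrable_cong_AE:
  assumes "sq_integrable M f" "g \<in> borel_measurable M" "AE x in M. f x = g x"
  shows "sq_integrable M g"
proof -
  have [measurable]: "f \<in> borel_measurable M" "g \<in> borel_measurable M"
    using assms by (auto simp: sq_integrable_def)
  have "integrable M (\<lambda>x. (cmod (g x))\<^sup>2) \<longleftrightarrow> integrable M (\<lambda>x. (cmod (f x))\<^sup>2)"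
    by (rule integrable_cong_AE) (use assms(3) in \<open>auto elim: AE_mp\<close>)
  with assms show ?thesis by (auto simp: sq_integrable_def)
qed

lemma l2norm_cong_AE:
  assumes "f \<in> borel_measurable M" "g \<in> borel_measurable M" "AE x in M. f x = g x"
  shows "l2norm M f = l2norm M g"
  unfolding l2norm_def using assms
  by (intro arg_cong[where f=sqrt] integral_cong_AE) auto

lemma l2norm_cnj [simp]: "l2norm M (\<lambda>x. cnj (f x)) = l2norm M f"
  by (simp add: l2norm_def)

lemma l2norm_minus_commute: "l2norm M (\<lambda>x. f x - g x) = l2norm M (\<lambda>x. g x - f x)"
  by (simp add: l2norm_def norm_minus_commute)

lemma sq_integrable_mult:
  assumes "sq_integrable M f" "sq_integrable M g"
  shows "integrable M (\<lambda>x. f x * g x)"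
proof (rule Bochner_Integration.integrable_bound)
  have [measurable]: "f \<in> borel_measurable M" "g \<in> borel_measurable M"
    using assms by (auto simp: sq_integrable_def)
  show "integrable M (\<lambda>x. (cmod (f x))\<^sup>2 + (cmod (g x))\<^sup>2)"
    using assms by (auto simp: sq_integrable_def)
  show "(\<lambda>x. f x * g x) \<in> borel_measurable M" by simp
  show "AE x in M. norm (f x * g x) \<le> norm ((cmod (f x))\<^sup>2 + (cmod (g x))\<^sup>2)"
  proof (rule AE_I2)
    fix x
    have "2 * (cmod (f x) * cmod (g x)) \<le> (cmod (f x))\<^sup>2 + (cmod (g x))\<^sup>2"
      using sum_squares_bound[of "cmod (f x)" "cmod (g x)"] by simp
    moreover have "0 \<le> cmod (f x) * cmod (g x)" by simp
    ultimately show "norm (f x * g x) \<le> norm ((cmod (f x))\<^sup>2 + (cmod (g x))\<^sup>2)"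
      unfolding norm_mult real_norm_def by linarith
  qed
qed

text \<open>Transferred from the inequality for nonnegative integrals with values in
  \<open>ennreal\<close>: square integrability makes all three integrals finite, so they can be read
  as real numbers.\<close>

lemma l2_Cauchy_Schwarz:
  assumes "sq_integrable M f" "sq_integrable M g"
  shows "(\<integral>x. cmod (f x) * cmod (g x) \<partial>M) \<le> l2norm M f * l2norm M g"
proof -
  have [measurable]: "f \<in> borel_measurable M" "g \<in> borel_measurable M"
    using assms by (auto simp: sq_integrable_def)
  have i: "integrable M (\<lambda>x. cmod (f x) * cmod (g x))"
    using integrable_norm[OF sq_integrable_mult[OF assms]] by (simp add: norm_mult)
  have nn: "(\<integral>\<^sup>+x. ennreal (cmod (f x)) * ennreal (cmod (g x)) \<partial>M)
      = ennreal (\<integral>x. cmod (f x) * cmod (g x) \<partial>M)"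
    using nn_integral_eq_integral[OF i] by (simp add: ennreal_mult)
  have sq: "(\<integral>\<^sup>+x. (ennreal (cmod (h x)))\<^sup>2 \<partial>M) = ennreal ((l2norm M h)\<^sup>2)"
    if "sq_integrable M h" for h
    using nn_integral_eq_integral[of M "\<lambda>x. (cmod (h x))\<^sup>2"] that
    by (simp add: sq_integrable_def l2norm_power2 ennreal_power)
  have "(ennreal (\<integral>x. cmod (f x) * cmod (g x) \<partial>M))\<^sup>2
      \<le> ennreal ((l2norm M f)\<^sup>2) * ennreal ((l2norm M g)\<^sup>2)"
    using Cauchy_Schwarz_nn_integral[of "\<lambda>x. ennreal (cmod (f x))" M "\<lambda>x. ennreal (cmod (g x))"]
    unfolding nn sq[OF assms(1)] sq[OF assms(2)] by simp
  then have "(\<integral>x. cmod (f x) * cmod (g x) \<partial>M)\<^sup>2 \<le> (l2norm M f * l2norm M g)\<^sup>2"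
    by (simp add: ennreal_power flip: ennreal_mult power_mult_distrib)
  then show ?thesis
    by (rule power2_le_imp_le) simp
qed

lemma l2_integral_bound:
  assumes "sq_integrable M f" "sq_integrable M g"
  shows "cmod (\<integral>x. f x * g x \<partial>M) \<le> l2norm M f * l2norm M g"
proof -
  have "cmod (\<integral>x. f x * g x \<partial>M) \<le> (\<integral>x. cmod (f x * g x) \<partial>M)"
    by (rule integral_norm_bound)
  with l2_Cauchy_Schwarz[OF assms] show ?thesis by (simp add: norm_mult)
qed

lemma l2norm_triangle:
  assumes "sq_integrable M f" "sq_integrable M g"
  shows "l2norm M (\<lambda>x. f x + g x) \<le> l2norm M f + l2norm M g"
proof (rule power2_le_imp_le)
  have [measurable]: "f \<in> borel_measurable M" "g \<in> borel_measurable M"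
    using assms by (auto simp: sq_integrable_def)
  have i: "integrable M (\<lambda>x. cmod (f x) * cmod (g x))"
    using integrable_norm[OF sq_integrable_mult[OF assms]] by (simp add: norm_mult)
  have isq: "integrable M (\<lambda>x. (cmod (f x))\<^sup>2)" "integrable M (\<lambda>x. (cmod (g x))\<^sup>2)"
    "integrable M (\<lambda>x. (cmod (f x + g x))\<^sup>2)"
    using assms sq_integrable_add[OF assms] by (auto simp: sq_integrable_def)
  have "(l2norm M (\<lambda>x. f x + g x))\<^sup>2
      \<le> (\<integral>x. (cmod (f x))\<^sup>2 + 2 * (cmod (f x) * cmod (g x)) + (cmod (g x))\<^sup>2 \<partial>M)"
    unfolding l2norm_power2
  proof (rule integral_mono)
    fix x
    have "(cmod (f x + g x))\<^sup>2 \<le> (cmod (f x) + cmod (g x))\<^sup>2"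
      by (simp add: norm_triangle_ineq power_mono)
    then show "(cmod (f x + g x))\<^sup>2 \<le> (cmod (f x))\<^sup>2 + 2 * (cmod (f x) * cmod (g x)) + (cmod (g x))\<^sup>2"
      by (simp add: power2_sum)
  qed (use i isq in auto)
  also have "\<dots> = (l2norm M f)\<^sup>2 + 2 * (\<integral>x. cmod (f x) * cmod (g x) \<partial>M) + (l2norm M g)\<^sup>2"
    using i isq by (simp add: l2norm_power2)
  also have "\<dots> \<le> (l2norm M f + l2norm M g)\<^sup>2"
    using l2_Cauchy_Schwarz[OF assms] by (simp add: power2_sum)
  finally show "(l2norm M (\<lambda>x. f x + g x))\<^sup>2 \<le> (l2norm M f + l2norm M g)\<^sup>2" .
qed simp

lemma l2norm_bounded_mult:
  assumes "sq_integrable M f" "b \<in> borel_measurable M" "\<And>x. x \<in> space M \<Longrightarrow> cmod (b x) \<le> K" "0 \<le> K"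
  shows "l2norm M (\<lambda>x. b x * f x) \<le> K * l2norm M f"
proof (rule power2_le_imp_le)
  have "(l2norm M (\<lambda>x. b x * f x))\<^sup>2 \<le> (\<integral>x. K\<^sup>2 * (cmod (f x))\<^sup>2 \<partial>M)"
    unfolding l2norm_power2
  proof (rule integral_mono)
    show "integrable M (\<lambda>x. (cmod (b x * f x))\<^sup>2)"
      using sq_integrable_bounded_mult[OF assms(1-3)] by (simp add: sq_integrable_def)
    show "integrable M (\<lambda>x. K\<^sup>2 * (cmod (f x))\<^sup>2)"
      using assms(1) by (simp add: sq_integrable_def)
  qed (use assms in \<open>auto simp: norm_mult power_mult_distrib intro!: mult_right_mono power_mono\<close>)
  also have "\<dots> = (K * l2norm M f)\<^sup>2"
    by (simp add: l2norm_power2 power_mult_distrib)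
  finally show "(l2norm M (\<lambda>x. b x * f x))\<^sup>2 \<le> (K * l2norm M f)\<^sup>2" .
qed (use assms in simp)

text \<open>Reverse triangle inequality. Square integrability of \<open>fs s\<close> is asked only
  eventually along \<open>F\<close>, because the curves in time are controlled at nonnegative times
  only.\<close>

lemma l2_tendsto_norm:
  assumes "sq_integrable M f" "eventually (\<lambda>s. sq_integrable M (fs s)) F"
    and "((\<lambda>s. l2norm M (\<lambda>x. fs s x - f x)) \<longlongrightarrow> 0) F"
  shows "((\<lambda>s. l2norm M (fs s)) \<longlongrightarrow> l2norm M f) F"
proof (rule LIM_zero_cancel, rule Lim_null_comparison[OF _ assms(3)])
  show "\<forall>\<^sub>F s in F. norm (l2norm M (fs s) - l2norm M f) \<le> l2norm M (\<lambda>x. fs s x - f x)"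
    using assms(2)
  proof eventually_elim
    case (elim s)
    have "l2norm M (fs s) \<le> l2norm M (\<lambda>x. fs s x - f x) + l2norm M f"
      using l2norm_triangle[OF sq_integrable_diff[OF elim assms(1)] assms(1)] by simp
    moreover have "l2norm M f \<le> l2norm M (\<lambda>x. fs s x - f x) + l2norm M (fs s)"
      using l2norm_triangle[OF sq_integrable_diff[OF assms(1) elim] elim]
      by (simp add: l2norm_minus_commute[of M f])
    ultimately show ?case by simp
  qed
qed

lemma l2_tendsto_add:
  assumes "sq_integrable M f" "eventually (\<lambda>s. sq_integrable M (fs s)) F"
    and "sq_integrable M g" "eventually (\<lambda>s. sq_integrable M (gs s)) F"
    and "((\<lambda>s. l2norm M (\<lambda>x. fs s x - f x)) \<longlongrightarrow> 0) F"
    and "((\<lambda>s. l2norm M (\<lambda>x. gs s x - g x)) \<longlongrightarrow> 0) F"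
  shows "((\<lambda>s. l2norm M (\<lambda>x. (fs s x + gs s x) - (f x + g x))) \<longlongrightarrow> 0) F"
proof (rule Lim_null_comparison)
  show "((\<lambda>s. l2norm M (\<lambda>x. fs s x - f x) + l2norm M (\<lambda>x. gs s x - g x)) \<longlongrightarrow> 0) F"
    using tendsto_add[OF assms(5,6)] by simp
  show "\<forall>\<^sub>F s in F. norm (l2norm M (\<lambda>x. (fs s x + gs s x) - (f x + g x)))
      \<le> l2norm M (\<lambda>x. fs s x - f x) + l2norm M (\<lambda>x. gs s x - g x)"
    using assms(2,4)
  proof eventually_elim
    case (elim s)
    show ?case
      using l2norm_triangle[OF sq_integrable_diff[OF elim(1) assms(1)] sq_integrable_diff[OF elim(2) assms(3)]]
      by (simp add: algebra_simps)
  qed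
qed

text \<open>The difference of the products telescopes into \<open>(fs - f) gs + f (gs - g)\<close>,
  and the norms of \<open>gs\<close> converge. Every limit of a spatial pairing in the balance laws
  is an instance: one factor is a difference quotient, the other an L2-continuous curve.\<close>

lemma l2_tendsto_integral_mult:
  assumes "sq_integrable M f" "eventually (\<lambda>s. sq_integrable M (fs s)) F"
    and "sq_integrable M g" "eventually (\<lambda>s. sq_integrable M (gs s)) F"
    and "((\<lambda>s. l2norm M (\<lambda>x. fs s x - f x)) \<longlongrightarrow> 0) F"
    and "((\<lambda>s. l2norm M (\<lambda>x. gs s x - g x)) \<longlongrightarrow> 0) F"
  shows "((\<lambda>s. \<integral>x. fs s x * gs s x \<partial>M) \<longlongrightarrow> (\<integral>x. f x * g x \<partial>M)) F"
proof (rule LIM_zero_cancel, rule Lim_null_comparison)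
  have "((\<lambda>s. l2norm M (\<lambda>x. fs s x - f x) * l2norm M (gs s) + l2norm M f * l2norm M (\<lambda>x. gs s x - g x))
      \<longlongrightarrow> 0 * l2norm M g + l2norm M f * 0) F"
    using assms by (intro tendsto_intros l2_tendsto_norm)
  then show "((\<lambda>s. l2norm M (\<lambda>x. fs s x - f x) * l2norm M (gs s) + l2norm M f * l2norm M (\<lambda>x. gs s x - g x))
      \<longlongrightarrow> 0) F" by simp
  show "\<forall>\<^sub>F s in F. norm ((\<integral>x. fs s x * gs s x \<partial>M) - (\<integral>x. f x * g x \<partial>M))
      \<le> l2norm M (\<lambda>x. fs s x - f x) * l2norm M (gs s) + l2norm M f * l2norm M (\<lambda>x. gs s x - g x)"
    using assms(2,4)
  proof eventually_elim
    case (elim s)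
    note d = sq_integrable_diff[OF elim(1) assms(1)] sq_integrable_diff[OF elim(2) assms(3)]
    have "(\<integral>x. fs s x * gs s x \<partial>M) - (\<integral>x. f x * g x \<partial>M)
        = (\<integral>x. fs s x * gs s x - f x * g x \<partial>M)"
      by (simp add: sq_integrable_mult elim assms)
    also have "\<dots> = (\<integral>x. (fs s x - f x) * gs s x + f x * (gs s x - g x) \<partial>M)"
      by (rule Bochner_Integration.integral_cong) (auto simp: algebra_simps)
    also have "\<dots> = (\<integral>x. (fs s x - f x) * gs s x \<partial>M) + (\<integral>x. f x * (gs s x - g x) \<partial>M)"
      by (rule Bochner_Integration.integral_add) (auto intro!: sq_integrable_mult elim assms d)
    finally show ?case
      using l2_integral_bound[OF d(1) elim(2)] l2_integral_bound[OF assms(1) d(2)]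
      by (smt (verit) norm_triangle_ineq)
  qed
qed

subsection \<open>Primitives and Sobolev functions on the half-line\<close>

lemma L2_on_iff_sq_integrable:
  assumes "S \<in> sets borel"
  shows "L2_on S f \<longleftrightarrow> sq_integrable (restrict_space lborel S) f"
  using assms
  by (simp add: L2_on_def sq_integrable_def set_borel_measurable_def set_integrable_def
      integrable_restrict_space borel_measurable_restrict_space_iff)

lemma L2_norm_eq_l2norm:
  assumes "S \<in> sets borel"
  shows "L2_norm S f = l2norm (restrict_space lborel S) f"
  using assms
  by (simp add: L2_norm_def l2norm_def integral_restrict_space set_lebesgue_integral_def)

abbreviation half_line_measure :: "real measure" where
  "half_line_measure \<equiv> restrict_space lborel half_line"

lemma integrable_half_line_iff:
  "integrable half_line_measure f \<longleftrightarrow> set_integrable lborel half_line f"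
  for f :: "real \<Rightarrow> 'b::{banach, second_countable_topology}"
  by (simp add: integrable_restrict_space set_integrable_def)

lemma integral_half_line_eq:
  "integral\<^sup>L half_line_measure f = (LINT x:half_line|lborel. f x)"
  for f :: "real \<Rightarrow> 'b::{banach, second_countable_topology}"
  by (simp add: integral_restrict_space set_lebesgue_integral_def)

text \<open>Fubini for \<open>a x * b y\<close> on the plane, cut along the diagonal into the parts
  below and above it. Each part is one of the two iterated integrals. This is integration by parts
  for primitives of merely integrable functions.\<close>

lemma integrable_iterated_ordered:
  fixes a b :: "real \<Rightarrow> complex"
  assumes ia: "integrable lborel a" and ib: "integrable lborel b"
  shows "integrable lborel (\<lambda>x. a x * (LINT y:{..x}|lborel. b y) + (LINT y:{..x}|lborel. a y) * b x)"
    and "(\<integral>x. a x * (LINT y:{..x}|lborel. b y) + (LINT y:{..x}|lborel. a y) * b x \<partial>lborel)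
      = (\<integral>x. a x \<partial>lborel) * (\<integral>x. b x \<partial>lborel)"
proof -
  have [measurable]: "a \<in> borel_measurable lborel" "b \<in> borel_measurable lborel"
    using ia ib by auto
  have [measurable]: "a \<in> borel_measurable borel" "b \<in> borel_measurable borel"
    using ia ib by (auto dest!: borel_measurable_integrable)
  define P where "P = (\<lambda>(x, y). a x * b y)"
  define S where "S = {p::real \<times> real. snd p \<le> fst p}"
  have S: "S \<in> sets borel"
    unfolding S_def by (intro borel_closed closed_Collect_le continuous_intros)
  then have [measurable]: "S \<in> sets (lborel \<Otimes>\<^sub>M lborel)"
    unfolding lborel_prod by simp
  have iP: "integrable (lborel \<Otimes>\<^sub>M lborel) P"
  proof (rule lborel_pair.Fubini_integrable)
    show "P \<in> borel_measurable (lborel \<Otimes>\<^sub>M lborel)"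
      unfolding P_def by measurable
    show "integrable lborel (\<lambda>x. \<integral>y. norm (P (x, y)) \<partial>lborel)"
      unfolding P_def using ia ib by (simp add: norm_mult)
    show "AE x in lborel. integrable lborel (\<lambda>y. P (x, y))"
      unfolding P_def using ib by simp
  qed
  have i1: "integrable (lborel \<Otimes>\<^sub>M lborel) (\<lambda>p. indicator S p *\<^sub>R P p)"
    by (rule integrable_mult_indicator[OF _ iP]) (unfold lborel_prod, simp add: S)
  have i2: "integrable (lborel \<Otimes>\<^sub>M lborel) (\<lambda>p. indicator (- S) p *\<^sub>R P p)"
    by (rule integrable_mult_indicator[OF _ iP]) (unfold lborel_prod, simp add: S borel_comp)
  have i2': "integrable (lborel \<Otimes>\<^sub>M lborel) (\<lambda>(x, y). indicator (- S) (y, x) *\<^sub>R P (y, x))"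
    using lborel_pair.integrable_product_swap[OF i2] .
  have e1: "(\<integral>y. indicator S (x, y) *\<^sub>R P (x, y) \<partial>lborel) = a x * (LINT y:{..x}|lborel. b y)" for x
  proof -
    have "(\<integral>y. indicator S (x, y) *\<^sub>R P (x, y) \<partial>lborel) = (\<integral>y. a x * (indicator {..x} y *\<^sub>R b y) \<partial>lborel)"
      by (rule Bochner_Integration.integral_cong) (auto simp: S_def P_def indicator_def)
    then show ?thesis by (simp add: set_lebesgue_integral_def del: mult_scaleR_right mult_scaleR_left)
  qed
  have e2: "(\<integral>y. indicator (- S) (y, x) *\<^sub>R P (y, x) \<partial>lborel) = (LINT y:{..x}|lborel. a y) * b x" for x
  proof -
    have "(\<integral>y. indicator (- S) (y, x) *\<^sub>R P (y, x) \<partial>lborel) = (\<integral>y. (indicator {..x} y *\<^sub>R a y) * b x \<partial>lborel)"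
    proof (rule integral_cong_AE)
      \<comment> \<open>\<open>- S\<close> demands \<open>y < x\<close> strictly, while
        \<open>{..x}\<close> contains \<open>x\<close>; the single point has measure zero.\<close>
      show "AE y in lborel. indicator (- S) (y, x) *\<^sub>R P (y, x) = (indicator {..x} y *\<^sub>R a y) * b x"
        using AE_lborel_singleton[of x]
        by eventually_elim (auto simp: S_def P_def indicator_def)
    qed (simp_all add: P_def S_def indicator_def)
    then show ?thesis by (simp add: set_lebesgue_integral_def del: mult_scaleR_right mult_scaleR_left)
  qed
  have j1: "integrable lborel (\<lambda>x. a x * (LINT y:{..x}|lborel. b y))"
    using lborel_pair.integrable_fst'[OF i1] unfolding e1 .
  have j2: "integrable lborel (\<lambda>x. (LINT y:{..x}|lborel. a y) * b x)"
    using lborel_pair.integrable_fst'[OF i2'] unfolding prod.case e2 .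
  show "integrable lborel (\<lambda>x. a x * (LINT y:{..x}|lborel. b y) + (LINT y:{..x}|lborel. a y) * b x)"
    using j1 j2 by simp
  have "(\<integral>x. a x \<partial>lborel) * (\<integral>x. b x \<partial>lborel) = (\<integral>x. \<integral>y. P (x, y) \<partial>lborel \<partial>lborel)"
    by (simp add: P_def)
  also have "\<dots> = integral\<^sup>L (lborel \<Otimes>\<^sub>M lborel) P"
    by (rule lborel_pair.integral_fst'[OF iP])
  also have "\<dots> = (\<integral>p. indicator S p *\<^sub>R P p + indicator (- S) p *\<^sub>R P p \<partial>(lborel \<Otimes>\<^sub>M lborel))"
    by (rule Bochner_Integration.integral_cong) (auto simp: indicator_def)
  also have "\<dots> = (\<integral>p. indicator S p *\<^sub>R P p \<partial>(lborel \<Otimes>\<^sub>M lborel))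
      + (\<integral>p. indicator (- S) p *\<^sub>R P p \<partial>(lborel \<Otimes>\<^sub>M lborel))"
    by (rule Bochner_Integration.integral_add[OF i1 i2])
  also have "(\<integral>p. indicator S p *\<^sub>R P p \<partial>(lborel \<Otimes>\<^sub>M lborel)) = (\<integral>x. a x * (LINT y:{..x}|lborel. b y) \<partial>lborel)"
    using lborel_pair.integral_fst'[OF i1] unfolding e1 by simp
  also have "(\<integral>p. indicator (- S) p *\<^sub>R P p \<partial>(lborel \<Otimes>\<^sub>M lborel))
      = (\<integral>(x, y). indicator (- S) (y, x) *\<^sub>R P (y, x) \<partial>(lborel \<Otimes>\<^sub>M lborel))"
    by (rule lborel_pair.integral_product_swap[symmetric]) (use i2 in auto)
  also have "\<dots> = (\<integral>x. (LINT y:{..x}|lborel. a y) * b x \<partial>lborel)"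
    using lborel_pair.integral_fst'[OF i2'] unfolding prod.case e2 by simp
  finally show "(\<integral>x. a x * (LINT y:{..x}|lborel. b y) + (LINT y:{..x}|lborel. a y) * b x \<partial>lborel)
      = (\<integral>x. a x \<partial>lborel) * (\<integral>x. b x \<partial>lborel)"
    using j1 j2 by simp
qed

text \<open>The interval is open at 0 so that integrability on the open half-line suffices.\<close>
definition primitive_on :: "real \<Rightarrow> (real \<Rightarrow> complex) \<Rightarrow> (real \<Rightarrow> complex) \<Rightarrow> bool" where
  "primitive_on X F f \<longleftrightarrow> set_integrable lborel {0<..X} f \<and>
     (\<forall>x\<in>{0..X}. F x = F 0 + (LINT y:{0<..x}|lborel. f y))"

lemma primitive_onD:
  assumes "primitive_on X F f" "0 \<le> x" "x \<le> X"
  shows "F x = F 0 + (LINT y:{0<..x}|lborel. f y)"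
  using assms unfolding primitive_on_def by (meson atLeastAtMost_iff)

text \<open>The product rule for absolutely continuous functions. Cut off to \<open>{0<..x}\<close>,
  the densities \<open>f\<close> and \<open>g\<close> have the running integrals
  \<open>F - F 0\<close> and \<open>G - G 0\<close>, so the ordered Fubini identity is the claim for
  these two; the constants \<open>F 0\<close> and \<open>G 0\<close> are restored by
  linearity.\<close>

lemma primitive_on_mult:
  assumes F: "primitive_on X F f" and G: "primitive_on X G g" and X: "0 \<le> X"
  shows "primitive_on X (\<lambda>x. F x * G x) (\<lambda>x. f x * G x + F x * g x)"
proof -
  have main: "set_integrable lborel {0<..x} (\<lambda>x. f x * G x + F x * g x) \<and>
     (LINT y:{0<..x}|lborel. f y * G y + F y * g y) = F x * G x - F 0 * G 0"
    if x: "x \<in> {0..X}" for x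
  proof -
    have fi: "set_integrable lborel {0<..x} f" and gi: "set_integrable lborel {0<..x} g"
      using F G x by (auto simp: primitive_on_def intro: set_integrable_subset)
    define a where "a = (\<lambda>y. indicator {0<..x} y *\<^sub>R f y)"
    define b where "b = (\<lambda>y. indicator {0<..x} y *\<^sub>R g y)"
    have ia: "integrable lborel a" and ib: "integrable lborel b"
      using fi gi by (auto simp: a_def b_def set_integrable_def)
    have A: "(LINT z:{..y}|lborel. a z) = F y - F 0" if "y \<in> {0<..x}" for y
    proof -
      have "(LINT z:{..y}|lborel. a z) = (LINT z:{0<..y}|lborel. f z)"
        unfolding set_lebesgue_integral_def a_def
        by (rule Bochner_Integration.integral_cong) (use that in \<open>auto simp: indicator_def\<close>)
      moreover have "F y = F 0 + (LINT z:{0<..y}|lborel. f z)"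
        by (rule primitive_onD[OF F]) (use that x in auto)
      ultimately show ?thesis by simp
    qed
    have B: "(LINT z:{..y}|lborel. b z) = G y - G 0" if "y \<in> {0<..x}" for y
    proof -
      have "(LINT z:{..y}|lborel. b z) = (LINT z:{0<..y}|lborel. g z)"
        unfolding set_lebesgue_integral_def b_def
        by (rule Bochner_Integration.integral_cong) (use that in \<open>auto simp: indicator_def\<close>)
      moreover have "G y = G 0 + (LINT z:{0<..y}|lborel. g z)"
        by (rule primitive_onD[OF G]) (use that x in auto)
      ultimately show ?thesis by simp
    qed
    have Fx: "(LINT y:{0<..x}|lborel. f y) = F x - F 0" and Gx: "(LINT y:{0<..x}|lborel. g y) = G x - G 0"
    proof -
      have "F x = F 0 + (LINT z:{0<..x}|lborel. f z)" "G x = G 0 + (LINT z:{0<..x}|lborel. g z)"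
        by (rule primitive_onD[OF F] primitive_onD[OF G]; use x in simp)+
      then show "(LINT y:{0<..x}|lborel. f y) = F x - F 0" "(LINT y:{0<..x}|lborel. g y) = G x - G 0"
        by simp_all
    qed
    have ia': "integral\<^sup>L lborel a = F x - F 0" and ib': "integral\<^sup>L lborel b = G x - G 0"
      using Fx Gx by (simp_all add: a_def b_def set_lebesgue_integral_def)
    have e: "a y * (LINT z:{..y}|lborel. b z) + (LINT z:{..y}|lborel. a z) * b y
        = indicator {0<..x} y *\<^sub>R (f y * (G y - G 0) + (F y - F 0) * g y)" for y
      using A[of y] B[of y] by (cases "y \<in> {0<..x}") (auto simp: a_def b_def)
    have i: "set_integrable lborel {0<..x} (\<lambda>y. f y * (G y - G 0) + (F y - F 0) * g y)"
      using integrable_iterated_ordered(1)[OF ia ib] unfolding e set_integrable_def .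
    have v: "(LINT y:{0<..x}|lborel. f y * (G y - G 0) + (F y - F 0) * g y) = (F x - F 0) * (G x - G 0)"
      using integrable_iterated_ordered(2)[OF ia ib] unfolding e ia' ib' by (simp add: set_lebesgue_integral_def)
    have j: "set_integrable lborel {0<..x} (\<lambda>y. f y * G 0 + F 0 * g y)"
      using fi gi by (intro set_integral_add) auto
    have w: "(LINT y:{0<..x}|lborel. f y * G 0 + F 0 * g y) = (F x - F 0) * G 0 + F 0 * (G x - G 0)"
      using fi gi by (subst set_integral_add) (auto simp: Fx Gx)
    have s: "(\<lambda>y. f y * (G y - G 0) + (F y - F 0) * g y + (f y * G 0 + F 0 * g y))
        = (\<lambda>y. f y * G y + F y * g y)"
      by (auto simp: algebra_simps)
    show ?thesis
      using set_integral_add[OF i j] unfolding s v w by (auto simp: algebra_simps)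
  qed
  show ?thesis
    unfolding primitive_on_def using main[of X] main X by (auto simp: algebra_simps)
qed

text \<open>The Lebesgue integral over \<open>{0<..x}\<close> equals the gauge integral over
  \<open>{0..x}\<close>, as the domains differ by a negligible point, and the latter is continuous
  in its end point.\<close>

lemma primitive_on_continuous:
  assumes "primitive_on X F f"
  shows "continuous_on {0..X} F"
proof -
  have e: "f integrable_on {0..x} \<and> (LINT y:{0<..x}|lborel. f y) = integral {0..x} f" if "x \<in> {0..X}" for x
  proof -
    have "set_integrable lborel {0<..x} f"
      using assms that by (auto simp: primitive_on_def intro: set_integrable_subset)
    note * = set_borel_integral_eq_integral[OF this]
    have n: "negligible {y \<in> {0<..x} - {0..x}. f y \<noteq> 0}" "negligible {y \<in> {0..x} - {0<..x}. f y \<noteq> 0}"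
      by (rule negligible_subset[of "{0}"]; auto)+
    show ?thesis
      using * integrable_spike_set[OF _ n] integral_spike_set[OF n] by auto
  qed
  show ?thesis
  proof (cases "0 \<le> X")
    case True
    then have "continuous_on {0..X} (\<lambda>x. F 0 + integral {0..x} f)"
      using e[of X] by (intro continuous_intros indefinite_integral_continuous_1) auto
    moreover have "F x = F 0 + integral {0..x} f" if "x \<in> {0..X}" for x
    proof -
      have "F x = F 0 + (LINT y:{0<..x}|lborel. f y)"
        by (rule primitive_onD[OF assms]) (use that in auto)
      then show ?thesis using e[OF that] by simp
    qed
    ultimately show ?thesis by (metis (no_types, lifting) continuous_on_cong)
  qed auto
qed

lemma primitive_continuous_half_line:
  assumes "\<And>X. 0 \<le> X \<Longrightarrow> primitive_on X F f"
  shows "continuous_on {0..} F"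
  unfolding continuous_on_eq_continuous_within
proof
  fix x :: real assume x: "x \<in> {0..}"
  have "continuous (at x within {0..x + 1}) F"
    using primitive_on_continuous[OF assms, of "x + 1"] x
    by (auto simp: continuous_on_eq_continuous_within)
  moreover have "at x within {0..} = at x within {0..x + 1}"
    by (rule at_within_nhd[of x "{..<x + 1}"]) auto
  ultimately show "continuous (at x within {0..}) F"
    by (simp add: continuous_within)
qed

text \<open>Integrability of \<open>f\<close> gives \<open>F\<close> a limit at infinity. A nonzero
  limit would keep \<open>|F|\<close> above a positive constant on some \<open>{R..}\<close>,
  against the integrability of \<open>F\<close>. With limit 0, \<open>F x\<close> is minus the
  integral of \<open>f\<close> beyond \<open>x\<close>, which yields both the value at 0 and the
  uniform bound.\<close>

lemma primitive_vanishing: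
  assumes F: "\<And>X. 0 \<le> X \<Longrightarrow> primitive_on X F f"
    and Fi: "integrable half_line_measure F" and fi: "integrable half_line_measure f"
  shows "(\<integral>x. f x \<partial>half_line_measure) = - F 0"
    and "0 \<le> x \<Longrightarrow> cmod (F x) \<le> (\<integral>x. cmod (f x) \<partial>half_line_measure)"
proof -
  define I where "I = (\<integral>x. f x \<partial>half_line_measure)"
  have si: "set_integrable lborel half_line f"
    using fi by (simp add: integrable_half_line_iff)
  have Fx: "F x = F 0 + (LINT y:{0<..x}|lborel. f y)" if "0 \<le> x" for x
    by (rule primitive_onD[OF F[OF that]]) (use that in auto)
  have "((\<lambda>b. LINT x:{0..b}|lborel. indicator half_line x *\<^sub>R f x) \<longlongrightarrow> (LINT x:{0..}|lborel. indicator half_line x *\<^sub>R f x)) at_top"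
  proof (rule tendsto_set_lebesgue_integral_at_top)
    show "set_integrable lborel {0..} (\<lambda>x. indicator half_line x *\<^sub>R f x)"
      unfolding set_integrable_def
      by (rule integrable_mult_indicator) (use si in \<open>auto simp: set_integrable_def\<close>)
  qed auto
  moreover have "(LINT x:{0..b}|lborel. indicator half_line x *\<^sub>R f x) = (LINT x:{0<..b}|lborel. f x)" for b
    unfolding set_lebesgue_integral_def
    by (rule Bochner_Integration.integral_cong) (auto simp: indicator_def)
  moreover have "(LINT x:{0..}|lborel. indicator half_line x *\<^sub>R f x) = I"
    unfolding I_def integral_half_line_eq set_lebesgue_integral_def
    by (rule Bochner_Integration.integral_cong) (auto simp: indicator_def)
  ultimately have lim0: "((\<lambda>b. LINT x:{0<..b}|lborel. f x) \<longlongrightarrow> I) at_top"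
    by simp
  have lim: "(F \<longlongrightarrow> F 0 + I) at_top"
  proof (rule Lim_transform_eventually)
    show "((\<lambda>b. F 0 + (LINT x:{0<..b}|lborel. f x)) \<longlongrightarrow> F 0 + I) at_top"
      by (intro tendsto_intros lim0)
    show "\<forall>\<^sub>F b in at_top. F 0 + (LINT x:{0<..b}|lborel. f x) = F b"
      using eventually_ge_at_top[of 0] by eventually_elim (rule Fx[symmetric])
  qed
  have L0: "F 0 + I = 0"
  proof (rule ccontr)
    assume "F 0 + I \<noteq> 0"
    define d where "d = cmod (F 0 + I) / 2"
    have d: "d > 0" "d < cmod (F 0 + I)" using \<open>F 0 + I \<noteq> 0\<close> by (auto simp: d_def)
    have "\<forall>\<^sub>F x in at_top. d < cmod (F x)"
      using order_tendstoD(1)[OF tendsto_norm[OF lim] d(2)] .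
    then obtain N where N: "\<And>x. N \<le> x \<Longrightarrow> d < cmod (F x)"
      by (auto simp: eventually_at_top_linorder)
    define R where "R = max N 1"
    have "set_integrable lborel {R..} F"
      using Fi unfolding integrable_half_line_iff
      by (rule set_integrable_subset) (auto simp: R_def)
    then have "set_integrable lborel {R..} (\<lambda>x. d)"
      by (rule set_integrable_bound)
        (use N d in \<open>auto simp: set_borel_measurable_def R_def intro!: AE_I2 less_imp_le\<close>)
    then have "integrable lborel (\<lambda>x. indicator {R..} x *\<^sub>R d)"
      by (simp add: set_integrable_def)
    then have "integrable lborel (\<lambda>x. (indicator {R..} x *\<^sub>R d) * (1 / d))"
      by (rule integrable_mult_left)
    then have "integrable lborel (indicator {R..} :: real \<Rightarrow> real)"
      using d by simp
    then have "emeasure lborel {R..} < \<infinity>"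
      by (simp add: integrable_indicator_iff)
    then obtain r where r: "0 \<le> r" "emeasure lborel {R..} = ennreal r"
      by (cases "emeasure lborel {R..}") auto
    \<comment> \<open>An interval of length \<open>r + 1\<close> inside a set of measure
      \<open>r\<close>.\<close>
    have "emeasure lborel {R..R + r + 1} \<le> emeasure lborel {R..}"
      by (rule emeasure_mono) auto
    then show False using r by (simp add: ennreal_le_iff)
  qed
  then show "(\<integral>x. f x \<partial>half_line_measure) = - F 0"
    unfolding I_def by (simp add: eq_neg_iff_add_eq_0 add.commute)
  show "cmod (F x) \<le> (\<integral>x. cmod (f x) \<partial>half_line_measure)" if "0 \<le> x"
  proof -
    have "((\<lambda>y. cmod (F x - F y)) \<longlongrightarrow> cmod (F x - 0)) at_top"
      using lim unfolding L0 by (intro tendsto_intros)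
    moreover have "\<forall>\<^sub>F y in at_top. cmod (F x - F y) \<le> (\<integral>x. cmod (f x) \<partial>half_line_measure)"
      using eventually_ge_at_top[of x]
    proof eventually_elim
      case (elim y)
      have s: "set_integrable lborel {0<..x} f" "set_integrable lborel {x<..y} f"
        using si that by (auto intro: set_integrable_subset)
      have "(LINT z:{0<..x} \<union> {x<..y}|lborel. f z) = (LINT z:{0<..x}|lborel. f z) + (LINT z:{x<..y}|lborel. f z)"
        by (rule set_integral_Un) (use s in auto)
      moreover have "{0<..x} \<union> {x<..y} = {0<..y}" using elim that by auto
      ultimately have "F y - F x = (LINT z:{x<..y}|lborel. f z)"
        using Fx[OF that] Fx[OF order_trans[OF that elim]] by (simp only: add_diff_cancel_left) simp
      then have "cmod (F x - F y) = cmod (LINT z:{x<..y}|lborel. f z)"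
        by (metis norm_minus_commute)
      also have "\<dots> \<le> (\<integral>z. norm (indicator {x<..y} z *\<^sub>R f z) \<partial>lborel)"
        unfolding set_lebesgue_integral_def by (rule integral_norm_bound)
      also have "\<dots> \<le> (\<integral>z. indicator half_line z *\<^sub>R cmod (f z) \<partial>lborel)"
      proof (rule integral_mono)
        show "integrable lborel (\<lambda>z. norm (indicator {x<..y} z *\<^sub>R f z))"
          using s(2) unfolding set_integrable_def by (rule integrable_norm)
        show "integrable lborel (\<lambda>z. indicator half_line z *\<^sub>R cmod (f z))"
          using integrable_norm[OF si[unfolded set_integrable_def]] by simp
      qed (use that in \<open>auto simp: indicator_def\<close>)
      finally show ?case
        by (simp add: integral_half_line_eq set_lebesgue_integral_def)
    qed
    ultimately have "cmod (F x - 0) \<le> (\<integral>x. cmod (f x) \<partial>half_line_measure)"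
      by (intro tendsto_upperbound) auto
    then show ?thesis by simp
  qed
qed


section \<open>H^1 functions on the half-line as absolutely continuous functions\<close>

lemma sq_integrable_imp_set_integrable:
  assumes "sq_integrable half_line_measure f"
  shows "set_integrable lborel {0<..X} f"
proof -
  have m: "(\<lambda>x. indicator half_line x *\<^sub>R f x) \<in> borel_measurable lborel"
    using assms by (simp add: sq_integrable_def borel_measurable_restrict_space_iff)
  have "(\<lambda>x. indicator {0<..X} x *\<^sub>R (indicator half_line x *\<^sub>R f x)) \<in> borel_measurable lborel"
    using m by measurable
  moreover have "(\<lambda>x. indicator {0<..X} x *\<^sub>R (indicator half_line x *\<^sub>R f x)) = (\<lambda>x. indicator {0<..X} x *\<^sub>R f x)"
    by (auto simp: indicator_def)
  ultimately have m': "set_borel_measurable lborel {0<..X} f"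
    by (simp only: set_borel_measurable_def)
  have "set_integrable lborel half_line (\<lambda>x. (cmod (f x))\<^sup>2)"
    using assms by (simp add: sq_integrable_def integrable_half_line_iff)
  then have "set_integrable lborel {0<..X} (\<lambda>x. (cmod (f x))\<^sup>2)"
    by (rule set_integrable_subset) auto
  moreover have "set_integrable lborel {0<..X} (\<lambda>x. 1 :: real)"
    unfolding set_integrable_def by (cases "0 \<le> X") (auto simp: integrable_indicator_iff)
  ultimately have "set_integrable lborel {0<..X} (\<lambda>x. (cmod (f x))\<^sup>2 + 1)"
    by (rule set_integral_add)
  then show ?thesis
  proof (rule set_integrable_bound[OF _ m'])
    \<comment> \<open>On a bounded interval the constant 1 is integrable, so this inequality turns
      square integrability into integrability.\<close>
    have "cmod (f x) \<le> (cmod (f x))\<^sup>2 + 1" for x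
      using sum_squares_bound[of "cmod (f x)" 1] norm_ge_zero[of "f x"] unfolding power_one mult_1_right by linarith
    then show "AE x in lborel. x \<in> {0<..X} \<longrightarrow> norm (f x) \<le> norm ((cmod (f x))\<^sup>2 + 1)"
      by (intro AE_I2) (auto intro: order_trans[OF _ abs_ge_self])
  qed
qed

text \<open>The space H^1 on the half-line, with the absolutely continuous representative built in:
  \<open>f\<close> has genuine point values, in particular a trace \<open>f 0\<close>, whereas
  \<open>f'\<close> matters only up to null sets.\<close>

definition sobolev1 :: "(real \<Rightarrow> complex) \<Rightarrow> (real \<Rightarrow> complex) \<Rightarrow> bool" where
  "sobolev1 f f' \<longleftrightarrow> sq_integrable half_line_measure f \<and> sq_integrable half_line_measure f' \<and>
     (\<forall>X\<ge>0. primitive_on X f f')"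

lemma sobolev1I:
  assumes "sq_integrable half_line_measure f" "sq_integrable half_line_measure f'"
    and "\<And>x. 0 \<le> x \<Longrightarrow> f x = f 0 + (LINT y:{0<..x}|lborel. f' y)"
  shows "sobolev1 f f'"
  unfolding sobolev1_def primitive_on_def
  using assms(1,2) sq_integrable_imp_set_integrable[OF assms(2)] assms(3) by (meson atLeastAtMost_iff)

lemma sobolev1_sq_integrable:
  assumes "sobolev1 f f'"
  shows "sq_integrable half_line_measure f" "sq_integrable half_line_measure f'"
  using assms by (auto simp: sobolev1_def)

lemma sobolev1_primitive:
  "sobolev1 f f' \<Longrightarrow> 0 \<le> X \<Longrightarrow> primitive_on X f f'"
  by (auto simp: sobolev1_def)

lemma sobolev1D:
  assumes "sobolev1 f f'" "0 \<le> x"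
  shows "f x = f 0 + (LINT y:{0<..x}|lborel. f' y)"
  by (rule primitive_onD[OF sobolev1_primitive[OF assms]]) (use assms in auto)

lemma sobolev1_continuous:
  assumes "sobolev1 f f'"
  shows "continuous_on {0..} f"
  by (rule primitive_continuous_half_line[OF sobolev1_primitive[OF assms]])

lemma sobolev1_add:
  assumes "sobolev1 f f'" "sobolev1 g g'"
  shows "sobolev1 (\<lambda>x. f x + g x) (\<lambda>x. f' x + g' x)"
proof (rule sobolev1I)
  note s = sobolev1_sq_integrable[OF assms(1)] sobolev1_sq_integrable[OF assms(2)]
  show "sq_integrable half_line_measure (\<lambda>x. f x + g x)" "sq_integrable half_line_measure (\<lambda>x. f' x + g' x)"
    by (intro sq_integrable_add s)+
  fix x :: real assume x: "0 \<le> x"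
  show "f x + g x = f 0 + g 0 + (LINT y:{0<..x}|lborel. f' y + g' y)"
    using sq_integrable_imp_set_integrable[OF s(2), of x] sq_integrable_imp_set_integrable[OF s(4), of x]
    by (subst sobolev1D[OF assms(1) x], subst sobolev1D[OF assms(2) x]) (simp add: set_integral_add)
qed

lemma sobolev1_cmult:
  assumes "sobolev1 f f'"
  shows "sobolev1 (\<lambda>x. c * f x) (\<lambda>x. c * f' x)"
proof (rule sobolev1I)
  note s = sobolev1_sq_integrable[OF assms]
  show "sq_integrable half_line_measure (\<lambda>x. c * f x)" "sq_integrable half_line_measure (\<lambda>x. c * f' x)"
    by (intro sq_integrable_cmult s)+
  fix x :: real assume x: "0 \<le> x"
  show "c * f x = c * f 0 + (LINT y:{0<..x}|lborel. c * f' y)"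
    by (subst sobolev1D[OF assms x]) (simp add: distrib_left)
qed

lemma sobolev1_diff:
  assumes "sobolev1 f f'" "sobolev1 g g'"
  shows "sobolev1 (\<lambda>x. f x - g x) (\<lambda>x. f' x - g' x)"
  using sobolev1_add[OF assms(1) sobolev1_cmult[OF assms(2), of "-1"]] by simp

lemma sobolev1_cnj:
  assumes "sobolev1 f f'"
  shows "sobolev1 (\<lambda>x. cnj (f x)) (\<lambda>x. cnj (f' x))"
proof (rule sobolev1I)
  note s = sobolev1_sq_integrable[OF assms]
  show "sq_integrable half_line_measure (\<lambda>x. cnj (f x))" "sq_integrable half_line_measure (\<lambda>x. cnj (f' x))"
    by (intro sq_integrable_cnj s)+
  fix x :: real assume x: "0 \<le> x"
  have "(LINT y:{0<..x}|lborel. cnj (f' y)) = cnj (LINT y:{0<..x}|lborel. f' y)"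
    using Bochner_Integration.integral_cnj[of lborel "\<lambda>y. indicator {0<..x} y *\<^sub>R f' y"]
    by (simp add: set_lebesgue_integral_def)
  then show "cnj (f x) = cnj (f 0) + (LINT y:{0<..x}|lborel. cnj (f' y))"
    by (subst sobolev1D[OF assms x]) simp
qed

text \<open>The product and its derivative are integrable, so the product vanishes at infinity and
  only the boundary term at 0 survives.\<close>

lemma sobolev1_integration_by_parts:
  assumes "sobolev1 f f'" "sobolev1 g g'"
  shows "(\<integral>x. f' x * g x \<partial>half_line_measure) + (\<integral>x. f x * g' x \<partial>half_line_measure) = - (f 0 * g 0)"
proof -
  note s = sobolev1_sq_integrable[OF assms(1)] sobolev1_sq_integrable[OF assms(2)]
  note i = sq_integrable_mult[OF s(2,3)] sq_integrable_mult[OF s(1,4)]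
  have "(\<integral>x. f' x * g x + f x * g' x \<partial>half_line_measure) = - (f 0 * g 0)"
    by (rule primitive_vanishing(1)[OF primitive_on_mult[OF sobolev1_primitive[OF assms(1)]
          sobolev1_primitive[OF assms(2)]]]) (use i sq_integrable_mult[OF s(1,3)] in auto)
  with i show ?thesis by simp
qed

text \<open>Applied to \<open>f * cnj f\<close>, the uniform bound for vanishing primitives gives
  the integral of \<open>2 |f| |f'|\<close>, and Cauchy-Schwarz does the rest. The factor 2
  reappears in the quartic estimate and, as \<open>sqrt 2\<close>, in the pointwise bound of the
  theorem.\<close>

lemma sobolev1_sup_bound:
  assumes "sobolev1 f f'" "0 \<le> x"
  shows "(cmod (f x))\<^sup>2 \<le> 2 * l2norm half_line_measure f * l2norm half_line_measure f'"
proof -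
  note c = sobolev1_cnj[OF assms(1)]
  note s = sobolev1_sq_integrable[OF assms(1)] sobolev1_sq_integrable[OF c]
  note i = sq_integrable_mult[OF s(2,3)] sq_integrable_mult[OF s(1,4)]
  have "cmod (f x * cnj (f x)) \<le> (\<integral>x. cmod (f' x * cnj (f x) + f x * cnj (f' x)) \<partial>half_line_measure)"
    by (rule primitive_vanishing(2)[OF primitive_on_mult[OF sobolev1_primitive[OF assms(1)]
          sobolev1_primitive[OF c]]]) (use i sq_integrable_mult[OF s(1,3)] assms(2) in auto)
  also have "\<dots> \<le> (\<integral>x. 2 * (cmod (f x) * cmod (f' x)) \<partial>half_line_measure)"
  proof (rule integral_mono)
    show "integrable half_line_measure (\<lambda>x. cmod (f' x * cnj (f x) + f x * cnj (f' x)))"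
      using i by simp
    show "integrable half_line_measure (\<lambda>x. 2 * (cmod (f x) * cmod (f' x)))"
      using integrable_norm[OF i(2)] by (simp add: norm_mult)
    fix x
    show "cmod (f' x * cnj (f x) + f x * cnj (f' x)) \<le> 2 * (cmod (f x) * cmod (f' x))"
      using norm_triangle_ineq[of "f' x * cnj (f x)" "f x * cnj (f' x)"] by (simp add: norm_mult mult.commute)
  qed
  also have "\<dots> \<le> 2 * (l2norm half_line_measure f * l2norm half_line_measure f')"
    using l2_Cauchy_Schwarz[OF s(1,2)] by simp
  finally show ?thesis by (simp add: norm_mult power2_eq_square)
qed

text \<open>H^1 is an algebra in one dimension: by the sup bound each product has one bounded and
  one square-integrable factor.\<close>

lemma sobolev1_mult:
  assumes "sobolev1 f f'" "sobolev1 g g'"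
  shows "sobolev1 (\<lambda>x. f x * g x) (\<lambda>x. f' x * g x + f x * g' x)"
proof -
  note s = sobolev1_sq_integrable[OF assms(1)] sobolev1_sq_integrable[OF assms(2)]
  have m: "h \<in> borel_measurable half_line_measure" if "sq_integrable half_line_measure h" for h
    using that by (simp add: sq_integrable_def)
  have b: "cmod (h x) \<le> sqrt (2 * l2norm half_line_measure h * l2norm half_line_measure h')"
    if "sobolev1 h h'" "x \<in> space half_line_measure" for h h' x
    using sobolev1_sup_bound[OF that(1), of x] that(2)
    by (intro real_le_rsqrt) (auto simp: space_restrict_space)
  show ?thesis
    unfolding sobolev1_def
  proof (intro conjI allI impI)
    show "sq_integrable half_line_measure (\<lambda>x. f x * g x)"
      by (rule sq_integrable_bounded_mult[OF s(3) m[OF s(1)] b[OF assms(1)]])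
    have "sq_integrable half_line_measure (\<lambda>x. g x * f' x)"
      by (rule sq_integrable_bounded_mult[OF s(2) m[OF s(3)] b[OF assms(2)]])
    moreover have "sq_integrable half_line_measure (\<lambda>x. f x * g' x)"
      by (rule sq_integrable_bounded_mult[OF s(4) m[OF s(1)] b[OF assms(1)]])
    ultimately show "sq_integrable half_line_measure (\<lambda>x. f' x * g x + f x * g' x)"
      using sq_integrable_add by (simp add: mult.commute)
    show "primitive_on X (\<lambda>x. f x * g x) (\<lambda>x. f' x * g x + f x * g' x)" if "0 \<le> X" for X
      using assms that by (intro primitive_on_mult sobolev1_primitive)
  qed
qed

subsection \<open>Weak derivatives\<close>

text \<open>The half-lines \<open>{..a}\<close> are stable under intersection and generate the Borel
  sets, so the vanishing of the integral spreads to all Borel sets. Passing to complements needs the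
  integral over the whole line, which is the limit of those over \<open>{..real n}\<close>.\<close>

lemma AE_zero_if_integral_atMost_zero:
  fixes k :: "real \<Rightarrow> complex"
  assumes k: "integrable lborel k" and z: "\<And>a. (LINT x:{..a}|lborel. k x) = 0"
  shows "AE x in lborel. k x = 0"
proof -
  have si: "set_integrable lborel A k" if "A \<in> sets borel" for A
    using k that unfolding set_integrable_def by (intro integrable_mult_indicator) auto
  have UN: "(\<integral>x. k x \<partial>lborel) = 0"
  proof -
    have "(\<lambda>n. LINT x:{..real n}|lborel. k x) \<longlonglongrightarrow> (LINT x:(\<Union>n. {..real n})|lborel. k x)"
      by (rule set_integral_cont_up) (auto simp: incseq_def intro!: si)
    moreover have "(\<Union>n. {..real n}) = UNIV"
      by (auto intro: real_arch_simple)
    ultimately have "(LINT x:UNIV|lborel. k x) = 0"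
      unfolding z by (simp add: LIMSEQ_const_iff)
    then show ?thesis
      by (simp add: set_lebesgue_integral_def)
  qed
  have "(LINT x:A|lborel. k x) = 0" if "A \<in> sigma_sets UNIV (range (\<lambda>a::real. {..a}))" for A
  proof (rule sigma_sets_induct_disjoint[OF _ _ that])
    show "Int_stable (range (\<lambda>a::real. {..a}))"
      by (auto simp: Int_stable_def)
    show "(LINT x:A|lborel. k x) = 0" if "A \<in> range (\<lambda>a::real. {..a})" for A
      using that z by auto
    show "(LINT x:{}|lborel. k x) = 0"
      by (simp add: set_lebesgue_integral_def)
  next
    fix A assume "A \<in> sigma_sets UNIV (range (\<lambda>a::real. {..a}))" and 0: "(LINT x:A|lborel. k x) = 0"
    then have A: "A \<in> sets borel" by (simp add: borel_eq_atMost)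
    have "(LINT x:A \<union> (UNIV - A)|lborel. k x) = (LINT x:A|lborel. k x) + (LINT x:UNIV - A|lborel. k x)"
      by (rule set_integral_Un) (use A in \<open>auto intro!: si\<close>)
    then show "(LINT x:UNIV - A|lborel. k x) = 0"
      using 0 UN by (simp add: set_lebesgue_integral_def)
  next
    fix A :: "nat \<Rightarrow> real set"
    assume d: "disjoint_family A" and "range A \<subseteq> sigma_sets UNIV (range (\<lambda>a::real. {..a}))"
      and 0: "\<And>i. (LINT x:A i|lborel. k x) = 0"
    then have A: "A i \<in> sets borel" for i by (auto simp: borel_eq_atMost)
    have "(LINT x:(\<Union>i. A i)|lborel. k x) = (\<Sum>i. (LINT x:(A i)|lborel. k x))"
      by (rule lebesgue_integral_countable_add)
        (use A d in \<open>auto intro!: si simp: disjoint_family_on_def\<close>)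
    then show "(LINT x:(\<Union>i. A i)|lborel. k x) = 0" using 0 by simp
  qed auto
  then have "(LINT x:A|lborel. k x) = 0" if "A \<in> sets lborel" for A
    using that by (simp add: borel_eq_atMost)
  then show ?thesis
    by (intro sigma_finite_measure.density_zero[OF sigma_finite_lborel] k)
qed

section \<open>The du Bois-Reymond lemma: weakly differentiable functions are primitives\<close>

lemma set_integral_Ioc_eq_Icc:
  fixes f :: "real \<Rightarrow> 'b::{banach, second_countable_topology}"
  shows "(LINT x:{a<..b}|lborel. f x) = (LINT x:{a..b}|lborel. f x)"
  by (rule set_integral_discrete_difference[where X="{a}"]) auto

text \<open>A primitive of \<open>v\<close> is constant to the left of \<open>a\<close> and to the
  right of \<open>b\<close>, and mean zero says that the two constants agree. Subtracting this
  constant leaves compact support. Since test functions are only C^1, a continuous \<open>v\<close>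
  is enough.\<close>

lemma test_function_mean_zero:
  fixes v :: "real \<Rightarrow> real"
  assumes v: "continuous_on UNIV v" and ab: "0 < a" "a \<le> b"
    and supp: "\<And>x. x \<notin> {a<..<b} \<Longrightarrow> v x = 0" and mean: "(\<integral>x. v x \<partial>lborel) = 0"
  shows "\<exists>phi. test_function phi v \<and> (\<forall>x. x \<notin> {a..b} \<longrightarrow> phi x = 0)"
proof -
  obtain F where F: "\<And>x. (F has_vector_derivative v x) (at x)"
    using einterval_antiderivative[of "-\<infinity>" "\<infinity>" v] v by (auto simp: continuous_on_eq_continuous_at)
  have ftc: "(v has_integral F y - F x) {x..y}" if "x \<le> y" for x y
    by (rule fundamental_theorem_of_calculus[OF that]) (auto intro: has_vector_derivative_at_within F)
  have 0: "F y = F x" if "x \<le> y" "\<And>z. z \<in> {x..y} \<Longrightarrow> v z = 0" for x y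
    using has_integral_unique[OF ftc[OF that(1)] has_integral_is_0[of "{x..y}" v]] that(2) by auto
  have "F b - F a = (\<integral>x. indicator {a..b} x *\<^sub>R v x \<partial>lborel)"
    by (rule integral_FTC_atLeastAtMost[symmetric])
      (use ab v in \<open>auto intro: has_vector_derivative_at_within F continuous_on_subset\<close>)
  also have "(\<lambda>x. indicator {a..b} x *\<^sub>R v x) = v"
  proof
    show "indicator {a..b} x *\<^sub>R v x = v x" for x
      by (cases "x \<in> {a<..<b}") (auto simp: supp indicator_def)
  qed
  finally have Fab: "F b = F a" using mean by simp
  have out: "F x - F a = 0" if "x \<notin> {a..b}" for x
  proof (cases "x < a")
    case True
    then show ?thesis using 0[of x a] supp by auto
  next
    case False
    with that have "b \<le> x" by auto
    then show ?thesis using 0[of b x] supp Fab by auto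
  qed
  show ?thesis
    unfolding test_function_def
    by (rule exI[of _ "\<lambda>x. F x - F a"])
      (use out F v ab in \<open>auto intro!: derivative_eq_intros simp: has_real_derivative_iff_has_vector_derivative\<close>)
qed

text \<open>Let \<open>phi\<close> be the test function with derivative \<open>v\<close> and
  \<open>G\<close> the primitive of \<open>g\<close>. The weak derivative turns the integral of
  \<open>v f\<close> into minus that of \<open>phi g\<close>, and integration by parts, with
  \<open>phi\<close> vanishing at 0 and at \<open>b\<close>, does the same for \<open>v G\<close>.
  So \<open>f - G\<close> is orthogonal to every such \<open>v\<close>.\<close>

lemma weak_derivative_mean_zero:
  assumes wd: "weak_derivative f g"
    and f: "sq_integrable half_line_measure f" and g: "sq_integrable half_line_measure g"
    and v: "continuous_on UNIV v" and ab: "0 < a" "a \<le> b"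
    and supp: "\<And>x. x \<notin> {a<..<b} \<Longrightarrow> v x = 0" and mean: "(\<integral>x. v x \<partial>lborel) = 0"
  shows "(LINT x:{0<..b}|lborel. v x *\<^sub>R (f x - (LINT y:{0<..x}|lborel. g y))) = 0"
proof -
  define G where "G = (\<lambda>x. LINT y:{0<..x}|lborel. g y)"
  obtain phi where phi: "test_function phi v" "\<And>x. x \<notin> {a..b} \<Longrightarrow> phi x = 0"
    using test_function_mean_zero[OF v ab supp mean] by blast
  have phi': "(phi has_vector_derivative v x) (at x)" for x
    using phi(1) by (auto simp: test_function_def has_real_derivative_iff_has_vector_derivative)
  have c: "continuous_on A phi" for A
    using phi' by (meson has_vector_derivative_continuous continuous_at_imp_continuous_on)
  \<comment> \<open>The support condition says nothing at the end points of \<open>{a..b}\<close>;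
    the value at \<open>b\<close> follows by continuity from the right.\<close>
  have phib: "phi b = 0"
  proof -
    have "phi x = 0" if "x \<in> {b<..}" for x using phi(2) that by auto
    moreover have "b \<in> closure {b<..}" by simp
    ultimately show ?thesis
      using continuous_constant_on_closure[of "{b<..}" phi 0 b] c by auto
  qed
  have phi0: "phi 0 = 0" using phi(2) ab by auto
  have wd': "(LINT x:half_line|lborel. v x *\<^sub>R f x) = - (LINT x:half_line|lborel. phi x *\<^sub>R g x)"
    using wd phi(1) by (auto simp: weak_derivative_def)
  have r1: "(LINT x:half_line|lborel. v x *\<^sub>R f x) = (LINT x:{0<..b}|lborel. v x *\<^sub>R f x)"
    unfolding set_lebesgue_integral_def
    by (rule Bochner_Integration.integral_cong) (use supp in \<open>auto simp: indicator_def\<close>)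
  have r2: "(LINT x:half_line|lborel. phi x *\<^sub>R g x) = (LINT x:{0<..b}|lborel. phi x *\<^sub>R g x)"
    unfolding set_lebesgue_integral_def
    by (rule Bochner_Integration.integral_cong) (use phi(2) in \<open>auto simp: indicator_def\<close>)
  have sv: "set_integrable lborel {0<..b} v"
    by (rule set_integrable_subset[OF borel_integrable_atLeastAtMost'[OF continuous_on_subset[OF v]], of 0 b]) auto
  have sv': "set_integrable lborel {0<..b} (\<lambda>x. complex_of_real (v x))"
    using sv unfolding set_integrable_def
    by (subst (asm) complex_of_real_integrable_eq[symmetric]) (simp add: scaleR_conv_of_real)
  have "primitive_on b (\<lambda>x. complex_of_real (phi x)) (\<lambda>x. complex_of_real (v x))"
    unfolding primitive_on_def
  proof (intro conjI ballI sv')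
    fix x assume x: "x \<in> {0..b}"
    have "(LINT y:{0<..x}|lborel. complex_of_real (v y)) = complex_of_real (LINT y:{0<..x}|lborel. v y)"
      by (rule set_integral_complex_of_real)
    also have "(LINT y:{0<..x}|lborel. v y) = phi x - phi 0"
      unfolding set_integral_Ioc_eq_Icc unfolding set_lebesgue_integral_def
      by (rule integral_FTC_atLeastAtMost)
        (use x v in \<open>auto intro: has_vector_derivative_at_within phi' continuous_on_subset\<close>)
    finally show "complex_of_real (phi x) = complex_of_real (phi 0) + (LINT y:{0<..x}|lborel. complex_of_real (v y))"
      by simp
  qed
  moreover have G: "primitive_on b G g"
    unfolding primitive_on_def G_def
    using sq_integrable_imp_set_integrable[OF g] by (auto simp: set_lebesgue_integral_def)
  ultimately have p: "primitive_on b (\<lambda>x. complex_of_real (phi x) * G x)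
      (\<lambda>x. complex_of_real (v x) * G x + complex_of_real (phi x) * g x)"
    using ab by (intro primitive_on_mult) auto
  have "complex_of_real (phi b) * G b = complex_of_real (phi 0) * G 0
      + (LINT x:{0<..b}|lborel. complex_of_real (v x) * G x + complex_of_real (phi x) * g x)"
    by (rule primitive_onD[OF p]) (use ab in auto)
  then have z: "(LINT x:{0<..b}|lborel. complex_of_real (v x) * G x + complex_of_real (phi x) * g x) = 0"
    by (simp add: phib phi0)
  have bm: "set_integrable lborel {0<..b} (\<lambda>x. w x *\<^sub>R h x)"
    if w: "continuous_on UNIV w" and h: "set_integrable lborel {0<..b} h" for w :: "real \<Rightarrow> real" and h :: "real \<Rightarrow> complex"
  proof -
    have "compact (w ` {0..b})"
      using w by (intro compact_continuous_image continuous_on_subset[OF w]) auto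
    then obtain K where K: "\<And>x. x \<in> {0..b} \<Longrightarrow> \<bar>w x\<bar> \<le> K"
      by (force dest!: compact_imp_bounded simp: bounded_iff)
    have [measurable]: "w \<in> borel_measurable borel" "w \<in> borel_measurable lborel"
      using w by (auto intro: borel_measurable_continuous_onI)
    have [measurable]: "(\<lambda>x. indicator {0<..b} x *\<^sub>R h x) \<in> borel_measurable lborel"
      using h by (auto simp: set_integrable_def)
    have "(\<lambda>x. w x *\<^sub>R (indicator {0<..b} x *\<^sub>R h x)) \<in> borel_measurable lborel"
      by measurable
    then have m: "set_borel_measurable lborel {0<..b} (\<lambda>x. w x *\<^sub>R h x)"
      by (simp add: set_borel_measurable_def mult.commute)
    have "set_integrable lborel {0<..b} (\<lambda>x. K *\<^sub>R h x)"
      using h by simp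
    then show ?thesis
      by (rule set_integrable_bound[OF _ m]) (use K in \<open>auto intro!: AE_I2 mult_right_mono order_trans[OF K]\<close>)
  qed
  have cphi: "continuous_on UNIV phi" by (rule c)
  note vf = bm[OF v sq_integrable_imp_set_integrable[OF f]] 
  note ig = bm[OF cphi sq_integrable_imp_set_integrable[OF g]]
  have Gi: "set_integrable lborel {0<..b} G"
    by (rule set_integrable_subset[OF borel_integrable_atLeastAtMost'[OF primitive_on_continuous[OF G]]]) auto
  note iG = bm[OF v Gi]
  have "(LINT x:{0<..b}|lborel. v x *\<^sub>R G x) + (LINT x:{0<..b}|lborel. phi x *\<^sub>R g x) = 0"
    using z set_integral_add(2)[OF iG ig] by (simp add: scaleR_conv_of_real)
  moreover have "(LINT x:{0<..b}|lborel. v x *\<^sub>R (f x - G x))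
      = (LINT x:{0<..b}|lborel. v x *\<^sub>R f x) - (LINT x:{0<..b}|lborel. v x *\<^sub>R G x)"
    using set_integral_diff(2)[OF vf iG] by (simp add: scaleR_diff_right)
  ultimately have "(LINT x:{0<..b}|lborel. v x *\<^sub>R (f x - G x)) = 0"
    using wd' unfolding r1 r2 by (simp add: add_eq_0_iff)
  then show ?thesis by (simp add: G_def)
qed


text \<open>A continuous approximation from below to the indicator of the open interval from
  \<open>c\<close> to \<open>d\<close>, with edges of slope \<open>n\<close> (a triangle while
  \<open>n\<close> is too small for the plateau at height 1). Derivatives of test functions must be
  continuous, which rules out the indicator itself.\<close>

definition trapezoid :: "nat \<Rightarrow> real \<Rightarrow> real \<Rightarrow> real \<Rightarrow> real" where
  "trapezoid n c d x = min 1 (real n * max 0 (min (x - c) (d - x)))"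

lemma trapezoid_continuous: "continuous_on UNIV (trapezoid n c d)"
  unfolding trapezoid_def by (intro continuous_intros)

lemma trapezoid_bounds: "0 \<le> trapezoid n c d x" "trapezoid n c d x \<le> 1"
  by (auto simp: trapezoid_def)

lemma trapezoid_outside: "x \<notin> {c<..<d} \<Longrightarrow> trapezoid n c d x = 0"
  by (auto simp: trapezoid_def)

lemma trapezoid_tendsto_indicator: "(\<lambda>n. trapezoid n c d x) \<longlonglongrightarrow> indicator {c<..<d} x"
proof (cases "x \<in> {c<..<d}")
  case True
  define m where "m = min (x - c) (d - x)"
  have m: "m > 0" using True by (auto simp: m_def)
  obtain N where N: "1 < real N * m" using reals_Archimedean3[OF m] by blast
  have "trapezoid n c d x = 1" if "n \<ge> N" for n
  proof -
    have "1 < real n * m" using N mult_right_mono[of "real N" "real n" m] m that by linarith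
    then show ?thesis using m by (simp add: trapezoid_def m_def[symmetric])
  qed
  then show ?thesis
    using True by (intro tendsto_eventually) (auto simp: eventually_sequentially)
next
  case False
  then show ?thesis by (simp add: trapezoid_outside)
qed

lemma trapezoid_measurable [measurable]: "trapezoid n c d \<in> borel_measurable borel"
  by (rule borel_measurable_continuous_onI[OF trapezoid_continuous])

lemma trapezoid_integrable:
  fixes k :: "real \<Rightarrow> 'b::{banach, second_countable_topology}"
  assumes k: "set_integrable lborel S k"
  shows "set_integrable lborel S (\<lambda>x. trapezoid n c d x *\<^sub>R k x)"
proof (rule set_integrable_bound[OF k])
  have "(\<lambda>x. indicator S x *\<^sub>R k x) \<in> borel_measurable lborel"
    using k by (auto simp: set_integrable_def)
  then have "(\<lambda>x. trapezoid n c d x *\<^sub>R (indicator S x *\<^sub>R k x)) \<in> borel_measurable lborel"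
    by measurable
  then show "set_borel_measurable lborel S (\<lambda>x. trapezoid n c d x *\<^sub>R k x)"
    by (simp add: set_borel_measurable_def mult.commute)
  show "AE x in lborel. x \<in> S \<longrightarrow> norm (trapezoid n c d x *\<^sub>R k x) \<le> norm (k x)"
    using trapezoid_bounds[of n c d] by (intro AE_I2) (auto intro!: mult_left_le_one_le)
qed

lemma trapezoid_integral_tendsto:
  fixes k :: "real \<Rightarrow> 'b::{banach, second_countable_topology}"
  assumes k: "set_integrable lborel S k" and S: "{c<..<d} \<subseteq> S"
  shows "(\<lambda>n. LINT x:S|lborel. trapezoid n c d x *\<^sub>R k x) \<longlonglongrightarrow> (LINT x:{c<..<d}|lborel. k x)"
  unfolding set_lebesgue_integral_def
proof (rule integral_dominated_convergence[where w="\<lambda>x. norm (indicator S x *\<^sub>R k x)"])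
  show "integrable lborel (\<lambda>x. norm (indicator S x *\<^sub>R k x))"
    using k unfolding set_integrable_def by (rule integrable_norm)
  have "set_integrable lborel {c<..<d} k"
    using k by (rule set_integrable_subset) (use S in auto)
  then show "(\<lambda>x. indicator {c<..<d} x *\<^sub>R k x) \<in> borel_measurable lborel"
    by (auto simp: set_integrable_def)
  fix n
  show "(\<lambda>x. indicator S x *\<^sub>R trapezoid n c d x *\<^sub>R k x) \<in> borel_measurable lborel"
    using trapezoid_integrable[OF k, of n c d] by (auto simp: set_integrable_def)
  show "AE x in lborel. norm (indicator S x *\<^sub>R trapezoid n c d x *\<^sub>R k x) \<le> norm (indicator S x *\<^sub>R k x)"
    using trapezoid_bounds[of n c d] by (intro AE_I2) (auto simp: indicator_def intro!: mult_left_le_one_le)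
next
  show "AE x in lborel. (\<lambda>n. indicator S x *\<^sub>R trapezoid n c d x *\<^sub>R k x) \<longlonglongrightarrow> indicator {c<..<d} x *\<^sub>R k x"
  proof (rule AE_I2)
    fix x
    have "(\<lambda>n. indicator S x *\<^sub>R trapezoid n c d x *\<^sub>R k x) \<longlonglongrightarrow> indicator S x *\<^sub>R indicator {c<..<d} x *\<^sub>R k x"
      by (intro tendsto_intros trapezoid_tendsto_indicator)
    moreover have "indicator S x *\<^sub>R indicator {c<..<d} x *\<^sub>R k x = indicator {c<..<d} x *\<^sub>R k x"
      using S by (auto simp: indicator_def)
    ultimately show "(\<lambda>n. indicator S x *\<^sub>R trapezoid n c d x *\<^sub>R k x) \<longlonglongrightarrow> indicator {c<..<d} x *\<^sub>R k x"
      by (simp only:)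
  qed
qed

text \<open>Combining two trapezoids into a test function of mean zero shows that the mean value of
  \<open>f - \<integral>g\<close> over an interval does not depend on the interval.\<close>
lemma weak_derivative_primitive:
  assumes wd: "weak_derivative f g"
    and f: "sq_integrable half_line_measure f" and g: "sq_integrable half_line_measure g"
  shows "\<exists>C. AE x in half_line_measure. f x = C + (LINT y:{0<..x}|lborel. g y)"
proof -
  define G where "G = (\<lambda>x. LINT y:{0<..x}|lborel. g y)"
  define h where "h = (\<lambda>x. f x - G x)"
  \<comment> \<open>The reference interval has length 1, so \<open>C\<close> is the mean of
    \<open>h\<close> over it; the choice of the interval is arbitrary.\<close>
  define C where "C = (LINT x:{1<..<2}|lborel. h x)"
  have hi: "set_integrable lborel {0<..X} h" for X
  proof -
    have "primitive_on X G g"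
      unfolding primitive_on_def G_def
      using sq_integrable_imp_set_integrable[OF g] by (auto simp: set_lebesgue_integral_def)
    then have "set_integrable lborel {0<..X} G"
      by (intro set_integrable_subset[OF borel_integrable_atLeastAtMost'[OF primitive_on_continuous]]) auto
    then show ?thesis
      unfolding h_def using sq_integrable_imp_set_integrable[OF f] by (intro set_integral_diff)
  qed
  have I: "(LINT x:{c<..<d}|lborel. h x) = (d - c) *\<^sub>R C" if cd: "0 < c" "c < d" for c d
  proof -
    define b where "b = max d 2"
    define A where "A = (\<lambda>n. LINT x:{0<..b}|lborel. trapezoid n 1 2 x *\<^sub>R (1::real))"
    define B where "B = (\<lambda>n. LINT x:{0<..b}|lborel. trapezoid n c d x *\<^sub>R (1::real))"
    have one: "set_integrable lborel {0<..b} (\<lambda>x. 1 :: real)"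
      unfolding set_integrable_def using cd by (auto simp: integrable_indicator_iff b_def)
    have sub: "{1<..<2} \<subseteq> {0<..b}" "{c<..<d} \<subseteq> {0<..b}"
      using cd by (auto simp: b_def)
    have A: "A \<longlonglongrightarrow> 1"
      using trapezoid_integral_tendsto[OF one sub(1)] by (simp add: A_def set_lebesgue_integral_def)
    have B: "B \<longlonglongrightarrow> d - c"
      using trapezoid_integral_tendsto[OF one sub(2)] cd by (simp add: B_def set_lebesgue_integral_def)
    have eq: "A n *\<^sub>R (LINT x:{0<..b}|lborel. trapezoid n c d x *\<^sub>R h x)
        = B n *\<^sub>R (LINT x:{0<..b}|lborel. trapezoid n 1 2 x *\<^sub>R h x)" for n
    proof -
      \<comment> \<open>\<open>A n\<close> and \<open>B n\<close> are the integrals of the two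
        trapezoids, so the crossed weights give mean zero. As \<open>n\<close> grows they tend to
        the interval lengths 1 and \<open>d - c\<close>.\<close>
      define v where "v = (\<lambda>x. A n * trapezoid n c d x - B n * trapezoid n 1 2 x)"
      note t1 = trapezoid_integrable[OF one, of n 1 2] and t2 = trapezoid_integrable[OF one, of n c d]
      have out: "v x = 0" if "x \<notin> {min c 1<..<b}" for x
      proof -
        have "x \<notin> {c<..<d}" "x \<notin> {1<..<2}" using that by (auto simp: b_def)
        then show ?thesis by (simp add: v_def trapezoid_outside)
      qed
      have "(\<integral>x. v x \<partial>lborel) = (LINT x:{0<..b}|lborel. v x)"
        unfolding set_lebesgue_integral_def
      proof (rule Bochner_Integration.integral_cong)
        show "v x = indicator {0<..b} x *\<^sub>R v x" for x
          using out[of x] cd by (cases "x \<in> {min c 1<..<b}") (auto simp: indicator_def)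
      qed simp
      also have "\<dots> = A n * B n - B n * A n"
        using t1 t2 unfolding v_def A_def B_def
        by (subst set_integral_diff) auto
      finally have mean: "(\<integral>x. v x \<partial>lborel) = 0" by simp
      have "(LINT x:{0<..b}|lborel. v x *\<^sub>R h x) = 0"
        unfolding h_def G_def
      proof (rule weak_derivative_mean_zero[OF wd f g _ _ _ out mean])
        show "continuous_on UNIV v"
          unfolding v_def by (intro continuous_intros trapezoid_continuous)
      qed (use cd in \<open>auto simp: b_def\<close>)
      moreover have "(LINT x:{0<..b}|lborel. v x *\<^sub>R h x)
          = (LINT x:{0<..b}|lborel. A n *\<^sub>R (trapezoid n c d x *\<^sub>R h x) - B n *\<^sub>R (trapezoid n 1 2 x *\<^sub>R h x))"
        by (rule arg_cong[where f="set_lebesgue_integral lborel {0<..b}"]) (auto simp: v_def scaleR_diff_left)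
      moreover have "\<dots> = A n *\<^sub>R (LINT x:{0<..b}|lborel. trapezoid n c d x *\<^sub>R h x)
          - B n *\<^sub>R (LINT x:{0<..b}|lborel. trapezoid n 1 2 x *\<^sub>R h x)"
        by (subst set_integral_diff)
          (auto intro!: trapezoid_integrable hi simp del: scaleR_scaleR simp: set_integral_scaleR_right)
      ultimately show ?thesis by simp
    qed
    have "(\<lambda>n. A n *\<^sub>R (LINT x:{0<..b}|lborel. trapezoid n c d x *\<^sub>R h x)) \<longlonglongrightarrow> 1 *\<^sub>R (LINT x:{c<..<d}|lborel. h x)"
      by (intro tendsto_scaleR A trapezoid_integral_tendsto hi sub)
    moreover have "(\<lambda>n. A n *\<^sub>R (LINT x:{0<..b}|lborel. trapezoid n c d x *\<^sub>R h x)) \<longlonglongrightarrow> (d - c) *\<^sub>R C"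
      unfolding eq C_def by (intro tendsto_scaleR B trapezoid_integral_tendsto hi sub)
    ultimately show ?thesis
      using LIMSEQ_unique by fastforce
  qed
  \<comment> \<open>These intervals stay away from 0, as \<open>I\<close> requires, are bounded, so
    that the constant \<open>C\<close> is integrable on them, and exhaust the half-line.\<close>
  have "AE x in lborel. indicator {1 / real (Suc n)<..<real (Suc n)} x *\<^sub>R (h x - C) = 0" for n
  proof (rule AE_zero_if_integral_atMost_zero)
    let ?l = "1 / real (Suc n)" and ?r = "real (Suc n)"
    have ss: "set_integrable lborel {l<..<r} h" if "0 < l" for l r
      by (rule set_integrable_subset[OF hi[of r]]) (use that in auto)
    have cc: "set_integrable lborel {l<..<r} (\<lambda>x. C)" for l r :: real
      unfolding set_integrable_def by (cases "l \<le> r") (auto simp: integrable_indicator_iff)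
    show "integrable lborel (\<lambda>x. indicator {?l<..<?r} x *\<^sub>R (h x - C))"
      using set_integral_diff(1)[OF ss cc, of ?l ?r] by (simp add: set_integrable_def)
    have z: "(LINT x:{l<..<r}|lborel. h x - C) = 0" if "0 < l" for l r
    proof (cases "l < r")
      case True
      have "(LINT x:{l<..<r}|lborel. C) = (r - l) *\<^sub>R C"
        using True by (subst set_integral_const) auto
      then show ?thesis
        using I[OF that True] by (simp add: set_integral_diff(2)[OF ss[OF that] cc])
    qed (simp add: set_lebesgue_integral_def)
    fix a :: real
    have "(LINT x:{..a}|lborel. indicator {?l<..<?r} x *\<^sub>R (h x - C)) = (LINT x:{..a} \<inter> {?l<..<?r}|lborel. h x - C)"
      unfolding set_lebesgue_integral_def
      by (rule Bochner_Integration.integral_cong) (auto simp: indicator_def)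
    also have "\<dots> = (LINT x:{?l<..<min a ?r}|lborel. h x - C)"
      \<comment> \<open>The two domains can differ only in the point \<open>a\<close>.\<close>
      by (rule set_integral_discrete_difference[where X="{a}"]) auto
    also have "\<dots> = 0" by (rule z) simp
    finally show "(LINT x:{..a}|lborel. indicator {?l<..<?r} x *\<^sub>R (h x - C)) = 0" .
  qed
  then have "AE x in lborel. \<forall>n. indicator {1 / real (Suc n)<..<real (Suc n)} x *\<^sub>R (h x - C) = 0"
    by (intro AE_all_countable[THEN iffD2] allI)
  then have "AE x in lborel. x \<in> half_line \<longrightarrow> h x = C"
  proof eventually_elim
    case (elim x)
    show ?case
    proof
      assume "x \<in> half_line"
      then have x: "0 < x" by simp
      obtain n where n: "max x (1 / x) < real n" using reals_Archimedean2 by blast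
      then have "1 / x < real (Suc n)" "x < real (Suc n)" by auto
      then have "1 / real (Suc n) < x" using x by (simp add: field_simps)
      then have "x \<in> {1 / real (Suc n)<..<real (Suc n)}" using \<open>x < real (Suc n)\<close> by simp
      then show "h x = C" using elim[rule_format, of n] by simp
    qed
  qed
  then have "AE x in half_line_measure. h x = C"
    by (simp add: AE_restrict_space_iff)
  then have "AE x in half_line_measure. f x = C + (LINT y:{0<..x}|lborel. g y)"
    by eventually_elim (auto simp: h_def G_def algebra_simps)
  then show ?thesis ..
qed

section \<open>Continuous representatives and their classical derivatives\<close>

lemma continuous_AE_eq_half_line:
  fixes f g :: "real \<Rightarrow> complex"
  assumes f: "continuous_on {0..} f" and g: "continuous_on {0..} g"
    and ae: "AE x in half_line_measure. f x = g x" and x: "0 \<le> x"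
  shows "f x = g x"
proof (rule ccontr)
  assume ne: "f x \<noteq> g x"
  have "continuous_on {0..} (\<lambda>y. f y - g y)"
    by (intro continuous_intros f g)
  then have "((\<lambda>y. f y - g y) \<longlongrightarrow> f x - g x) (at x within {0..})"
    using x by (auto simp: continuous_on_def)
  then have "\<forall>\<^sub>F y in at x within {0..}. f y - g y \<noteq> 0"
    by (rule tendsto_imp_eventually_ne) (use ne in simp)
  then obtain d where d: "d > 0" "\<And>y. 0 \<le> y \<Longrightarrow> y \<noteq> x \<Longrightarrow> dist y x < d \<Longrightarrow> f y - g y \<noteq> 0"
    unfolding eventually_at by auto
  have "AE y in lborel. y > 0 \<longrightarrow> f y = g y"
    using ae by (simp add: AE_restrict_space_iff)
  \<comment> \<open>Only the interval to the right of \<open>x\<close> is used, so that the end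
    point \<open>x = 0\<close> is covered as well.\<close>
  then have "AE y in lborel. y \<notin> {x<..<x + d}"
    by eventually_elim (use d x in \<open>auto simp: dist_real_def\<close>)
  then have "emeasure lborel {x<..<x + d} = 0"
    by (subst (asm) AE_iff_measurable[where N="{x<..<x + d}"]) auto
  then show False using d by simp
qed

lemma continuous_on_half_line_measurable:
  fixes f :: "real \<Rightarrow> complex"
  assumes "continuous_on {0..} f"
  shows "f \<in> borel_measurable half_line_measure"
proof -
  have "continuous_on half_line f"
    by (rule continuous_on_subset[OF assms]) auto
  then show ?thesis
    using borel_measurable_continuous_on_indicator[of half_line f]
    by (simp add: borel_measurable_restrict_space_iff)
qed

lemma set_integral_cong_AE_half_line:
  assumes "sq_integrable half_line_measure f" "sq_integrable half_line_measure g"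
    and "AE x in half_line_measure. f x = g x"
  shows "(LINT y:{0<..x}|lborel. f y) = (LINT y:{0<..x}|lborel. g y)"
  unfolding set_lebesgue_integral_def
proof (rule integral_cong_AE)
  have "AE y in lborel. y > 0 \<longrightarrow> f y = g y"
    using assms(3) by (simp add: AE_restrict_space_iff)
  then show "AE y in lborel. indicator {0<..x} y *\<^sub>R f y = indicator {0<..x} y *\<^sub>R g y"
    by eventually_elim (auto simp: indicator_def)
qed (use sq_integrable_imp_set_integrable[OF assms(1), of x] sq_integrable_imp_set_integrable[OF assms(2), of x]
  in \<open>auto simp: set_integrable_def\<close>)

lemma sobolev1_cong_AE:
  assumes "sobolev1 f g" "sq_integrable half_line_measure g'" "AE x in half_line_measure. g x = g' x"
  shows "sobolev1 f g'"
proof (rule sobolev1I)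
  show "f x = f 0 + (LINT y:{0<..x}|lborel. g' y)" if "0 \<le> x" for x
    using sobolev1D[OF assms(1) that]
    unfolding set_integral_cong_AE_half_line[OF sobolev1_sq_integrable(2)[OF assms(1)] assms(2,3)] .
qed (use assms sobolev1_sq_integrable in auto)

text \<open>The fundamental theorem for a continuous density, one-sided at 0. It identifies
  \<open>dx\<close>, a classical derivative, with the continuous representative of the weak
  derivative.\<close>

lemma sobolev1_has_vector_derivative:
  assumes "sobolev1 f p" "continuous_on {0..} p" "0 \<le> x"
  shows "(f has_vector_derivative p x) (at x within {0..})"
proof -
  have e: "f y = f 0 + integral {0..y} p" if "0 \<le> y" for y
  proof -
    have "(LINT z:{0<..y}|lborel. p z) = integral {0..y} p"
      unfolding set_integral_Ioc_eq_Icc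
      by (rule set_borel_integral_eq_integral(2)[OF borel_integrable_atLeastAtMost'[OF continuous_on_subset[OF assms(2)]]]) auto
    then show ?thesis using sobolev1D[OF assms(1) that] by simp
  qed
  have "((\<lambda>y. f 0 + integral {0..y} p) has_vector_derivative 0 + p x) (at x within {0..x + 1})"
    by (intro derivative_intros integral_has_vector_derivative continuous_on_subset[OF assms(2)]) (use assms(3) in auto)
  then have "(f has_vector_derivative p x) (at x within {0..x + 1})"
    by (rule_tac has_vector_derivative_transform[where f="\<lambda>y. f 0 + integral {0..y} p"]) (use assms(3) in \<open>auto intro: e\<close>)
  moreover have "at x within {0..} = at x within {0..x + 1}"
    by (rule at_within_nhd[of x "{..<x + 1}"]) auto
  ultimately show ?thesis by (simp add: has_vector_derivative_def)
qed

text \<open>The representative is the primitive \<open>C + \<integral>g\<close> itself; it inherits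
  square integrability from \<open>f\<close> through almost-everywhere equality. For
  \<open>q_x\<close>, which is given only up to null sets, it provides the trace at
  \<open>x = 0\<close>.\<close>

lemma weak_derivative_representative:
  assumes "weak_derivative f g" "sq_integrable half_line_measure f" "sq_integrable half_line_measure g"
  shows "\<exists>p. sobolev1 p g \<and> (AE x in half_line_measure. f x = p x)"
proof -
  obtain C where C: "AE x in half_line_measure. f x = C + (LINT y:{0<..x}|lborel. g y)"
    using weak_derivative_primitive[OF assms] by blast
  define p where "p = (\<lambda>x. C + (LINT y:{0<..x}|lborel. g y))"
  have pr: "primitive_on X p g" if "0 \<le> X" for X
    unfolding primitive_on_def p_def
    using sq_integrable_imp_set_integrable[OF assms(3)] by (auto simp: set_lebesgue_integral_def)
  have "continuous_on {0..} p"
    by (rule primitive_continuous_half_line[OF pr])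
  then have "sq_integrable half_line_measure p"
    using sq_integrable_cong_AE[OF assms(2) continuous_on_half_line_measurable C[folded p_def]]
    by (simp add: p_def)
  then have "sobolev1 p g"
    using assms(3) pr by (auto simp: sobolev1_def)
  then show ?thesis using C by (auto simp: p_def)
qed

text \<open>A continuous function agrees with its absolutely continuous representative at every
  point, including 0. So the prescribed boundary value of \<open>q\<close> is not altered.\<close>

lemma weak_derivative_continuous_sobolev1:
  assumes "weak_derivative f g" "sq_integrable half_line_measure f" "sq_integrable half_line_measure g"
    and "continuous_on {0..} f"
  shows "sobolev1 f g"
proof -
  obtain p where p: "sobolev1 p g" "AE x in half_line_measure. f x = p x"
    using weak_derivative_representative[OF assms(1-3)] by blast
  have "f x = p x" if "0 \<le> x" for x
    by (rule continuous_AE_eq_half_line[OF assms(4) sobolev1_continuous[OF p(1)] p(2) that])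
  then have "f x = f 0 + (LINT y:{0<..x}|lborel. g y)" if "0 \<le> x" for x
    using sobolev1D[OF p(1) that] that by simp
  with assms(2,3) show ?thesis by (intro sobolev1I)
qed

lemma has_vector_derivative_iff_quotient:
  "(f has_vector_derivative D) (at t within S) \<longleftrightarrow>
    ((\<lambda>s. (f s - f t) /\<^sub>R (s - t)) \<longlongrightarrow> D) (at t within S)"
proof -
  have eq: "norm ((1 / norm (s - t)) *\<^sub>R (f s - (f t + (s - t) *\<^sub>R D))) = norm ((f s - f t) /\<^sub>R (s - t) - D)"
    if "s \<noteq> t" for s
  proof -
    have "(f s - f t) /\<^sub>R (s - t) - D = (1 / (s - t)) *\<^sub>R (f s - (f t + (s - t) *\<^sub>R D))"
      using that unfolding diff_diff_eq[symmetric] by (simp add: scaleR_diff_right divide_inverse)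
    then show ?thesis by simp
  qed
  have "(f has_vector_derivative D) (at t within S) \<longleftrightarrow>
      ((\<lambda>s. (1 / norm (s - t)) *\<^sub>R (f s - (f t + (s - t) *\<^sub>R D))) \<longlongrightarrow> 0) (at t within S)"
    unfolding has_vector_derivative_def has_derivative_within by (simp add: bounded_linear_scaleR_left)
  also have "\<dots> \<longleftrightarrow> ((\<lambda>s. norm ((1 / norm (s - t)) *\<^sub>R (f s - (f t + (s - t) *\<^sub>R D)))) \<longlongrightarrow> 0) (at t within S)"
    by (simp only: tendsto_norm_zero_iff)
  also have "\<dots> \<longleftrightarrow> ((\<lambda>s. norm ((f s - f t) /\<^sub>R (s - t) - D)) \<longlongrightarrow> 0) (at t within S)"
  proof (rule tendsto_cong)
    have "\<forall>\<^sub>F s in at t within S. s \<noteq> t"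
      by (auto simp: eventually_at_filter)
    then show "\<forall>\<^sub>F s in at t within S. norm ((1 / norm (s - t)) *\<^sub>R (f s - (f t + (s - t) *\<^sub>R D)))
        = norm ((f s - f t) /\<^sub>R (s - t) - D)"
      by eventually_elim (rule eq)
  qed
  also have "\<dots> \<longleftrightarrow> ((\<lambda>s. (f s - f t) /\<^sub>R (s - t)) \<longlongrightarrow> D) (at t within S)"
    by (simp only: tendsto_norm_zero_iff LIM_zero_iff)
  finally show ?thesis .
qed

lemma at_within_atLeast_neq_bot: "(a::real) \<le> x \<Longrightarrow> at x within {a..} \<noteq> bot"
  using islimpt_Icc[of x "x + 1" x] islimpt_subset[of x "{x..x + 1}" "{a..}"]
  by (auto simp: trivial_limit_within)

subsection \<open>Balance laws\<close>

text \<open>Time is the first argument; \<open>p\<close>, \<open>r\<close>, \<open>ut\<close> stand for the continuous representative of \<open>q\<^sub>x\<close>,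
  for \<open>q\<^sub>x\<^sub>x\<close> and for \<open>q\<^sub>t\<close>.\<close>
locale nls_flow =
  fixes lam :: real and u p r ut :: "real \<Rightarrow> real \<Rightarrow> complex" and Q Q' :: "real \<Rightarrow> complex"
  assumes u_sobolev: "0 \<le> t \<Longrightarrow> sobolev1 (u t) (p t)"
    and p_sobolev: "0 \<le> t \<Longrightarrow> sobolev1 (p t) (r t)"
    and u_C1: "C1_L2 u ut" and p_C0: "C0_L2 p" and r_C0: "C0_L2 r"
    and equation: "0 < t \<Longrightarrow> AE x in half_line_measure.
          ut t x = \<i> * (r t x - 2 * of_real lam * (u t x * cnj (u t x) * u t x))"
    and initial: "0 \<le> x \<Longrightarrow> u 0 x = 0"
    and boundary: "0 \<le> t \<Longrightarrow> u t 0 = Q t"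
    and Q_deriv: "0 \<le> t \<Longrightarrow> (Q has_vector_derivative Q' t) (at t within {0..})"
    and Q'_continuous: "continuous_on {0..} Q'"
begin

abbreviation H :: "real measure" where "H \<equiv> half_line_measure"

abbreviation L2lim :: "(real \<Rightarrow> real \<Rightarrow> complex) \<Rightarrow> (real \<Rightarrow> complex) \<Rightarrow> real \<Rightarrow> bool" where
  "L2lim fs f t \<equiv> ((\<lambda>s. l2norm H (\<lambda>x. fs s x - f x)) \<longlongrightarrow> 0) (at t within {0..})"

lemma C0_L2_D:
  assumes "C0_L2 w" "0 \<le> t"
  shows "sq_integrable H (w t)" "L2lim w (w t) t"
  using assms by (auto simp: C0_L2_def L2_on_iff_sq_integrable L2_norm_eq_l2norm)

lemma u_C0: "C0_L2 u" and ut_C0: "C0_L2 ut"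
  using u_C1 by (auto simp: C1_L2_def)

lemmas u_sq = C0_L2_D(1)[OF u_C0] and ut_sq = C0_L2_D(1)[OF ut_C0]
  and p_sq = C0_L2_D(1)[OF p_C0] and r_sq = C0_L2_D(1)[OF r_C0]

lemmas u_lim = C0_L2_D(2)[OF u_C0] and p_lim = C0_L2_D(2)[OF p_C0] and r_lim = C0_L2_D(2)[OF r_C0]

lemma eventually_nonneg: "\<forall>\<^sub>F s in at t within {0..}. (0::real) \<le> s"
  by (auto simp: eventually_at_filter)

lemma L2lim_cnj: "L2lim fs f t \<Longrightarrow> L2lim (\<lambda>s x. cnj (fs s x)) (\<lambda>x. cnj (f x)) t"
  using l2norm_cnj[of H "\<lambda>x. fs s x - f x" for s] by (simp del: l2norm_cnj)

text \<open>The difference quotient of \<open>u\<close> converges to \<open>ut\<close> strongly in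
  L2, so it may be paired with a factor that also moves with \<open>s\<close>. This freedom is
  needed because increments of quadratic expressions contain factors at time
  \<open>s\<close>.\<close>

lemma difference_pairing:
  assumes t: "0 \<le> t" and gs: "\<And>s. 0 \<le> s \<Longrightarrow> sq_integrable H (gs s)" and g: "sq_integrable H g"
    and lim: "L2lim gs g t"
  shows "((\<lambda>s. (\<integral>x. (u s x - u t x) * gs s x \<partial>H) /\<^sub>R (s - t)) \<longlongrightarrow> (\<integral>x. ut t x * g x \<partial>H)) (at t within {0..})"
proof -
  have "((\<lambda>s. \<integral>x. ((u s x - u t x) /\<^sub>R (s - t)) * gs s x \<partial>H) \<longlongrightarrow> (\<integral>x. ut t x * g x \<partial>H)) (at t within {0..})"
  proof (rule l2_tendsto_integral_mult)
    show "\<forall>\<^sub>F s in at t within {0..}. sq_integrable H (\<lambda>x. (u s x - u t x) /\<^sub>R (s - t))"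
      using eventually_nonneg
      by eventually_elim (intro sq_integrable_scaleR sq_integrable_diff u_sq t)
    show "\<forall>\<^sub>F s in at t within {0..}. sq_integrable H (gs s)"
      using eventually_nonneg by eventually_elim (rule gs)
    show "L2lim (\<lambda>s x. (u s x - u t x) /\<^sub>R (s - t)) (ut t) t"
      using u_C1 t by (auto simp: C1_L2_def L2_norm_eq_l2norm)
  qed (use t g lim ut_sq in auto)
  then show ?thesis by simp
qed

text \<open>The Sobolev inequality makes \<open>u\<close> continuous in time uniformly in space.\<close>
lemma L2lim_mult_u:
  assumes t: "0 \<le> t" and gs: "\<And>s. 0 \<le> s \<Longrightarrow> sq_integrable H (gs s)" and g: "sq_integrable H g"
    and lim: "L2lim gs g t"
  shows "L2lim (\<lambda>s x. u s x * gs s x) (\<lambda>x. u t x * g x) t"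
proof -
  \<comment> \<open>\<open>K s\<close> bounds \<open>u s - u t\<close> uniformly in space and tends
    to 0 because both norms under the root do; \<open>B\<close> bounds \<open>u t\<close>.\<close>
  define K where "K = (\<lambda>s. sqrt (2 * l2norm H (\<lambda>x. u s x - u t x) * l2norm H (\<lambda>x. p s x - p t x)))"
  define B where "B = sqrt (2 * l2norm H (u t) * l2norm H (p t))"
  have K: "cmod (u s x - u t x) \<le> K s" if "0 \<le> s" "x \<in> space H" for s x
    unfolding K_def using sobolev1_sup_bound[OF sobolev1_diff[OF u_sobolev u_sobolev], of s t x] that t
    by (intro real_le_rsqrt) (auto simp: space_restrict_space)
  have B: "cmod (u t x) \<le> B" if "x \<in> space H" for x
    unfolding B_def using sobolev1_sup_bound[OF u_sobolev, of t x] that t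
    by (intro real_le_rsqrt) (auto simp: space_restrict_space)
  have m: "u s \<in> borel_measurable H" if "0 \<le> s" for s
    using u_sq[OF that] by (simp add: sq_integrable_def)
  have KB: "0 \<le> K s" "0 \<le> B" for s by (auto simp: K_def B_def)
  have "(K \<longlongrightarrow> sqrt (2 * 0 * 0)) (at t within {0..})"
    unfolding K_def by (intro tendsto_intros u_lim p_lim t)
  then have "((\<lambda>s. K s * l2norm H (gs s) + B * l2norm H (\<lambda>x. gs s x - g x))
      \<longlongrightarrow> sqrt (2 * 0 * 0) * l2norm H g + B * 0) (at t within {0..})"
    by (intro tendsto_intros l2_tendsto_norm g lim eventually_mono[OF eventually_nonneg gs])
  then have "((\<lambda>s. K s * l2norm H (gs s) + B * l2norm H (\<lambda>x. gs s x - g x)) \<longlongrightarrow> 0) (at t within {0..})"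
    by simp
  then show ?thesis
  proof (rule Lim_null_comparison[rotated])
    show "\<forall>\<^sub>F s in at t within {0..}. norm (l2norm H (\<lambda>x. u s x * gs s x - u t x * g x))
        \<le> K s * l2norm H (gs s) + B * l2norm H (\<lambda>x. gs s x - g x)"
      using eventually_nonneg
    proof eventually_elim
      case (elim s)
      have md: "(\<lambda>x. u s x - u t x) \<in> borel_measurable H"
        using m[OF elim] m[OF t] by simp
      have "l2norm H (\<lambda>x. u s x * gs s x - u t x * g x)
          = l2norm H (\<lambda>x. (u s x - u t x) * gs s x + u t x * (gs s x - g x))"
        by (simp add: algebra_simps)
      also have "\<dots> \<le> l2norm H (\<lambda>x. (u s x - u t x) * gs s x) + l2norm H (\<lambda>x. u t x * (gs s x - g x))"
        by (rule l2norm_triangle)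
          (rule sq_integrable_bounded_mult[OF gs[OF elim] md K[OF elim]]
            sq_integrable_bounded_mult[OF sq_integrable_diff[OF gs[OF elim] g] m[OF t] B]; assumption)+
      also have "\<dots> \<le> K s * l2norm H (gs s) + B * l2norm H (\<lambda>x. gs s x - g x)"
        by (intro add_mono l2norm_bounded_mult gs elim md K KB sq_integrable_diff g m t B)
      finally show ?case by simp
    qed
  qed
qed

lemma L2lim_mult_cnj_u:
  assumes t: "0 \<le> t" and gs: "\<And>s. 0 \<le> s \<Longrightarrow> sq_integrable H (gs s)" and g: "sq_integrable H g"
    and lim: "L2lim gs g t"
  shows "L2lim (\<lambda>s x. cnj (u s x) * gs s x) (\<lambda>x. cnj (u t x) * g x) t"
  using L2lim_cnj[OF L2lim_mult_u[OF t sq_integrable_cnj[OF gs] sq_integrable_cnj[OF g] L2lim_cnj[OF lim]]]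
  by simp

text \<open>The sup bound at \<open>x = 0\<close> for \<open>p s - p t\<close> controls the trace by
  the L2 distances of \<open>p\<close> and \<open>r\<close> at the two times.\<close>

lemma boundary_derivative_continuous: "continuous_on {0..} (\<lambda>t. p t 0)"
  unfolding continuous_on_def
proof
  fix t :: real assume "t \<in> {0..}"
  then have t: "0 \<le> t" by simp
  have "((\<lambda>s. sqrt (2 * l2norm H (\<lambda>x. p s x - p t x) * l2norm H (\<lambda>x. r s x - r t x))) \<longlongrightarrow> sqrt (2 * 0 * 0)) (at t within {0..})"
    by (intro tendsto_intros p_lim r_lim t)
  then have "((\<lambda>s. sqrt (2 * l2norm H (\<lambda>x. p s x - p t x) * l2norm H (\<lambda>x. r s x - r t x))) \<longlongrightarrow> 0) (at t within {0..})"
    by simp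
  then have "((\<lambda>s. p s 0 - p t 0) \<longlongrightarrow> 0) (at t within {0..})"
  proof (rule Lim_null_comparison[rotated])
    show "\<forall>\<^sub>F s in at t within {0..}. norm (p s 0 - p t 0)
        \<le> sqrt (2 * l2norm H (\<lambda>x. p s x - p t x) * l2norm H (\<lambda>x. r s x - r t x))"
      using eventually_nonneg
    proof eventually_elim
      case (elim s)
      show ?case
        using sobolev1_sup_bound[OF sobolev1_diff[OF p_sobolev[OF elim] p_sobolev[OF t]], of 0]
        by (intro real_le_rsqrt) auto
    qed
  qed
  then show "((\<lambda>t. p t 0) \<longlongrightarrow> p t 0) (at t within {0..})"
    by (rule LIM_zero_cancel)
qed

section \<open>Time derivatives of the conserved densities as pairings with
  \<open>ut\<close>\<close>

definition mass :: "real \<Rightarrow> complex" where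
  "mass t = (\<integral>x. u t x * cnj (u t x) \<partial>H)"

text \<open>The momentum proper is the imaginary part; the real part is the boundary quantity
  \<open>-|Q t|^2 / 2\<close>. All four quantities are kept complex so that their increments split
  into a pairing and a conjugate pairing.\<close>

definition momentum :: "real \<Rightarrow> complex" where
  "momentum t = (\<integral>x. u t x * cnj (p t x) \<partial>H)"

definition kinetic :: "real \<Rightarrow> complex" where
  "kinetic t = (\<integral>x. p t x * cnj (p t x) \<partial>H)"

definition quartic :: "real \<Rightarrow> complex" where
  "quartic t = (\<integral>x. (u t x * cnj (u t x)) * (u t x * cnj (u t x)) \<partial>H)"

text \<open>The increment of \<open>|u|^2\<close> is \<open>(u s - u t) * cnj (u s)\<close> plus the
  conjugate of \<open>(u s - u t) * cnj (u t)\<close>, so both terms carry the difference of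
  \<open>u\<close> in time.\<close>

lemma mass_derivative_pairing:
  assumes t: "0 \<le> t"
  shows "(mass has_vector_derivative (\<integral>x. ut t x * cnj (u t x) \<partial>H) + cnj (\<integral>x. ut t x * cnj (u t x) \<partial>H))
    (at t within {0..})"
  unfolding has_vector_derivative_iff_quotient
proof (rule Lim_transform_eventually)
  show "((\<lambda>s. (\<integral>x. (u s x - u t x) * cnj (u s x) \<partial>H) /\<^sub>R (s - t)
        + cnj ((\<integral>x. (u s x - u t x) * cnj (u t x) \<partial>H) /\<^sub>R (s - t)))
      \<longlongrightarrow> (\<integral>x. ut t x * cnj (u t x) \<partial>H) + cnj (\<integral>x. ut t x * cnj (u t x) \<partial>H)) (at t within {0..})"
    by (intro tendsto_intros difference_pairing t sq_integrable_cnj u_sq L2lim_cnj u_lim) simp_all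
  show "\<forall>\<^sub>F s in at t within {0..}. (\<integral>x. (u s x - u t x) * cnj (u s x) \<partial>H) /\<^sub>R (s - t)
        + cnj ((\<integral>x. (u s x - u t x) * cnj (u t x) \<partial>H) /\<^sub>R (s - t)) = (mass s - mass t) /\<^sub>R (s - t)"
    using eventually_nonneg
  proof eventually_elim
    case (elim s)
    note i = sq_integrable_mult[OF _ sq_integrable_cnj]
    have "mass s - mass t = (\<integral>x. u s x * cnj (u s x) - u t x * cnj (u t x) \<partial>H)"
      unfolding mass_def by (rule Bochner_Integration.integral_diff[symmetric]; intro i u_sq elim t)
    also have "\<dots> = (\<integral>x. (u s x - u t x) * cnj (u s x) + cnj ((u s x - u t x) * cnj (u t x)) \<partial>H)"
      by (rule Bochner_Integration.integral_cong) (auto simp: algebra_simps)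
    also have "\<dots> = (\<integral>x. (u s x - u t x) * cnj (u s x) \<partial>H) + (\<integral>x. cnj ((u s x - u t x) * cnj (u t x)) \<partial>H)"
      by (rule Bochner_Integration.integral_add; (intro integrable_cnj)?; intro i sq_integrable_diff u_sq elim t)
    also have "\<dots> = (\<integral>x. (u s x - u t x) * cnj (u s x) \<partial>H) + cnj (\<integral>x. (u s x - u t x) * cnj (u t x) \<partial>H)"
      by (simp only: Bochner_Integration.integral_cnj)
    finally show ?case by (simp add: scaleR_add_right)
  qed
qed

lemma momentum_derivative_pairing:
  assumes t: "0 \<le> t"
  shows "(momentum has_vector_derivative (\<integral>x. ut t x * cnj (p t x) \<partial>H) - cnj (\<integral>x. ut t x * cnj (p t x) \<partial>H)
    - Q t * cnj (Q' t)) (at t within {0..})"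
  unfolding has_vector_derivative_iff_quotient
proof (rule Lim_transform_eventually)
  have "((\<lambda>s. (Q s - Q t) /\<^sub>R (s - t)) \<longlongrightarrow> Q' t) (at t within {0..})"
    using Q_deriv[OF t] by (simp add: has_vector_derivative_iff_quotient)
  then show "((\<lambda>s. (\<integral>x. (u s x - u t x) * cnj (p s x) \<partial>H) /\<^sub>R (s - t)
        - cnj ((\<integral>x. (u s x - u t x) * cnj (p t x) \<partial>H) /\<^sub>R (s - t)) - Q t * cnj ((Q s - Q t) /\<^sub>R (s - t)))
      \<longlongrightarrow> (\<integral>x. ut t x * cnj (p t x) \<partial>H) - cnj (\<integral>x. ut t x * cnj (p t x) \<partial>H) - Q t * cnj (Q' t)) (at t within {0..})"
    by (intro tendsto_intros difference_pairing t sq_integrable_cnj p_sq L2lim_cnj p_lim) simp_all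
  show "\<forall>\<^sub>F s in at t within {0..}. (\<integral>x. (u s x - u t x) * cnj (p s x) \<partial>H) /\<^sub>R (s - t)
        - cnj ((\<integral>x. (u s x - u t x) * cnj (p t x) \<partial>H) /\<^sub>R (s - t)) - Q t * cnj ((Q s - Q t) /\<^sub>R (s - t))
      = (momentum s - momentum t) /\<^sub>R (s - t)"
    using eventually_nonneg
  proof eventually_elim
    case (elim s)
    note i = sq_integrable_mult[OF _ sq_integrable_cnj]
    \<comment> \<open>The increment of the momentum contains \<open>p s - p t\<close>, which has no
      difference quotient in L2. Integration by parts in \<open>x\<close> trades it for
      \<open>u s - u t\<close>; the trace at 0 produces the term with \<open>Q'\<close>.\<close>
    have ibp: "(\<integral>x. p t x * cnj (u s x - u t x) \<partial>H) + (\<integral>x. u t x * cnj (p s x - p t x) \<partial>H)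
        = - (Q t * cnj (Q s - Q t))"
      using sobolev1_integration_by_parts[OF u_sobolev[OF t]
          sobolev1_cnj[OF sobolev1_diff[OF u_sobolev[OF elim] u_sobolev[OF t]]]]
      by (simp add: boundary t elim)
    have c: "(\<integral>x. p t x * cnj (u s x - u t x) \<partial>H) = cnj (\<integral>x. (u s x - u t x) * cnj (p t x) \<partial>H)"
      unfolding Bochner_Integration.integral_cnj[symmetric]
      by (rule Bochner_Integration.integral_cong) (auto simp: algebra_simps)
    have "momentum s - momentum t = (\<integral>x. u s x * cnj (p s x) - u t x * cnj (p t x) \<partial>H)"
      unfolding momentum_def by (rule Bochner_Integration.integral_diff[symmetric]; intro i u_sq p_sq elim t)
    also have "\<dots> = (\<integral>x. (u s x - u t x) * cnj (p s x) + u t x * cnj (p s x - p t x) \<partial>H)"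
      by (rule Bochner_Integration.integral_cong) (auto simp: algebra_simps)
    also have "\<dots> = (\<integral>x. (u s x - u t x) * cnj (p s x) \<partial>H) + (\<integral>x. u t x * cnj (p s x - p t x) \<partial>H)"
      by (rule Bochner_Integration.integral_add; intro i sq_integrable_diff u_sq p_sq elim t)
    also have "\<dots> = (\<integral>x. (u s x - u t x) * cnj (p s x) \<partial>H) - cnj (\<integral>x. (u s x - u t x) * cnj (p t x) \<partial>H)
        - Q t * cnj (Q s - Q t)"
      using ibp unfolding c by (simp add: algebra_simps)
    finally show ?case by (simp add: scaleR_diff_right right_diff_distrib)
  qed
qed

lemma kinetic_derivative_pairing:
  assumes t: "0 \<le> t"
  defines "D \<equiv> (\<integral>x. ut t x * cnj (r t x) \<partial>H) + Q' t * cnj (p t 0)"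
  shows "(kinetic has_vector_derivative - D - cnj D) (at t within {0..})"
  unfolding has_vector_derivative_iff_quotient
proof (rule Lim_transform_eventually)
  \<comment> \<open>The increment of \<open>|p|^2\<close> pairs \<open>p s - p t\<close> with
    \<open>p\<close> at both times; after integration by parts these become pairings of
    \<open>u s - u t\<close> with \<open>r w\<close> for \<open>w = s\<close> and
    \<open>w = t\<close>.\<close>
  define E where "E = (\<lambda>w s. \<integral>x. (u s x - u t x) * cnj (r w x) \<partial>H)"
  have q: "((\<lambda>s. (Q s - Q t) /\<^sub>R (s - t)) \<longlongrightarrow> Q' t) (at t within {0..})"
    using Q_deriv[OF t] by (simp add: has_vector_derivative_iff_quotient)
  have g: "((\<lambda>s. p s 0) \<longlongrightarrow> p t 0) (at t within {0..})"
    using boundary_derivative_continuous t by (auto simp: continuous_on_def)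
  have E1: "((\<lambda>s. E s s /\<^sub>R (s - t)) \<longlongrightarrow> (\<integral>x. ut t x * cnj (r t x) \<partial>H)) (at t within {0..})"
    unfolding E_def by (intro difference_pairing t sq_integrable_cnj r_sq L2lim_cnj r_lim)
  have E2: "((\<lambda>s. E t s /\<^sub>R (s - t)) \<longlongrightarrow> (\<integral>x. ut t x * cnj (r t x) \<partial>H)) (at t within {0..})"
    unfolding E_def by (intro difference_pairing t sq_integrable_cnj r_sq) simp
  show "((\<lambda>s. - (E s s /\<^sub>R (s - t) + (Q s - Q t) /\<^sub>R (s - t) * cnj (p s 0))
        - cnj (E t s /\<^sub>R (s - t) + (Q s - Q t) /\<^sub>R (s - t) * cnj (p t 0))) \<longlongrightarrow> - D - cnj D) (at t within {0..})"
    unfolding D_def by (intro tendsto_intros q g E1 E2)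
  show "\<forall>\<^sub>F s in at t within {0..}. - (E s s /\<^sub>R (s - t) + (Q s - Q t) /\<^sub>R (s - t) * cnj (p s 0))
        - cnj (E t s /\<^sub>R (s - t) + (Q s - Q t) /\<^sub>R (s - t) * cnj (p t 0)) = (kinetic s - kinetic t) /\<^sub>R (s - t)"
    using eventually_nonneg
  proof eventually_elim
    case (elim s)
    note i = sq_integrable_mult[OF _ sq_integrable_cnj]
    have ibp: "(\<integral>x. (p s x - p t x) * cnj (p w x) \<partial>H) = - (E w s + (Q s - Q t) * cnj (p w 0))" if "0 \<le> w" for w
      using sobolev1_integration_by_parts[OF sobolev1_diff[OF u_sobolev[OF elim] u_sobolev[OF t]]
          sobolev1_cnj[OF p_sobolev[OF that]]]
      by (simp add: boundary t elim E_def eq_neg_iff_add_eq_0 algebra_simps)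
    have "kinetic s - kinetic t = (\<integral>x. p s x * cnj (p s x) - p t x * cnj (p t x) \<partial>H)"
      unfolding kinetic_def by (rule Bochner_Integration.integral_diff[symmetric]; intro i p_sq elim t)
    also have "\<dots> = (\<integral>x. (p s x - p t x) * cnj (p s x) + cnj ((p s x - p t x) * cnj (p t x)) \<partial>H)"
      by (rule Bochner_Integration.integral_cong) (auto simp: algebra_simps)
    also have "\<dots> = (\<integral>x. (p s x - p t x) * cnj (p s x) \<partial>H) + (\<integral>x. cnj ((p s x - p t x) * cnj (p t x)) \<partial>H)"
      by (rule Bochner_Integration.integral_add; (intro integrable_cnj)?; intro i sq_integrable_diff p_sq elim t)
    also have "\<dots> = (\<integral>x. (p s x - p t x) * cnj (p s x) \<partial>H) + cnj (\<integral>x. (p s x - p t x) * cnj (p t x) \<partial>H)"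
      by (simp only: Bochner_Integration.integral_cnj)
    also have "\<dots> = - (E s s + (Q s - Q t) * cnj (p s 0)) - cnj (E t s + (Q s - Q t) * cnj (p t 0))"
      unfolding ibp[OF elim] ibp[OF t] by simp
    finally have e: "kinetic s - kinetic t = - (E s s + (Q s - Q t) * cnj (p s 0)) - cnj (E t s + (Q s - Q t) * cnj (p t 0))" .
    show ?case unfolding e by (simp add: scaleR_conv_of_real algebra_simps)
  qed
qed


lemma density_sobolev1:
  assumes "0 \<le> t"
  shows "sobolev1 (\<lambda>x. u t x * cnj (u t x)) (\<lambda>x. p t x * cnj (u t x) + u t x * cnj (p t x))"
  by (rule sobolev1_mult[OF u_sobolev sobolev1_cnj[OF u_sobolev]]) fact+

lemma sq_integrable_products:
  assumes "0 \<le> s" "0 \<le> t"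
  shows "sq_integrable H (\<lambda>x. u s x * u t x)" "sq_integrable H (\<lambda>x. u s x * cnj (u t x))"
    "0 \<le> w \<Longrightarrow> sq_integrable H (\<lambda>x. cnj (u w x) * (u s x * cnj (u t x)))"
    "0 \<le> w \<Longrightarrow> sq_integrable H (\<lambda>x. u w x * (u s x * cnj (u t x)))"
  by (rule sobolev1_sq_integrable(1), (rule sobolev1_mult sobolev1_cnj u_sobolev assms; assumption?)+)+

lemma quartic_derivative_pairing:
  assumes t: "0 \<le> t"
  defines "Y \<equiv> \<integral>x. ut t x * (cnj (u t x) * (u t x * cnj (u t x))) \<partial>H"
  shows "(quartic has_vector_derivative 2 * Y + cnj (2 * Y)) (at t within {0..})"
  unfolding has_vector_derivative_iff_quotient
proof (rule Lim_transform_eventually)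
  \<comment> \<open>With \<open>m = |u|^2\<close> the increment of \<open>m^2\<close> is
    \<open>(m s - m t) * (m s + m t)\<close>, and the first factor splits as for the mass. So
    \<open>a s\<close> is \<open>cnj (u s) * (m s + m t)\<close>, \<open>b s\<close> is
    \<open>cnj (u t) * (m s + m t)\<close>, and \<open>c\<close> is their common limit.\<close>
  define a where "a = (\<lambda>s x. cnj (u s x) * (u s x * cnj (u s x)) + cnj (u s x) * (u t x * cnj (u t x)))"
  define b where "b = (\<lambda>s x. cnj (u t x) * (u s x * cnj (u s x)) + cnj (u t x) * (u t x * cnj (u t x)))"
  define c where "c = (\<lambda>x. cnj (u t x) * (u t x * cnj (u t x)) + cnj (u t x) * (u t x * cnj (u t x)))"
  have m_lim: "L2lim (\<lambda>s x. u s x * cnj (u s x)) (\<lambda>x. u t x * cnj (u t x)) t"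
    by (intro L2lim_mult_u t sq_integrable_cnj u_sq L2lim_cnj u_lim)
  have sqa: "sq_integrable H (a s)" "sq_integrable H (b s)" if "0 \<le> s" for s
    unfolding a_def b_def using that t by (intro sq_integrable_add sq_integrable_products; simp)+
  have sqc: "sq_integrable H c"
    unfolding c_def using t by (intro sq_integrable_add sq_integrable_products; simp)
  have a_lim: "L2lim a c t"
    unfolding a_def c_def
  proof (rule l2_tendsto_add)
    show "L2lim (\<lambda>s x. cnj (u s x) * (u s x * cnj (u s x))) (\<lambda>x. cnj (u t x) * (u t x * cnj (u t x))) t"
      by (intro L2lim_mult_cnj_u t m_lim sq_integrable_products)
    show "L2lim (\<lambda>s x. cnj (u s x) * (u t x * cnj (u t x))) (\<lambda>x. cnj (u t x) * (u t x * cnj (u t x))) t"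
      by (rule L2lim_mult_cnj_u[OF t sq_integrable_products(2)[OF t t] sq_integrable_products(2)[OF t t]]) simp
  qed (use t in \<open>auto intro!: sq_integrable_products eventually_mono[OF eventually_nonneg]\<close>)
  have b_lim: "L2lim b c t"
    unfolding b_def c_def
  proof (rule l2_tendsto_add)
    \<comment> \<open>The factors are reordered so that those moving with \<open>s\<close> stand
      outside and the multiplication lemmas apply one factor at a time.\<close>
    have "L2lim (\<lambda>s x. u s x * (cnj (u s x) * cnj (u t x))) (\<lambda>x. u t x * (cnj (u t x) * cnj (u t x))) t"
    proof (rule L2lim_mult_u[OF t])
      show "L2lim (\<lambda>s x. cnj (u s x) * cnj (u t x)) (\<lambda>x. cnj (u t x) * cnj (u t x)) t"
        by (rule L2lim_mult_cnj_u[OF t]) (use t in \<open>auto intro: sq_integrable_cnj u_sq\<close>)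
      show "sq_integrable H (\<lambda>x. cnj (u s x) * cnj (u t x))" if "0 \<le> s" for s
        using sq_integrable_cnj[OF sq_integrable_products(1)[OF that t]] by simp
      show "sq_integrable H (\<lambda>x. cnj (u t x) * cnj (u t x))"
        using sq_integrable_cnj[OF sq_integrable_products(1)[OF t t]] by simp
    qed
    then show "L2lim (\<lambda>s x. cnj (u t x) * (u s x * cnj (u s x))) (\<lambda>x. cnj (u t x) * (u t x * cnj (u t x))) t"
      by (simp add: mult_ac)
  qed (use t in \<open>auto intro!: sq_integrable_products eventually_mono[OF eventually_nonneg]\<close>)
  have Yc: "(\<integral>x. ut t x * c x \<partial>H) = 2 * Y"
  proof -
    have "(\<integral>x. ut t x * c x \<partial>H) = (\<integral>x. 2 * (ut t x * (cnj (u t x) * (u t x * cnj (u t x)))) \<partial>H)"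
      by (rule Bochner_Integration.integral_cong) (auto simp: c_def algebra_simps)
    then show ?thesis by (simp only: Y_def integral_mult_right_zero)
  qed
  show "((\<lambda>s. (\<integral>x. (u s x - u t x) * a s x \<partial>H) /\<^sub>R (s - t)
        + cnj ((\<integral>x. (u s x - u t x) * b s x \<partial>H) /\<^sub>R (s - t))) \<longlongrightarrow> 2 * Y + cnj (2 * Y)) (at t within {0..})"
    unfolding Yc[symmetric]
    by (intro tendsto_intros difference_pairing t sqa sqc a_lim b_lim)
  show "\<forall>\<^sub>F s in at t within {0..}. (\<integral>x. (u s x - u t x) * a s x \<partial>H) /\<^sub>R (s - t)
        + cnj ((\<integral>x. (u s x - u t x) * b s x \<partial>H) /\<^sub>R (s - t)) = (quartic s - quartic t) /\<^sub>R (s - t)"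
    using eventually_nonneg
  proof eventually_elim
    case (elim s)
    note i = sq_integrable_mult
    have "quartic s - quartic t = (\<integral>x. (u s x * cnj (u s x)) * (u s x * cnj (u s x))
        - (u t x * cnj (u t x)) * (u t x * cnj (u t x)) \<partial>H)"
      unfolding quartic_def by (rule Bochner_Integration.integral_diff[symmetric]; intro i sq_integrable_products elim t)
    also have "\<dots> = (\<integral>x. (u s x - u t x) * a s x + cnj ((u s x - u t x) * b s x) \<partial>H)"
      by (rule Bochner_Integration.integral_cong) (auto simp: a_def b_def algebra_simps)
    also have "\<dots> = (\<integral>x. (u s x - u t x) * a s x \<partial>H) + (\<integral>x. cnj ((u s x - u t x) * b s x) \<partial>H)"
      by (rule Bochner_Integration.integral_add; (intro integrable_cnj)?; intro i sq_integrable_diff u_sq sqa elim t)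
    also have "\<dots> = (\<integral>x. (u s x - u t x) * a s x \<partial>H) + cnj (\<integral>x. (u s x - u t x) * b s x \<partial>H)"
      by (simp only: Bochner_Integration.integral_cnj)
    finally show ?case by (simp add: scaleR_add_right)
  qed
qed

text \<open>The one place where the equation is integrated against a general \<open>g\<close>, at
  positive times because it is imposed only there. The choices \<open>cnj (u t)\<close> and
  \<open>cnj (p t)\<close> give the mass and the momentum law.\<close>

lemma pairing_equation:
  assumes t: "0 < t" and g: "sq_integrable H g"
  shows "(\<integral>x. ut t x * g x \<partial>H)
    = \<i> * ((\<integral>x. r t x * g x \<partial>H) - 2 * of_real lam * (\<integral>x. (u t x * (u t x * cnj (u t x))) * g x \<partial>H))"
proof -
  have t': "0 \<le> t" using t by simp
  note n = sq_integrable_products(4)[OF t' t' t']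
  have "(\<integral>x. ut t x * g x \<partial>H)
      = (\<integral>x. \<i> * (r t x * g x - 2 * of_real lam * ((u t x * (u t x * cnj (u t x))) * g x)) \<partial>H)"
  proof (rule integral_cong_AE)
    show "AE x in H. ut t x * g x = \<i> * (r t x * g x - 2 * of_real lam * ((u t x * (u t x * cnj (u t x))) * g x))"
      using equation[OF t] by eventually_elim (simp (no_asm_simp) add: algebra_simps)
    show "(\<lambda>x. ut t x * g x) \<in> borel_measurable H"
      using sq_integrable_mult[OF ut_sq[OF t'] g] by auto
    show "(\<lambda>x. \<i> * (r t x * g x - 2 * of_real lam * ((u t x * (u t x * cnj (u t x))) * g x))) \<in> borel_measurable H"
      using sq_integrable_mult[OF r_sq[OF t'] g] sq_integrable_mult[OF n g]
      by (auto intro!: borel_measurable_times borel_measurable_diff)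
  qed
  also have "\<dots> = \<i> * ((\<integral>x. r t x * g x \<partial>H) - (\<integral>x. 2 * of_real lam * ((u t x * (u t x * cnj (u t x))) * g x) \<partial>H))"
    unfolding integral_mult_right_zero
    by (subst Bochner_Integration.integral_diff)
      (auto intro!: sq_integrable_mult[OF r_sq[OF t'] g] sq_integrable_mult[OF n g])
  finally show ?thesis by (simp only: integral_mult_right_zero)
qed

section \<open>The balance laws in differential form\<close>

definition quartic_real :: "real \<Rightarrow> real" where
  "quartic_real t = (\<integral>x. (cmod (u t x))^4 \<partial>H)"

lemma mass_eq: "mass t = of_real ((l2norm H (u t))\<^sup>2)"
  unfolding mass_def l2norm_power2 integral_complex_of_real[symmetric] complex_norm_square ..

lemma kinetic_eq: "kinetic t = of_real ((l2norm H (p t))\<^sup>2)"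
  unfolding kinetic_def l2norm_power2 integral_complex_of_real[symmetric] complex_norm_square ..

lemma quartic_eq: "quartic t = of_real (quartic_real t)"
proof -
  have "(u t x * cnj (u t x)) * (u t x * cnj (u t x)) = of_real ((cmod (u t x))^4)" for x
    unfolding complex_norm_square[symmetric] of_real_mult[symmetric] by (simp add: power4_eq_xxxx power2_eq_square)
  then show ?thesis
    unfolding quartic_def quartic_real_def by (simp only: integral_complex_of_real)
qed

lemma quartic_real_nonneg: "0 \<le> quartic_real t"
  by (simp add: quartic_real_def)

lemma momentum_bound: "0 \<le> t \<Longrightarrow> cmod (momentum t) \<le> l2norm H (u t) * l2norm H (p t)"
  using l2_integral_bound[OF u_sq sq_integrable_cnj[OF p_sq], of t t] by (simp add: momentum_def)

text \<open>One factor \<open>|u|^2\<close> is bounded by its supremum, at most \<open>2 n d\<close>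
  in terms of the norms of \<open>u\<close> and \<open>p\<close>; the other integrates to
  \<open>n^2\<close>.\<close>

lemma quartic_real_bound:
  assumes t: "0 \<le> t"
  shows "quartic_real t \<le> 2 * (l2norm H (u t))^3 * l2norm H (p t)"
proof -
  define S where "S = 2 * l2norm H (u t) * l2norm H (p t)"
  have "quartic_real t \<le> (\<integral>x. S * (cmod (u t x))\<^sup>2 \<partial>H)"
    unfolding quartic_real_def
  proof (rule integral_mono)
    have "integrable H (\<lambda>x. (u t x * cnj (u t x)) * (u t x * cnj (u t x)))"
      using t by (intro sq_integrable_mult sq_integrable_products)
    then have "integrable H (\<lambda>x. cmod ((u t x * cnj (u t x)) * (u t x * cnj (u t x))))"
      by (rule integrable_norm)
    then show "integrable H (\<lambda>x. (cmod (u t x))^4)"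
      by (simp add: norm_mult power4_eq_xxxx mult.assoc)
    show "integrable H (\<lambda>x. S * (cmod (u t x))\<^sup>2)"
      using u_sq[OF t] by (simp add: sq_integrable_def)
    fix x assume "x \<in> space H"
    then have "(cmod (u t x))\<^sup>2 \<le> S"
      unfolding S_def by (intro sobolev1_sup_bound u_sobolev t) (auto simp: space_restrict_space)
    then have "(cmod (u t x))\<^sup>2 * (cmod (u t x))\<^sup>2 \<le> S * (cmod (u t x))\<^sup>2"
      by (rule mult_right_mono) simp
    then show "(cmod (u t x))^4 \<le> S * (cmod (u t x))\<^sup>2"
      by (simp flip: power_add)
  qed
  also have "\<dots> = S * (l2norm H (u t))\<^sup>2"
    by (simp add: l2norm_power2)
  finally show ?thesis by (simp add: S_def power2_eq_square power3_eq_cube mult_ac)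
qed

text \<open>After integration by parts the kinetic and quartic terms are real multiples of
  \<open>\<i>\<close> and drop out of the real part; only the boundary term is left.\<close>

lemma mass_derivative:
  assumes t: "0 < t"
  shows "((\<lambda>t. (l2norm H (u t))\<^sup>2) has_vector_derivative 2 * Im (p t 0 * cnj (Q t))) (at t within {0..})"
proof -
  have t': "0 \<le> t" using t by simp
  define Z where "Z = (\<integral>x. ut t x * cnj (u t x) \<partial>H)"
  have "(\<integral>x. (u t x * (u t x * cnj (u t x))) * cnj (u t x) \<partial>H) = of_real (quartic_real t)"
    unfolding quartic_eq[symmetric] quartic_def by (simp add: mult_ac)
  moreover have "(\<integral>x. r t x * cnj (u t x) \<partial>H) + of_real ((l2norm H (p t))\<^sup>2) = - (p t 0 * cnj (Q t))"
    unfolding kinetic_eq[symmetric] kinetic_def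
    using sobolev1_integration_by_parts[OF p_sobolev[OF t'] sobolev1_cnj[OF u_sobolev[OF t']]]
    by (simp add: boundary t')
  then have "(\<integral>x. r t x * cnj (u t x) \<partial>H) = - (p t 0 * cnj (Q t)) - of_real ((l2norm H (p t))\<^sup>2)"
    by (simp only: eq_diff_eq)
  ultimately have "Z = \<i> * (- (p t 0 * cnj (Q t)) - of_real ((l2norm H (p t))\<^sup>2)
      - 2 * of_real lam * of_real (quartic_real t))"
    unfolding Z_def pairing_equation[OF t sq_integrable_cnj[OF u_sq[OF t']]] by (simp only:)
  then have "Re Z = Im (p t 0 * cnj (Q t))"
    by simp
  then have "Re (Z + cnj Z) = 2 * Im (p t 0 * cnj (Q t))"
    by simp
  then show ?thesis
    using bounded_linear.has_vector_derivative[OF bounded_linear_Re mass_derivative_pairing[OF t']]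
    by (simp add: mass_eq Z_def)
qed

text \<open>The real part of \<open>r * cnj p\<close> is half the derivative of
  \<open>|p|^2\<close>, and that of the nonlinear term, paired with \<open>cnj p\<close>, is a
  quarter of the derivative of \<open>|u|^4\<close>. Hence only traces at 0 remain, among them
  \<open>|p t 0|^2\<close>, whose sign does not depend on \<open>lam\<close>.\<close>

lemma momentum_derivative:
  assumes t: "0 < t"
  shows "((\<lambda>t. Im (momentum t)) has_vector_derivative
    - (cmod (p t 0))\<^sup>2 + lam * (cmod (Q t))^4 - Im (Q t * cnj (Q' t))) (at t within {0..})"
proof -
  have t': "0 \<le> t" using t by simp
  define W where "W = (\<integral>x. ut t x * cnj (p t x) \<partial>H)"
  define N where "N = (\<integral>x. (u t x * (u t x * cnj (u t x))) * cnj (p t x) \<partial>H)"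
  define R where "R = (\<integral>x. r t x * cnj (p t x) \<partial>H)"
  have "(\<integral>x. p t x * cnj (r t x) \<partial>H) = cnj R"
    unfolding R_def Bochner_Integration.integral_cnj[symmetric]
    by (rule Bochner_Integration.integral_cong) (auto simp: mult_ac)
  then have "R + cnj R = - (p t 0 * cnj (p t 0))"
    using sobolev1_integration_by_parts[OF p_sobolev[OF t'] sobolev1_cnj[OF p_sobolev[OF t']]]
    by (simp add: R_def)
  then have "R + cnj R = - of_real ((cmod (p t 0))\<^sup>2)"
    unfolding complex_norm_square .
  then have R: "2 * Re R = - (cmod (p t 0))\<^sup>2"
    by (simp add: complex_eq_iff)
  define m where "m = (\<lambda>x. u t x * cnj (u t x))"
  define m' where "m' = (\<lambda>x. p t x * cnj (u t x) + u t x * cnj (p t x))"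
  have m: "sobolev1 m m'"
    unfolding m_def m'_def by (rule density_sobolev1[OF t'])
  have i: "integrable H (\<lambda>x. (u t x * (u t x * cnj (u t x))) * cnj (p t x))"
    by (intro sq_integrable_mult sq_integrable_products sq_integrable_cnj p_sq t')
  have "(\<integral>x. m' x * m x \<partial>H) = (\<integral>x. (u t x * (u t x * cnj (u t x))) * cnj (p t x)
      + cnj ((u t x * (u t x * cnj (u t x))) * cnj (p t x)) \<partial>H)"
    by (rule Bochner_Integration.integral_cong) (auto simp: m_def m'_def algebra_simps)
  also have "\<dots> = N + (\<integral>x. cnj ((u t x * (u t x * cnj (u t x))) * cnj (p t x)) \<partial>H)"
    unfolding N_def by (rule Bochner_Integration.integral_add[OF i integrable_cnj[OF i]])
  also have "\<dots> = N + cnj N"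
    unfolding N_def by (simp only: Bochner_Integration.integral_cnj)
  finally have "2 * (N + cnj N) = - (m 0 * m 0)"
    using sobolev1_integration_by_parts[OF m m] by (simp add: mult.commute)
  also have "m 0 * m 0 = of_real ((cmod (Q t))^4)"
    unfolding m_def boundary[OF t'] complex_norm_square[symmetric] of_real_mult[symmetric]
    by (simp add: power4_eq_xxxx power2_eq_square)
  finally have N: "4 * Re N = - ((cmod (Q t))^4)"
    by (simp add: complex_eq_iff)
  have "W = \<i> * (R - 2 * of_real lam * N)"
    unfolding W_def R_def N_def by (rule pairing_equation[OF t sq_integrable_cnj[OF p_sq[OF t']]])
  then have "Im W = Re R - 2 * lam * Re N"
    by simp
  then have "2 * Im W = - (cmod (p t 0))\<^sup>2 + lam * (cmod (Q t))^4"
    using R arg_cong[OF N, of "\<lambda>z. lam * z"] by (simp add: algebra_simps)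
  then have "Im (W - cnj W - Q t * cnj (Q' t)) = - (cmod (p t 0))\<^sup>2 + lam * (cmod (Q t))^4 - Im (Q t * cnj (Q' t))"
    by simp
  then show ?thesis
    using bounded_linear.has_vector_derivative[OF bounded_linear_Im momentum_derivative_pairing[OF t']]
    by (simp add: W_def)
qed

text \<open>By the equation \<open>g = \<i> * cnj ut\<close>, so the pairing of \<open>ut\<close>
  with \<open>g\<close> is purely imaginary. Its real part gives
  \<open>Re V = 2 * lam * Re Y\<close>, which is exactly the cancellation between the kinetic and
  the quartic derivative.\<close>

lemma energy_derivative:
  assumes t: "0 < t"
  shows "((\<lambda>t. (l2norm H (p t))\<^sup>2 + lam * quartic_real t) has_vector_derivative
    - 2 * Re (Q' t * cnj (p t 0))) (at t within {0..})"
proof -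
  have t': "0 \<le> t" using t by simp
  define V where "V = (\<integral>x. ut t x * cnj (r t x) \<partial>H)"
  define Y where "Y = (\<integral>x. ut t x * (cnj (u t x) * (u t x * cnj (u t x))) \<partial>H)"
  define g where "g = (\<lambda>x. cnj (r t x) - 2 * of_real lam * (cnj (u t x) * (u t x * cnj (u t x))))"
  have n: "sq_integrable H (\<lambda>x. cnj (u t x) * (u t x * cnj (u t x)))"
    by (rule sq_integrable_products(3)[OF t' t' t'])
  have g: "sq_integrable H g"
    unfolding g_def by (intro sq_integrable_diff sq_integrable_cnj r_sq sq_integrable_cmult n t')
  have "(\<integral>x. ut t x * g x \<partial>H) = (\<integral>x. ut t x * cnj (r t x) - 2 * of_real lam * (ut t x * (cnj (u t x) * (u t x * cnj (u t x)))) \<partial>H)"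
    by (rule Bochner_Integration.integral_cong) (auto simp: g_def algebra_simps)
  also have "\<dots> = V - (\<integral>x. 2 * of_real lam * (ut t x * (cnj (u t x) * (u t x * cnj (u t x)))) \<partial>H)"
    unfolding V_def
    by (rule Bochner_Integration.integral_diff, rule sq_integrable_mult[OF ut_sq[OF t'] sq_integrable_cnj[OF r_sq[OF t']]],
        rule integrable_mult_right, rule sq_integrable_mult[OF ut_sq[OF t'] n])
  finally have VY: "(\<integral>x. ut t x * g x \<partial>H) = V - 2 * of_real lam * Y"
    unfolding Y_def by (simp only: integral_mult_right_zero)
  have "(\<integral>x. ut t x * g x \<partial>H) = (\<integral>x. \<i> * of_real ((cmod (ut t x))\<^sup>2) \<partial>H)"
  proof (rule integral_cong_AE)
    show "AE x in H. ut t x * g x = \<i> * of_real ((cmod (ut t x))\<^sup>2)"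
      using equation[OF t]
    proof eventually_elim
      case (elim x)
      have "cnj (ut t x) = - \<i> * g x"
        unfolding elim g_def by (simp add: algebra_simps)
      then have "g x = \<i> * cnj (ut t x)"
        by simp
      then show ?case unfolding complex_norm_square by (simp add: mult_ac)
    qed
    show "(\<lambda>x. ut t x * g x) \<in> borel_measurable H"
      using sq_integrable_mult[OF ut_sq[OF t'] g] by auto
    show "(\<lambda>x. \<i> * of_real ((cmod (ut t x))\<^sup>2)) \<in> borel_measurable H"
      using ut_sq[OF t'] by (auto simp: sq_integrable_def)
  qed
  also have "\<dots> = \<i> * of_real (\<integral>x. (cmod (ut t x))\<^sup>2 \<partial>H)"
    unfolding integral_mult_right_zero integral_complex_of_real ..
  finally have "Re (V - 2 * of_real lam * Y) = 0"
    unfolding VY by simp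
  then have re: "Re V = 2 * lam * Re Y" by simp
  have k: "((\<lambda>t. (l2norm H (p t))\<^sup>2) has_vector_derivative - 2 * Re (V + Q' t * cnj (p t 0))) (at t within {0..})"
    using bounded_linear.has_vector_derivative[OF bounded_linear_Re kinetic_derivative_pairing[OF t']]
    by (simp add: kinetic_eq V_def)
  have q: "(quartic_real has_vector_derivative 4 * Re Y) (at t within {0..})"
    using bounded_linear.has_vector_derivative[OF bounded_linear_Re quartic_derivative_pairing[OF t']]
    by (simp add: quartic_eq Y_def)
  have "((\<lambda>t. (l2norm H (p t))\<^sup>2 + lam * quartic_real t) has_vector_derivative
      - 2 * Re (V + Q' t * cnj (p t 0)) + lam * (4 * Re Y)) (at t within {0..})"
    by (intro has_vector_derivative_add k has_vector_derivative_mult_right q)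
  then show ?thesis using re by (simp add: algebra_simps)
qed

section \<open>Initial values and the balance laws integrated in time\<close>

lemma initial_derivative:
  assumes "0 \<le> x"
  shows "p 0 x = 0"
proof -
  have "(u 0 has_vector_derivative p 0 x) (at x within {0..})"
    by (rule sobolev1_has_vector_derivative[OF u_sobolev sobolev1_continuous[OF p_sobolev] assms]) auto
  moreover have "(u 0 has_vector_derivative 0) (at x within {0..})"
    by (rule has_vector_derivative_transform[where f="\<lambda>_. 0"]) (use assms initial in auto)
  ultimately show ?thesis
    by (rule vector_derivative_unique_within[OF at_within_atLeast_neq_bot[OF assms]])
qed

lemma initial_values: "l2norm H (u 0) = 0" "l2norm H (p 0) = 0" "quartic_real 0 = 0" "momentum 0 = 0"
proof -
  have "\<And>x. x \<in> space H \<Longrightarrow> u 0 x = 0" "\<And>x. x \<in> space H \<Longrightarrow> p 0 x = 0"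
    using initial initial_derivative by (auto simp: space_restrict_space)
  then show "l2norm H (u 0) = 0" "l2norm H (p 0) = 0" "quartic_real 0 = 0" "momentum 0 = 0"
    unfolding l2norm_def quartic_real_def momentum_def real_sqrt_eq_zero_cancel_iff
    by (intro integral_eq_zero_AE AE_I2; simp)+
qed

text \<open>The equation is imposed for positive times only, so the derivative is known inside the
  interval; continuity of \<open>F\<close> takes care of the end point 0.\<close>

lemma has_integral_of_derivative:
  fixes F f :: "real \<Rightarrow> real"
  assumes T: "0 \<le> T" and F0: "F 0 = 0" and c: "continuous_on {0..} F"
    and d: "\<And>t. 0 < t \<Longrightarrow> (F has_vector_derivative f t) (at t within {0..})"
  shows "(f has_integral F T) {0..T}"
proof -
  have "(f has_integral F T - F 0) {0..T}"
  proof (rule fundamental_theorem_of_calculus_interior[OF T])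
    show "continuous_on {0..T} F" by (rule continuous_on_subset[OF c]) auto
    show "(F has_vector_derivative f t) (at t)" if "t \<in> {0<..<T}" for t
      using d[of t] that at_within_interior[of t "{0..}"] by (simp add: interior_real_atLeast)
  qed
  then show ?thesis using F0 by simp
qed

text \<open>The derivatives as pairings do not involve the equation and hold at time 0 too, which
  supplies continuity there.\<close>

lemma continuous_quantities:
  "continuous_on {0..} mass" "continuous_on {0..} momentum"
  "continuous_on {0..} kinetic" "continuous_on {0..} quartic"
  unfolding continuous_on_eq_continuous_within
  using mass_derivative_pairing momentum_derivative_pairing kinetic_derivative_pairing quartic_derivative_pairing
  by (meson atLeast_iff has_vector_derivative_continuous)+

lemma mass_identity:
  assumes "0 \<le> T"
  shows "((\<lambda>t. 2 * Im (p t 0 * cnj (Q t))) has_integral (l2norm H (u T))\<^sup>2) {0..T}"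
proof (rule has_integral_of_derivative[OF assms _ _ mass_derivative])
  have "continuous_on {0..} (\<lambda>t. Re (mass t))"
    by (intro continuous_intros continuous_quantities)
  then show "continuous_on {0..} (\<lambda>t. (l2norm H (u t))\<^sup>2)"
    by (simp add: mass_eq)
qed (simp add: initial_values)

lemma energy_identity:
  assumes "0 \<le> T"
  shows "((\<lambda>t. - 2 * Re (Q' t * cnj (p t 0))) has_integral ((l2norm H (p T))\<^sup>2 + lam * quartic_real T)) {0..T}"
proof (rule has_integral_of_derivative[OF assms _ _ energy_derivative])
  have "continuous_on {0..} (\<lambda>t. Re (kinetic t))" "continuous_on {0..} (\<lambda>t. Re (quartic t))"
    by (intro continuous_intros continuous_quantities)+
  then show "continuous_on {0..} (\<lambda>t. (l2norm H (p t))\<^sup>2 + lam * quartic_real t)"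
    unfolding kinetic_eq quartic_eq by (auto intro!: continuous_intros)
qed (simp add: initial_values)

lemma momentum_identity:
  assumes "0 \<le> T"
  shows "((\<lambda>t. - (cmod (p t 0))\<^sup>2 + lam * (cmod (Q t))^4 - Im (Q t * cnj (Q' t))) has_integral Im (momentum T)) {0..T}"
proof (rule has_integral_of_derivative[OF assms _ _ momentum_derivative])
  show "continuous_on {0..} (\<lambda>t. Im (momentum t))"
    by (intro continuous_intros continuous_quantities)
qed (simp add: initial_values)

end

subsection \<open>A priori bounds\<close>

text \<open>The open interval is the one in the smallness hypothesis on the boundary data.\<close>

abbreviation time_measure :: "real \<Rightarrow> real measure" where
  "time_measure T \<equiv> restrict_space lborel {0<..<T}"

lemma sq_integrable_cong:
  "(\<And>x. x \<in> space M \<Longrightarrow> f x = g x) \<Longrightarrow> sq_integrable M f \<longleftrightarrow> sq_integrable M g"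
  unfolding sq_integrable_def by (simp cong: measurable_cong Bochner_Integration.integrable_cong)

lemma l2norm_cong:
  "(\<And>x. x \<in> space M \<Longrightarrow> f x = g x) \<Longrightarrow> l2norm M f = l2norm M g"
  unfolding l2norm_def by (simp cong: Bochner_Integration.integral_cong)

lemma continuous_set_integrable:
  fixes f :: "real \<Rightarrow> 'b::{banach, second_countable_topology}"
  assumes "continuous_on {0..} f"
  shows "set_integrable lborel {0..T} f"
  by (rule borel_integrable_atLeastAtMost'[OF continuous_on_subset[OF assms]]) auto

lemma continuous_integrable_time:
  fixes f :: "real \<Rightarrow> 'b::{banach, second_countable_topology}"
  assumes "continuous_on {0..} f"
  shows "integrable (time_measure T) f"
proof -
  have "set_integrable lborel {0<..<T} f"
    by (rule set_integrable_subset[OF continuous_set_integrable[OF assms, of T]]) auto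
  then show ?thesis by (simp add: set_integrable_def integrable_restrict_space)
qed

lemma continuous_sq_integrable_time:
  assumes "continuous_on {0..} f"
  shows "sq_integrable (time_measure T) f"
proof -
  have "continuous_on {0..} (\<lambda>x. (cmod (f x))\<^sup>2)"
    by (intro continuous_intros assms)
  then show ?thesis
    unfolding sq_integrable_def
    using continuous_integrable_time[OF assms, of T] continuous_integrable_time by auto
qed

lemma has_integral_time_integral:
  fixes f :: "real \<Rightarrow> real"
  assumes c: "continuous_on {0..} f" and i: "(f has_integral I) {0..T}"
  shows "I = (\<integral>t. f t \<partial>time_measure T)"
proof -
  have "(\<integral>t. f t \<partial>time_measure T) = (LINT t:{0<..<T}|lborel. f t)"
    by (simp add: integral_restrict_space set_lebesgue_integral_def)
  also have "\<dots> = (LINT t:{0..T}|lborel. f t)"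
    by (rule set_integral_discrete_difference[where X="{0, T}"]) auto
  also have "\<dots> = integral {0..T} f"
    by (rule set_borel_integral_eq_integral(2)[OF continuous_set_integrable[OF c]])
  finally show ?thesis using i by (simp add: integral_unique)
qed

lemma time_integral_le_l2norm:
  assumes c: "continuous_on {0..} f" "continuous_on {0..} a" "continuous_on {0..} b"
    and i: "(f has_integral I) {0..T}" and le: "\<And>t. f t \<le> 2 * (cmod (a t) * cmod (b t))"
  shows "I \<le> 2 * l2norm (time_measure T) a * l2norm (time_measure T) b"
proof -
  have "I \<le> (\<integral>t. 2 * (cmod (a t) * cmod (b t)) \<partial>time_measure T)"
    unfolding has_integral_time_integral[OF c(1) i]
    by (rule integral_mono) (use c le in \<open>auto intro!: continuous_integrable_time continuous_intros\<close>)
  also have "\<dots> \<le> 2 * (l2norm (time_measure T) a * l2norm (time_measure T) b)"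
    using l2_Cauchy_Schwarz[OF continuous_sq_integrable_time[OF c(2)] continuous_sq_integrable_time[OF c(3)], of T]
    by simp
  finally show ?thesis by simp
qed

text \<open>If \<open>d\<close> exceeded \<open>sqrt X + Y\<close>, multiplying by \<open>d\<close>
  would give \<open>d^2 > sqrt X * d + Y * d\<close>, which is at least
  \<open>X + Y * d\<close>.\<close>

lemma quadratic_le_imp_le:
  fixes d X Y :: real
  assumes "d\<^sup>2 \<le> X + Y * d" "0 \<le> d" "0 \<le> X" "0 \<le> Y"
  shows "d \<le> sqrt X + Y"
proof (rule ccontr)
  assume "\<not> d \<le> sqrt X + Y"
  then have d: "sqrt X + Y < d" by simp
  have "sqrt X * sqrt X \<le> sqrt X * d"
    using d assms by (intro mult_left_mono) auto
  moreover have "(sqrt X + Y) * d < d * d"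
    using d assms by (intro mult_strict_right_mono) (auto intro: le_less_trans[OF _ d])
  ultimately have "X + Y * d < d * d"
    using assms by (simp add: distrib_right)
  then show False using assms(1) by (simp add: power2_eq_square)
qed

text \<open>Here \<open>n\<close>, \<open>d\<close> are the norms of \<open>q\<close>, \<open>q\<^sub>x\<close> at a fixed time, and \<open>P\<close>, \<open>A\<close>, \<open>B\<close> those of
  \<open>q\<^sub>x\<close>, \<open>q\<close>, \<open>q\<^sub>t\<close> at the boundary; \<open>L\<close> is the negative part of the coupling constant. The product
  \<open>n d\<close> is at most linear in \<open>P\<close> up to \<open>8 L A\<^sup>2 P\<^sup>2\<close>, which smallness of \<open>A\<close> absorbs.\<close>
lemma boundary_flux_bound:
  fixes n d P A B K L :: real
  assumes nn: "0 \<le> n" "0 \<le> d" "0 \<le> P" "0 \<le> A" "0 \<le> B" "0 \<le> K" "0 \<le> L"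
    and n: "n\<^sup>2 \<le> 2 * P * A" and d: "d\<^sup>2 \<le> 2 * P * B + 2 * L * n^3 * d"
    and P: "P\<^sup>2 \<le> n * d + K" and small: "16 * L * A\<^sup>2 \<le> 1"
  shows "P \<le> sqrt (2 * K) + 2 * (A + B)"
proof -
  define X where "X = 2 * P * B"
  have X: "0 \<le> X" using nn by (simp add: X_def)
  have "d \<le> sqrt X + 2 * L * n^3"
    by (rule quadratic_le_imp_le) (use d nn X in \<open>auto simp: X_def\<close>)
  then have "n * d \<le> n * (sqrt X + 2 * L * n^3)"
    using nn by (intro mult_left_mono) auto
  also have "\<dots> = n * sqrt X + 2 * L * (n\<^sup>2)\<^sup>2"
    by (simp add: algebra_simps power2_eq_square power3_eq_cube)
  also have "\<dots> \<le> P * (A + B) + P\<^sup>2 / 2"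
  proof (rule add_mono)
    \<comment> \<open>Both \<open>n^2\<close> and \<open>X\<close> are linear in \<open>P\<close>,
      with sum at most \<open>2 P (A + B)\<close>, so this inequality keeps the mixed term linear in
      \<open>P\<close>.\<close>
    have "2 * (n * sqrt X) \<le> n\<^sup>2 + X"
      using sum_squares_bound[of n "sqrt X"] X by simp
    then show "n * sqrt X \<le> P * (A + B)"
      using n by (simp add: X_def algebra_simps)
    have "(n\<^sup>2)\<^sup>2 \<le> (2 * P * A)\<^sup>2"
      using n by (intro power_mono) auto
    then have "2 * L * (n\<^sup>2)\<^sup>2 \<le> 2 * L * (2 * P * A)\<^sup>2"
      using nn by (intro mult_left_mono) auto
    \<comment> \<open>The origin of the number 16: half of \<open>P^2\<close> can be absorbed on the
      left, and the term is \<open>8 L A^2 P^2\<close>.\<close>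
    also have "\<dots> = (16 * L * A\<^sup>2) * (P\<^sup>2 / 2)"
      by (simp add: power2_eq_square)
    also have "\<dots> \<le> 1 * (P\<^sup>2 / 2)"
      using small by (intro mult_right_mono) auto
    finally show "2 * L * (n\<^sup>2)\<^sup>2 \<le> P\<^sup>2 / 2" by simp
  qed
  \<comment> \<open>Moving \<open>P^2 / 2\<close> to the left and doubling produces the factors
    2.\<close>
  finally have "P\<^sup>2 \<le> 2 * K + 2 * (A + B) * P"
    using P by (simp add: algebra_simps)
  then show ?thesis
    by (rule quadratic_le_imp_le) (use nn in auto)
qed

context nls_flow
begin

abbreviation g :: "real \<Rightarrow> complex" where "g t \<equiv> p t 0"

lemma Q_continuous: "continuous_on {0..} Q"
  unfolding continuous_on_eq_continuous_within
  using Q_deriv by (meson atLeast_iff has_vector_derivative_continuous)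

lemmas time_continuous = Q_continuous Q'_continuous boundary_derivative_continuous

lemma mass_bound:
  assumes "0 \<le> T"
  shows "(l2norm H (u T))\<^sup>2 \<le> 2 * l2norm (time_measure T) g * l2norm (time_measure T) Q"
proof (rule time_integral_le_l2norm[OF _ _ _ mass_identity[OF assms]])
  show "2 * Im (g t * cnj (Q t)) \<le> 2 * (cmod (g t) * cmod (Q t))" for t
    using abs_Im_le_cmod[of "g t * cnj (Q t)"] by (simp add: norm_mult)
qed (intro continuous_intros time_continuous)+

lemma energy_bound:
  assumes "0 \<le> T"
  shows "(l2norm H (p T))\<^sup>2 + lam * quartic_real T \<le> 2 * l2norm (time_measure T) g * l2norm (time_measure T) Q'"
proof (rule time_integral_le_l2norm[OF _ _ _ energy_identity[OF assms]])
  show "- 2 * Re (Q' t * cnj (g t)) \<le> 2 * (cmod (g t) * cmod (Q' t))" for t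
    using abs_Re_le_cmod[of "Q' t * cnj (g t)"] by (simp add: norm_mult mult.commute)
qed (intro continuous_intros time_continuous)+

text \<open>The momentum identity solved for the integral of \<open>|g|^2\<close>. Since the data
  are controlled in L2, the term \<open>|Q|^4\<close> is estimated by
  \<open>M^2 * |Q|^2\<close>.\<close>

lemma flux_bound:
  assumes T: "0 \<le> T" and M: "\<And>t. 0 \<le> t \<Longrightarrow> cmod (Q t) \<le> M"
  shows "(l2norm (time_measure T) g)\<^sup>2 \<le> l2norm H (u T) * l2norm H (p T)
    + (\<bar>lam\<bar> * M\<^sup>2 * (l2norm (time_measure T) Q)\<^sup>2 + l2norm (time_measure T) Q * l2norm (time_measure T) Q')"
proof -
  let ?N = "time_measure T"
  define h where "h = (\<lambda>t. - (cmod (g t))\<^sup>2 + lam * (cmod (Q t))^4 - Im (Q t * cnj (Q' t)))"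
  have hc: "continuous_on {0..} h"
    unfolding h_def by (intro continuous_intros time_continuous)
  have i: "integrable ?N (\<lambda>t. (cmod (g t))\<^sup>2)" "integrable ?N h" "integrable ?N (\<lambda>t. (cmod (Q t))\<^sup>2)"
    "integrable ?N (\<lambda>t. cmod (Q t) * cmod (Q' t))"
    by (intro continuous_integrable_time hc continuous_intros time_continuous)+
  have hI: "Im (momentum T) = (\<integral>t. h t \<partial>?N)"
    by (rule has_integral_time_integral[OF hc]) (use momentum_identity[OF T] in \<open>simp add: h_def\<close>)
  have "(l2norm ?N g)\<^sup>2 \<le> (\<integral>t. - h t + (\<bar>lam\<bar> * M\<^sup>2 * (cmod (Q t))\<^sup>2 + cmod (Q t) * cmod (Q' t)) \<partial>?N)"
    unfolding l2norm_power2
  proof (rule integral_mono)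
    fix t assume "t \<in> space ?N"
    then have t: "0 \<le> t" by (auto simp: space_restrict_space)
    have "(cmod (Q t))\<^sup>2 \<le> M\<^sup>2"
      using M[OF t] by (intro power_mono) auto
    then have "\<bar>lam\<bar> * ((cmod (Q t))\<^sup>2 * (cmod (Q t))\<^sup>2) \<le> \<bar>lam\<bar> * (M\<^sup>2 * (cmod (Q t))\<^sup>2)"
      by (intro mult_left_mono mult_right_mono) auto
    moreover have "lam * ((cmod (Q t))\<^sup>2 * (cmod (Q t))\<^sup>2) \<le> \<bar>lam\<bar> * ((cmod (Q t))\<^sup>2 * (cmod (Q t))\<^sup>2)"
      by (intro mult_right_mono) auto
    moreover have "- Im (Q t * cnj (Q' t)) \<le> cmod (Q t) * cmod (Q' t)"
      using abs_Im_le_cmod[of "Q t * cnj (Q' t)"] by (simp add: norm_mult)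
    ultimately show "(cmod (g t))\<^sup>2 \<le> - h t + (\<bar>lam\<bar> * M\<^sup>2 * (cmod (Q t))\<^sup>2 + cmod (Q t) * cmod (Q' t))"
      unfolding h_def by (simp flip: power_add add: mult.assoc)
  qed (use i in auto)
  also have "\<dots> = - Im (momentum T) + (\<bar>lam\<bar> * M\<^sup>2 * (l2norm ?N Q)\<^sup>2 + (\<integral>t. cmod (Q t) * cmod (Q' t) \<partial>?N))"
    unfolding l2norm_power2 hI using i by simp
  also have "\<dots> \<le> l2norm H (u T) * l2norm H (p T)
      + (\<bar>lam\<bar> * M\<^sup>2 * (l2norm ?N Q)\<^sup>2 + l2norm ?N Q * l2norm ?N Q')"
  proof (intro add_mono order_refl)
    show "- Im (momentum T) \<le> l2norm H (u T) * l2norm H (p T)"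
      using abs_Im_le_cmod[of "momentum T"] momentum_bound[OF T] by linarith
    show "(\<integral>t. cmod (Q t) * cmod (Q' t) \<partial>?N) \<le> l2norm ?N Q * l2norm ?N Q'"
      by (intro l2_Cauchy_Schwarz continuous_sq_integrable_time time_continuous)
  qed
  finally show ?thesis .
qed

lemma uniform_bounds:
  assumes A: "\<And>T. 0 \<le> T \<Longrightarrow> l2norm (time_measure T) Q \<le> A"
    and B: "\<And>T. 0 \<le> T \<Longrightarrow> l2norm (time_measure T) Q' \<le> B"
    and M: "\<And>t. 0 \<le> t \<Longrightarrow> cmod (Q t) \<le> M"
    and small: "lam < 0 \<Longrightarrow> 16 * \<bar>lam\<bar> * A\<^sup>2 \<le> 1"
  shows "\<exists>C. \<forall>T\<ge>0. l2norm (time_measure T) g \<le> C \<and> l2norm H (u T) \<le> C \<and> l2norm H (p T) \<le> C"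
proof -
  have AB: "0 \<le> A" "0 \<le> B" using A[of 0] B[of 0] l2norm_nonneg order_trans by blast+
  \<comment> \<open>For nonnegative \<open>lam\<close> the quartic part of the energy has a
    favourable sign and is dropped; with \<open>L = 0\<close> the smallness condition is then
    trivially true.\<close>
  define L where "L = (if lam < 0 then \<bar>lam\<bar> else 0)"
  define K where "K = \<bar>lam\<bar> * M\<^sup>2 * A\<^sup>2 + A * B"
  define P0 where "P0 = sqrt (2 * K) + 2 * (A + B)"
  \<comment> \<open>Once \<open>P\<close> is at most \<open>P0\<close>, the mass law bounds the norm
    of \<open>u\<close> by \<open>n0\<close>; the energy law, quadratic in the norm of
    \<open>p\<close>, then gives \<open>d0\<close>.\<close>
  define n0 where "n0 = sqrt (2 * P0 * A)"
  define d0 where "d0 = sqrt (2 * P0 * B) + 2 * L * n0^3"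
  have K: "0 \<le> K" using AB by (simp add: K_def)
  have P0: "0 \<le> P0" using AB K by (simp add: P0_def)
  have L: "0 \<le> L" by (simp add: L_def)
  have "l2norm (time_measure T) g \<le> P0 \<and> l2norm H (u T) \<le> n0 \<and> l2norm H (p T) \<le> d0" if T: "0 \<le> T" for T
  proof -
    let ?P = "l2norm (time_measure T) g" and ?n = "l2norm H (u T)" and ?d = "l2norm H (p T)"
    have n: "?n\<^sup>2 \<le> 2 * ?P * A"
      using mass_bound[OF T] mult_left_mono[OF A[OF T], of "2 * ?P"] by simp
    have q: "- lam * quartic_real T \<le> L * (2 * ?n^3 * ?d)"
    proof (cases "lam < 0")
      case True
      then show ?thesis
        using mult_left_mono[OF quartic_real_bound[OF T], of "- lam"] by (simp add: L_def)
    next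
      case False
      then show ?thesis using quartic_real_nonneg[of T] by (simp add: L_def)
    qed
    have d: "?d\<^sup>2 \<le> 2 * ?P * B + 2 * L * ?n^3 * ?d"
      using energy_bound[OF T] mult_left_mono[OF B[OF T], of "2 * ?P"] q by (simp add: algebra_simps)
    have "\<bar>lam\<bar> * M\<^sup>2 * (l2norm (time_measure T) Q)\<^sup>2 + l2norm (time_measure T) Q * l2norm (time_measure T) Q' \<le> K"
      unfolding K_def using A[OF T] B[OF T] AB
      by (intro add_mono mult_left_mono mult_mono power_mono) auto
    then have P: "?P\<^sup>2 \<le> ?n * ?d + K"
      using flux_bound[OF T M] by linarith
    have "16 * L * A\<^sup>2 \<le> 1" using small by (simp add: L_def)
    then have P': "?P \<le> P0"
      unfolding P0_def by (intro boundary_flux_bound[OF _ _ _ _ _ _ _ n d P]) (use AB K L in auto)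
    then have "?n\<^sup>2 \<le> 2 * P0 * A"
      using n AB mult_right_mono[OF P', of "2 * A"] by (simp add: mult_ac)
    then have n': "?n \<le> n0"
      unfolding n0_def by (rule real_le_rsqrt)
    have "?d\<^sup>2 \<le> 2 * P0 * B + (2 * L * n0^3) * ?d"
    proof -
      have "2 * ?P * B \<le> 2 * P0 * B"
        using P' AB by (intro mult_right_mono) auto
      moreover have "2 * L * ?n^3 * ?d \<le> 2 * L * n0^3 * ?d"
        using n' L by (intro mult_right_mono mult_left_mono power_mono) auto
      ultimately show ?thesis using d by linarith
    qed
    then have "?d \<le> d0"
      unfolding d0_def by (rule quadratic_le_imp_le) (use P0 AB L in \<open>auto simp: n0_def\<close>)
    with P' n' show ?thesis by blast
  qed
  then have "\<forall>T\<ge>0. l2norm (time_measure T) g \<le> max P0 (max n0 d0) \<and> l2norm H (u T) \<le> max P0 (max n0 d0)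
      \<and> l2norm H (p T) \<le> max P0 (max n0 d0)"
    by (meson le_max_iff_disj)
  then show ?thesis by blast
qed

end

section \<open>Integrability in time\<close>

lemma powr_set_integrable_atLeast:
  fixes e R :: real
  assumes "e < -1" "0 < R"
  shows "set_integrable lborel {R..} (\<lambda>x. x powr e)"
proof -
  have e: "e + 1 \<noteq> 0" using assms by simp
  have "((\<lambda>x::real. x powr (e + 1) / (e + 1)) \<longlongrightarrow> 0 / (e + 1)) at_top"
    using assms e by (intro tendsto_intros tendsto_neg_powr filterlim_ident) auto
  moreover have "((\<lambda>x. x powr (e + 1) / (e + 1)) has_real_derivative x powr e) (at x)" if "R \<le> x" for x
    using DERIV_cdivide[OF has_real_derivative_powr, of x "e + 1" "e + 1"] that assms e by simp
  ultimately have "(\<integral>\<^sup>+x. ennreal (x powr e) * indicator {R..} x \<partial>lborel) = 0 / (e + 1) - R powr (e + 1) / (e + 1)"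
    by (intro nn_integral_FTC_atLeast) auto
  moreover have "(\<integral>\<^sup>+x. ennreal (norm (indicator {R..} x *\<^sub>R x powr e)) \<partial>lborel)
      = (\<integral>\<^sup>+x. ennreal (x powr e) * indicator {R..} x \<partial>lborel)"
    by (rule nn_integral_cong) (auto simp: indicator_def)
  ultimately show ?thesis
    unfolding set_integrable_def by (intro integrableI_bounded) auto
qed

text \<open>Continuity controls \<open>f\<close> on \<open>{0..R}\<close>; beyond \<open>R\<close>
  the square is dominated by a multiple of \<open>t powr (- 2 * a)\<close>, integrable since
  \<open>2 * a > 1\<close>.\<close>

lemma decay_sq_integrable:
  fixes f :: "real \<Rightarrow> complex"
  assumes c: "continuous_on {0..} f" and a: "a > 1/2"
    and O: "f \<in> O[at_top](\<lambda>t. of_real (t powr (- a)))"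
  shows "\<exists>K. \<forall>T\<ge>0. l2norm (time_measure T) f \<le> K" and "\<exists>M. \<forall>t\<ge>0. cmod (f t) \<le> M"
proof -
  from O obtain C where C: "C > 0" "\<forall>\<^sub>F t in at_top. norm (f t) \<le> C * norm (complex_of_real (t powr (- a)))"
    by (auto elim: landau_o.bigE)
  then obtain t0 where t0: "\<And>t. t \<ge> t0 \<Longrightarrow> cmod (f t) \<le> C * t powr (- a)"
    by (auto simp: eventually_at_top_linorder)
  \<comment> \<open>\<open>R \<ge> 1\<close> makes the powers at most 1 beyond \<open>R\<close> and
    keeps them away from their singularity at 0.\<close>
  define R where "R = max t0 1"
  have R: "R \<ge> 1" "\<And>t. t \<ge> R \<Longrightarrow> cmod (f t) \<le> C * t powr (- a)"
    using t0 by (auto simp: R_def)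
  have "compact (f ` {0..R})"
    by (intro compact_continuous_image continuous_on_subset[OF c]) auto
  then obtain M0 where M0: "\<And>t. t \<in> {0..R} \<Longrightarrow> cmod (f t) \<le> M0"
    by (force dest!: compact_imp_bounded simp: bounded_iff)
  have "cmod (f t) \<le> max M0 C" if t: "0 \<le> t" for t
  proof (cases "t \<le> R")
    case True
    then show ?thesis using M0[of t] t by simp
  next
    case False
    then have "t powr (- a) \<le> 1"
      using R(1) a powr_mono[of "- a" 0 t] by simp
    then have "C * t powr (- a) \<le> C" using C(1) by simp
    then show ?thesis using R(2)[of t] False by simp
  qed
  then show "\<exists>M. \<forall>t\<ge>0. cmod (f t) \<le> M" by blast
  have ia: "set_integrable lborel {R..} (\<lambda>t. (cmod (f t))\<^sup>2)"
  proof (rule set_integrable_bound)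
    show "set_integrable lborel {R..} (\<lambda>t. C\<^sup>2 * t powr (- 2 * a))"
      by (intro set_integrable_mult_right powr_set_integrable_atLeast) (use a R(1) in auto)
    have "continuous_on {R..} (\<lambda>t. (cmod (f t))\<^sup>2)"
      by (intro continuous_intros continuous_on_subset[OF c]) (use R(1) in auto)
    then show "set_borel_measurable lborel {R..} (\<lambda>t. (cmod (f t))\<^sup>2)"
      using set_measurable_continuous_on[of "{R..}" "\<lambda>t. (cmod (f t))\<^sup>2"] by (simp add: set_borel_measurable_def)
    show "AE t in lborel. t \<in> {R..} \<longrightarrow> norm ((cmod (f t))\<^sup>2) \<le> norm (C\<^sup>2 * t powr (- 2 * a))"
    proof (intro AE_I2 impI)
      fix t assume "t \<in> {R..}"
      then have t: "t \<ge> R" by simp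
      have "(cmod (f t))\<^sup>2 \<le> (C * t powr (- a))\<^sup>2"
        using R(2)[OF t] by (intro power_mono) auto
      also have "\<dots> = C\<^sup>2 * t powr (- 2 * a)"
        by (simp add: power_mult_distrib power2_eq_square flip: powr_add)
      finally show "norm ((cmod (f t))\<^sup>2) \<le> norm (C\<^sup>2 * t powr (- 2 * a))" by simp
    qed
  qed
  have ib: "set_integrable lborel {0..R} (\<lambda>t. (cmod (f t))\<^sup>2)"
    by (intro continuous_set_integrable continuous_intros c)
  have ic: "set_integrable lborel ({0..R} \<union> {R..}) (\<lambda>t. (cmod (f t))\<^sup>2)"
    by (intro set_integrable_Un ia ib) auto
  have "l2norm (time_measure T) f \<le> sqrt (LINT t:{0..R} \<union> {R..}|lborel. (cmod (f t))\<^sup>2)" for T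
  proof -
    have "(\<integral>t. (cmod (f t))\<^sup>2 \<partial>time_measure T) = (LINT t:{0<..<T}|lborel. (cmod (f t))\<^sup>2)"
      by (simp add: integral_restrict_space set_lebesgue_integral_def)
    also have "\<dots> \<le> (LINT t:{0..R} \<union> {R..}|lborel. (cmod (f t))\<^sup>2)"
      unfolding set_lebesgue_integral_def
    proof (rule integral_mono)
      have "set_integrable lborel {0<..<T} (\<lambda>t. (cmod (f t))\<^sup>2)"
        by (rule set_integrable_subset[OF ic]) auto
      then show "integrable lborel (\<lambda>t. indicator {0<..<T} t *\<^sub>R (cmod (f t))\<^sup>2)"
        by (simp add: set_integrable_def)
    qed (use ic in \<open>auto simp: set_integrable_def indicator_def\<close>)
    finally show ?thesis unfolding l2norm_def by simp
  qed
  then show "\<exists>K. \<forall>T\<ge>0. l2norm (time_measure T) f \<le> K" by blast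
qed

text \<open>The integrals over the intervals from 0 to \<open>n\<close> increase and stay below
  \<open>C^2\<close>, so monotone convergence applies.\<close>

lemma sq_set_integrable_if_l2norm_bounded:
  assumes c: "continuous_on {0..} f" and C: "\<And>T. 0 \<le> T \<Longrightarrow> l2norm (time_measure T) f \<le> C"
  shows "set_integrable lborel {0<..} (\<lambda>t. (cmod (f t))\<^sup>2)"
proof -
  define I where "I = (\<lambda>n. LINT t:{0<..<real n}|lborel. (cmod (f t))\<^sup>2)"
  have si: "set_integrable lborel {0<..<real n} (\<lambda>t. (cmod (f t))\<^sup>2)" for n
    by (rule set_integrable_subset[OF continuous_set_integrable[of _ "real n"]])
      (auto intro!: continuous_intros c)
  have In: "I n = (l2norm (time_measure (real n)) f)\<^sup>2" for n
    by (simp add: I_def l2norm_power2 integral_restrict_space set_lebesgue_integral_def)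
  have "incseq I"
    unfolding I_def set_lebesgue_integral_def
    by (intro monoI integral_mono si[unfolded set_integrable_def]) (auto simp: indicator_def)
  moreover have "I n \<le> C\<^sup>2" for n
    unfolding In by (intro power_mono C) auto
  ultimately obtain l where l: "I \<longlonglongrightarrow> l"
    using incseq_convergent by metis
  have "set_integrable lborel (\<Union>n. {0<..<real n}) (\<lambda>t. (cmod (f t))\<^sup>2)"
    by (rule pos_integrable_to_top[where l=l]) (use si l in \<open>auto simp: I_def mono_def\<close>)
  moreover have "(\<Union>n. {0<..<real n}) = {0<..}"
    by (auto intro: reals_Archimedean2)
  ultimately show ?thesis by simp
qed

section \<open>From the weak formulation to the flow, and the theorem\<close>

lemma L2_on_half_line: "L2_on half_line f \<longleftrightarrow> sq_integrable half_line_measure f"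
  and L2_norm_half_line: "L2_norm half_line f = l2norm half_line_measure f"
  by (simp_all add: L2_on_iff_sq_integrable L2_norm_eq_l2norm)

text \<open>Continuity in L2 sees only classes modulo null sets, so it passes from the given weak
  derivative \<open>qx\<close> to its continuous representative.\<close>

lemma C0_L2_cong_AE:
  assumes f: "C0_L2 f" and g: "\<And>t. 0 \<le> t \<Longrightarrow> sq_integrable half_line_measure (g t)"
    and eq: "\<And>t. 0 \<le> t \<Longrightarrow> AE x in half_line_measure. f t x = g t x"
  shows "C0_L2 g"
  unfolding C0_L2_def L2_on_half_line L2_norm_half_line
proof (intro allI impI conjI g)
  fix t :: real assume t: "0 \<le> t"
  have fs: "sq_integrable half_line_measure (f s)" if "0 \<le> s" for s
    using f that by (auto simp: C0_L2_def L2_on_half_line)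
  have "l2norm half_line_measure (\<lambda>x. f s x - f t x) = l2norm half_line_measure (\<lambda>x. g s x - g t x)" if s: "0 \<le> s" for s
  proof (rule l2norm_cong_AE)
    show "AE x in half_line_measure. f s x - f t x = g s x - g t x"
      using eq[OF s] eq[OF t] by eventually_elim simp
  qed (use sq_integrable_diff[OF fs[OF s] fs[OF t]] sq_integrable_diff[OF g[OF s] g[OF t]]
      in \<open>auto simp: sq_integrable_def\<close>)
  then have "\<forall>\<^sub>F s in at t within {0..}. l2norm half_line_measure (\<lambda>x. f s x - f t x)
      = l2norm half_line_measure (\<lambda>x. g s x - g t x)"
    by (auto simp: eventually_at_filter)
  moreover have "((\<lambda>s. l2norm half_line_measure (\<lambda>x. f s x - f t x)) \<longlongrightarrow> 0) (at t within {0..})"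
    using f t by (auto simp: C0_L2_def L2_norm_half_line)
  ultimately show "((\<lambda>s. l2norm half_line_measure (\<lambda>x. g s x - g t x)) \<longlongrightarrow> 0) (at t within {0..})"
    by (rule Lim_transform_eventually[rotated])
qed

lemma nls_solution_flow:
  assumes Q: "C2_half_line Q" and sol: "nls_solution lam Q q"
  shows "\<exists>p r ut Q'. nls_flow lam (\<lambda>t x. q x t) p r ut Q Q' \<and>
    (\<forall>t\<ge>0. \<forall>x\<ge>0. dx q x t = p t x) \<and> (\<forall>t\<ge>0. dt q 0 t = Q' t)"
proof -
  obtain qt qx qxx where qc: "\<And>t. 0 \<le> t \<Longrightarrow> continuous_on {0..} (\<lambda>x. q x t)"
    and C1: "C1_L2 (\<lambda>t x. q x t) qt" and H2: "C0_H2 (\<lambda>t x. q x t) qx qxx"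
    and eq: "\<And>t. 0 < t \<Longrightarrow> AE x in lborel. x > 0 \<longrightarrow>
           \<i> * qt t x + qxx t x - 2 * of_real lam * of_real ((cmod (q x t))\<^sup>2) * q x t = 0"
    and init: "\<And>x. 0 \<le> x \<Longrightarrow> q x 0 = 0" and bdry: "\<And>t. 0 \<le> t \<Longrightarrow> q 0 t = Q t"
    using sol unfolding nls_solution_def by blast
  obtain Q' Q'' where Q': "\<And>t. 0 \<le> t \<Longrightarrow> (Q has_vector_derivative Q' t) (at t within {0..})"
    "\<And>t. 0 \<le> t \<Longrightarrow> (Q' has_vector_derivative Q'' t) (at t within {0..})"
    using Q unfolding C2_half_line_def by blast
  have C0: "C0_L2 (\<lambda>t x. q x t)" "C0_L2 qx" "C0_L2 qxx"
    and wd: "\<And>t. 0 \<le> t \<Longrightarrow> weak_derivative (\<lambda>x. q x t) (qx t)" "\<And>t. 0 \<le> t \<Longrightarrow> weak_derivative (qx t) (qxx t)"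
    using H2 by (auto simp: C0_H2_def)
  have sq: "sq_integrable half_line_measure (\<lambda>x. q x t)" "sq_integrable half_line_measure (qx t)"
    "sq_integrable half_line_measure (qxx t)" if "0 \<le> t" for t
    using C0 that by (auto simp: C0_L2_def L2_on_half_line)
  \<comment> \<open>A representative is chosen separately at each time; its regularity in time is
    recovered afterwards from that of \<open>qx\<close>.\<close>
  have "\<forall>t. \<exists>p. 0 \<le> t \<longrightarrow> sobolev1 p (qxx t) \<and> (AE x in half_line_measure. qx t x = p x)"
    using weak_derivative_representative[OF wd(2) sq(2,3)] by blast
  then obtain p where p: "\<And>t. 0 \<le> t \<Longrightarrow> sobolev1 (p t) (qxx t)"
    "\<And>t. 0 \<le> t \<Longrightarrow> AE x in half_line_measure. qx t x = p t x"
    by metis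
  have psq: "sq_integrable half_line_measure (p t)" if "0 \<le> t" for t
    by (rule sobolev1_sq_integrable(1)[OF p(1)[OF that]])
  have u: "sobolev1 (\<lambda>x. q x t) (p t)" if t: "0 \<le> t" for t
    by (rule sobolev1_cong_AE[OF weak_derivative_continuous_sobolev1[OF wd(1)[OF t] sq(1,2)[OF t] qc[OF t]] psq[OF t] p(2)[OF t]])
  have "nls_flow lam (\<lambda>t x. q x t) p qxx qt Q Q'"
  proof
    show "C0_L2 p" by (rule C0_L2_cong_AE[OF C0(2) psq p(2)])
    show "continuous_on {0..} Q'"
      unfolding continuous_on_eq_continuous_within
      using Q'(2) by (meson atLeast_iff has_vector_derivative_continuous)
    fix t :: real assume t: "0 < t"
    have "AE x in half_line_measure.
        \<i> * qt t x + qxx t x - 2 * of_real lam * of_real ((cmod (q x t))\<^sup>2) * q x t = 0"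
      using eq[OF t] by (simp add: AE_restrict_space_iff)
    then show "AE x in half_line_measure. qt t x = \<i> * (qxx t x - 2 * of_real lam * (q x t * cnj (q x t) * q x t))"
    proof eventually_elim
      case (elim x)
      then have "\<i> * qt t x = - (qxx t x - 2 * of_real lam * (q x t * cnj (q x t) * q x t))"
        unfolding complex_norm_square by (simp add: algebra_simps eq_neg_iff_add_eq_0)
      \<comment> \<open>Multiplication by \<open>- \<i>\<close> solves the equation for
        \<open>qt\<close>.\<close>
      then have "- (\<i> * (\<i> * qt t x)) = \<i> * (qxx t x - 2 * of_real lam * (q x t * cnj (q x t) * q x t))"
        by (simp only: mult_minus_right minus_minus)
      then show ?case by (simp flip: mult.assoc)
    qed
  qed (use u p C1 C0 init bdry Q' in auto)
  moreover have "dx q x t = p t x" if "0 \<le> t" "0 \<le> x" for x t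
    unfolding dx_def
    by (rule vector_derivative_within[OF at_within_atLeast_neq_bot[OF that(2)]
          sobolev1_has_vector_derivative[OF u[OF that(1)] sobolev1_continuous[OF p(1)[OF that(1)]] that(2)]])
  moreover have "dt q 0 t = Q' t" if "0 \<le> t" for t
    unfolding dt_def
  proof (rule vector_derivative_within[OF at_within_atLeast_neq_bot[OF that]])
    show "((\<lambda>s. q 0 s) has_vector_derivative Q' t) (at t within {0..})"
      by (rule has_vector_derivative_transform[OF _ _ Q'(1)[OF that]]) (use that bdry in auto)
  qed
  ultimately show ?thesis by blast
qed

theorem mainTheorem2:
  fixes lam :: real
  assumes "lam \<noteq> 0"
  shows "\<exists>\<epsilon>>0. \<forall>(Q :: real \<Rightarrow> complex) (q :: real \<Rightarrow> real \<Rightarrow> complex) (\<alpha> :: real) (\<beta> :: real).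
    C2_half_line Q \<longrightarrow> Q 0 = 0 \<longrightarrow> nls_solution lam Q q \<longrightarrow>
    (lam < 0 \<longrightarrow> (\<exists>c2>0. c2 < \<epsilon> \<and> (\<forall>t\<ge>0. (L2_norm {0<..<t} (\<lambda>s. q 0 s))\<^sup>2 \<le> c2))) \<longrightarrow>
    \<alpha> > 1/2 \<longrightarrow> \<beta> > 1/2 \<longrightarrow>
    (\<lambda>t. q 0 t) \<in> O[at_top](\<lambda>t. of_real (t powr (-\<alpha>))) \<longrightarrow>
    (\<lambda>t. dt q 0 t) \<in> O[at_top](\<lambda>t. of_real (t powr (-\<beta>))) \<longrightarrow>
    set_integrable lborel {0<..} (\<lambda>t. (cmod (dx q 0 t))\<^sup>2) \<and>
    (\<exists>c>0. \<forall>t\<ge>0.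
       L2_on half_line (\<lambda>x. q x t) \<and> L2_norm half_line (\<lambda>x. q x t) \<le> c \<and>
       L2_on half_line (\<lambda>x. dx q x t) \<and> L2_norm half_line (\<lambda>x. dx q x t) \<le> c) \<and>
    (\<exists>c>0. \<exists>c'>0.
       (\<forall>t\<ge>0. \<forall>x\<ge>0.
          cmod (q x t) \<le> c * sqrt (L2_norm half_line (\<lambda>x. q x t)) * sqrt (L2_norm half_line (\<lambda>x. dx q x t)) \<and>
          c * sqrt (L2_norm half_line (\<lambda>x. q x t)) * sqrt (L2_norm half_line (\<lambda>x. dx q x t)) \<le> c') \<and>
       (\<forall>x\<ge>0. \<forall>l. ((\<lambda>t. cmod (q x t)) \<longlongrightarrow> l) at_top \<longrightarrow> l \<le> c'))"
\<comment> \<open>The threshold is the condition \<open>16 * L * A^2 \<le> 1\<close> of the flux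
  bound, read for \<open>A = sqrt c2\<close>.\<close>
proof (rule exI[of _ "1 / (16 * \<bar>lam\<bar>)"], intro conjI allI impI)
  show "0 < 1 / (16 * \<bar>lam\<bar>)" using assms by simp
next
  fix Q :: "real \<Rightarrow> complex" and q :: "real \<Rightarrow> real \<Rightarrow> complex" and \<alpha> \<beta> :: real
  assume Q: "C2_half_line Q" and sol: "nls_solution lam Q q"
    and small: "lam < 0 \<longrightarrow> (\<exists>c2>0. c2 < 1 / (16 * \<bar>lam\<bar>) \<and> (\<forall>t\<ge>0. (L2_norm {0<..<t} (\<lambda>s. q 0 s))\<^sup>2 \<le> c2))"
    and \<alpha>: "\<alpha> > 1/2" and \<beta>: "\<beta> > 1/2"
    and O: "(\<lambda>t. q 0 t) \<in> O[at_top](\<lambda>t. of_real (t powr (-\<alpha>)))"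
      "(\<lambda>t. dt q 0 t) \<in> O[at_top](\<lambda>t. of_real (t powr (-\<beta>)))"
  obtain p r ut Q' where flow: "nls_flow lam (\<lambda>t x. q x t) p r ut Q Q'"
    and dx: "\<And>t x. 0 \<le> t \<Longrightarrow> 0 \<le> x \<Longrightarrow> dx q x t = p t x" and dt: "\<And>t. 0 \<le> t \<Longrightarrow> dt q 0 t = Q' t"
    using nls_solution_flow[OF Q sol] by blast
  interpret nls_flow lam "\<lambda>t x. q x t" p r ut Q Q' by (rule flow)
  have OQ: "Q \<in> O[at_top](\<lambda>t. of_real (t powr (-\<alpha>)))"
    using O(1) boundary by (subst (asm) landau_o.big.in_cong)
      (auto intro: eventually_mono[OF eventually_ge_at_top[of 0]])
  have OQ': "Q' \<in> O[at_top](\<lambda>t. of_real (t powr (-\<beta>)))"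
    using O(2) dt by (subst (asm) landau_o.big.in_cong)
      (auto intro: eventually_mono[OF eventually_ge_at_top[of 0]])
  obtain B where B: "\<And>T. 0 \<le> T \<Longrightarrow> l2norm (time_measure T) Q' \<le> B"
    using decay_sq_integrable(1)[OF Q'_continuous \<beta> OQ'] by blast
  obtain M where M: "\<And>t. 0 \<le> t \<Longrightarrow> cmod (Q t) \<le> M"
    using decay_sq_integrable(2)[OF Q_continuous \<alpha> OQ] by blast
  \<comment> \<open>Decay yields some bound \<open>A\<close>, which need not be small. For
    \<open>lam < 0\<close> it must be \<open>sqrt c2\<close>, the only bound known to meet the
    smallness condition.\<close>
  have "\<exists>A. (\<forall>T\<ge>0. l2norm (time_measure T) Q \<le> A) \<and> (lam < 0 \<longrightarrow> 16 * \<bar>lam\<bar> * A\<^sup>2 \<le> 1)"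
  proof (cases "lam < 0")
    case True
    then obtain c2 where c2: "c2 > 0" "c2 < 1 / (16 * \<bar>lam\<bar>)"
      "\<And>t. 0 \<le> t \<Longrightarrow> (L2_norm {0<..<t} (\<lambda>s. q 0 s))\<^sup>2 \<le> c2"
      using small by blast
    have "l2norm (time_measure T) Q \<le> sqrt c2" if T: "0 \<le> T" for T
    proof -
      have "l2norm (time_measure T) Q = L2_norm {0<..<T} (\<lambda>s. q 0 s)"
        unfolding L2_norm_eq_l2norm[OF borel_open[OF open_greaterThanLessThan]]
        by (rule l2norm_cong) (auto simp: space_restrict_space boundary)
      then show ?thesis using c2(3)[OF T] by (intro real_le_rsqrt) simp
    qed
    moreover have "16 * \<bar>lam\<bar> * (sqrt c2)\<^sup>2 \<le> 1"
      using c2(1,2) assms by (simp add: field_simps)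
    ultimately show ?thesis by blast
  next
    case False
    then show ?thesis using decay_sq_integrable(1)[OF Q_continuous \<alpha> OQ] by auto
  qed
  then obtain A where A: "\<And>T. 0 \<le> T \<Longrightarrow> l2norm (time_measure T) Q \<le> A" "lam < 0 \<Longrightarrow> 16 * \<bar>lam\<bar> * A\<^sup>2 \<le> 1"
    by blast
  obtain C where C: "\<And>T. 0 \<le> T \<Longrightarrow> l2norm (time_measure T) g \<le> C"
    "\<And>T. 0 \<le> T \<Longrightarrow> l2norm H (\<lambda>x. q x T) \<le> C" "\<And>T. 0 \<le> T \<Longrightarrow> l2norm H (p T) \<le> C"
    using uniform_bounds[OF A(1) B M A(2)] by blast
  \<comment> \<open>The constants of the theorem must be positive, while \<open>C\<close> could be
    0.\<close>
  define D where "D = max C 1"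
  have D: "D > 0" "C \<le> D" by (auto simp: D_def)
  have dxsq: "L2_on half_line (\<lambda>x. dx q x t)" and dxn: "L2_norm half_line (\<lambda>x. dx q x t) = l2norm H (p t)"
    if t: "0 \<le> t" for t
  proof -
    have e: "\<And>x. x \<in> space H \<Longrightarrow> dx q x t = p t x"
      using dx[OF t] by (auto simp: space_restrict_space)
    show "L2_on half_line (\<lambda>x. dx q x t)" "L2_norm half_line (\<lambda>x. dx q x t) = l2norm H (p t)"
      unfolding L2_on_half_line L2_norm_half_line
      using sq_integrable_cong[where M=H, OF e] l2norm_cong[where M=H, OF e] p_sq[OF t] by auto
  qed
  have s: "cmod (q x t) \<le> sqrt 2 * sqrt (L2_norm half_line (\<lambda>x. q x t)) * sqrt (L2_norm half_line (\<lambda>x. dx q x t))"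
    "sqrt 2 * sqrt (L2_norm half_line (\<lambda>x. q x t)) * sqrt (L2_norm half_line (\<lambda>x. dx q x t)) \<le> sqrt 2 * D"
    if t: "0 \<le> t" and x: "0 \<le> x" for t x
    unfolding dxn[OF t] unfolding L2_norm_half_line
  proof -
    have "cmod (q x t) \<le> sqrt (2 * l2norm H (\<lambda>x. q x t) * l2norm H (p t))"
      by (rule real_le_rsqrt[OF sobolev1_sup_bound[OF u_sobolev[OF t] x]])
    then show "cmod (q x t) \<le> sqrt 2 * sqrt (l2norm H (\<lambda>x. q x t)) * sqrt (l2norm H (p t))"
      by (simp add: real_sqrt_mult)
    have "sqrt (l2norm H (\<lambda>x. q x t)) * sqrt (l2norm H (p t)) \<le> sqrt D * sqrt D"
      using C(2,3)[OF t] D by (intro mult_mono) auto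
    then show "sqrt 2 * sqrt (l2norm H (\<lambda>x. q x t)) * sqrt (l2norm H (p t)) \<le> sqrt 2 * D"
      using D by simp
  qed
  show "set_integrable lborel {0<..} (\<lambda>t. (cmod (dx q 0 t))\<^sup>2)"
  proof -
    have "set_integrable lborel {0<..} (\<lambda>t. (cmod (g t))\<^sup>2)"
      by (rule sq_set_integrable_if_l2norm_bounded[OF boundary_derivative_continuous C(1)])
    also have "?this \<longleftrightarrow> ?thesis"
      by (rule set_integrable_cong) (auto simp: dx)
    finally show ?thesis .
  qed
  show "\<exists>c>0. \<forall>t\<ge>0.
       L2_on half_line (\<lambda>x. q x t) \<and> L2_norm half_line (\<lambda>x. q x t) \<le> c \<and>
       L2_on half_line (\<lambda>x. dx q x t) \<and> L2_norm half_line (\<lambda>x. dx q x t) \<le> c"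
    using D C(2,3) u_sq dxsq dxn
    by (intro exI[of _ D]) (auto simp: L2_on_half_line L2_norm_half_line intro: order_trans)
  show "\<exists>c>0. \<exists>c'>0.
       (\<forall>t\<ge>0. \<forall>x\<ge>0.
          cmod (q x t) \<le> c * sqrt (L2_norm half_line (\<lambda>x. q x t)) * sqrt (L2_norm half_line (\<lambda>x. dx q x t)) \<and>
          c * sqrt (L2_norm half_line (\<lambda>x. q x t)) * sqrt (L2_norm half_line (\<lambda>x. dx q x t)) \<le> c') \<and>
       (\<forall>x\<ge>0. \<forall>l. ((\<lambda>t. cmod (q x t)) \<longlongrightarrow> l) at_top \<longrightarrow> l \<le> c')"
  \<comment> \<open>\<open>sqrt 2\<close> is the root of the factor in the sup bound, and
    \<open>sqrt 2 * D\<close> results from bounding both norms by \<open>D\<close>.\<close>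
  proof (rule exI[of _ "sqrt 2"], rule conjI, simp, rule exI[of _ "sqrt 2 * D"], intro conjI allI impI)
    fix x l assume x: "0 \<le> (x::real)" and l: "((\<lambda>t. cmod (q x t)) \<longlongrightarrow> l) at_top"
    have "\<forall>\<^sub>F t in at_top. cmod (q x t) \<le> sqrt 2 * D"
      using eventually_ge_at_top[of 0] by eventually_elim (rule order_trans[OF s(1) s(2)]; use x in simp)
    then show "l \<le> sqrt 2 * D"
      by (rule tendsto_upperbound[OF l]) simp
  next
    show "0 < sqrt 2 * D" using D by simp
  qed (rule s; assumption)+
qed

end
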